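(* Let $f(x,\xi)=h(c(x,\xi))$ and $\omega$ satisfy: (i) the samples $\xi^k$ are drawn i.i.d. from $\Xi$; (ii) $\omega$ is $L_\omega$-Lipschitz continuous over its domain; (iii) $\omega$ is $\kappa$-weakly convex; (iv) $h:\mathbb{R}\to\mathbb{R}$ is convex and $L_h$-Lipschitz continuous, $c(\cdot,\xi):\mathbb{R}^n\to\mathbb{R}$ has $C(\xi)$-Lipschitz continuous gradient and is $L_c(\xi)$-Lipschitz continuous over $\operatorname{dom}\omega$, with $\mathbb{E}_\xi[C(\xi)^2]\le C^2$ and $\mathbb{E}_\xi[L_c(\xi)^2]\le L_c^2$; (v) the delays $\tau_k$ arise in a distributed environment with $m$ workers. Put $L_f=L_hL_c$ and $\lambda=L_hC$. Let $\rho>2\lambda+\kappa$, $r>0$, and let either $\beta>0$ and $K>r^{1/\beta}$, or $\beta=0$ and $r<1$. Run the safeguarded DSPL with threshold $T=r^{-1}mK^\beta$ and $$\gamma_k\equiv\gamma=\frac{\sqrt{K}}{\alpha\sqrt{\eta}}+\rho+\kappa+6\lambda,\qquad \eta=1+\frac{r}{K^\beta-r},$$ for some $\alpha>0$, and let $k^*$ be chosen uniformly at random among the iterations $k\in\{1,\dots,K\}$ with $\tau_k\le T$. Then $$\mathbb{E}\big[\|\nabla\psi_{1/\rho}(x^{k^*})\|^2\big]\le\frac{2\rho}{\rho-2\lambda-\kappa}\left[\frac{\eta(\rho+4\lambda)D}{K}+\frac{\sqrt{\eta}\,D}{\sqrt{K}\,\alpha}+\frac{2\sqrt{\eta}\,\rho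 L_f^2\alpha}{\sqrt{K}}+\frac{6\eta^2\rho\lambda(L_f+L_\omega)^2m^2\alpha^2}{rK^{1-\beta}}\right],$$ where $D=\psi_{1/\rho}(x^1)-\inf_x\psi(x)$.
   Context: Problem: $\min_{x\in\mathbb{R}^n}\psi(x):=f(x)+\omega(x)$ with $f(x):=\mathbb{E}_{\xi\sim\Xi}[f(x,\xi)]$ and $\omega$ lower semicontinuous. A function $g$ is $\kappa$-weakly convex if $g+\frac{\kappa}{2}\|\cdot\|^2$ is convex ($\kappa\ge0$). Partial linearization: $f_z(x,\xi):=h\big(c(z,\xi)+\langle\nabla c(z,\xi),x-z\rangle\big)$. Moreau envelope (for $\rho$ larger than the weak convexity constant of $\psi$): $\psi_{1/\rho}(x)=\min_y\{\psi(y)+\frac{\rho}{2}\|x-y\|^2\}$, $\operatorname{prox}_{\psi/\rho}(x)=\arg\min_y\{\psi(y)+\frac{\rho}{2}\|x-y\|^2\}$; $\nabla\psi_{1/\rho}(x)=\rho(x-\operatorname{prox}_{\psi/\rho}(x))$. Safeguarded DSPL: given $x^1\in\operatorname{dom}\omega$, for $k=1,\dots,K$: if $\tau_k\le T$, set $x^{k+1}=\arg\min_{x}\{f_{x^{k-\tau_k}}(x,\xi^{k-\tau_k})+\omega(x)+\frac{\gamma_k}{2}\|x-x^k\|^2\}$; otherwise set $x^{k+1}=x^k$. Delays in an environment with $m$ workers: each worker carries a delay counter, initially $0$. At iteration $k$ the master uses the information sent by one worker; $\tau_k$ is the current value of that worker's counter. After iteration $k$ this worker's counter is reset to $0$ and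 the counters of the other $m-1$ workers each increase by $1$. The delay sequence is regarded as pre-defined, independent of the data sampling and of the algorithm; the expectation is over the samples and $k^*$ with the delay sequence given. Convention: $x^{k-j}=x^1$ if $j\ge k$. The sample $\xi^{k-\tau_k}$ used at iteration $k$ is a draw from $\Xi$ independent of $x^1,\dots,x^k$. *)

theory Defs
  imports "HOL-Probability.Probability"
begin

text \<open>Extended-valued functions: the regularizer takes the value \<open>\<infinity>\<close> outside its domain and is
  required separately never to be \<open>-\<infinity>\<close>.\<close>

definition edom :: "('a \<Rightarrow> ereal) \<Rightarrow> 'a set" where
  "edom g = {x. g x < \<infinity>}"

definition lower_semicontinuous :: "('a::topological_space \<Rightarrow> ereal) \<Rightarrow> bool" where
  "lower_semicontinuous g \<longleftrightarrow> (\<forall>x. g x \<le> Liminf (at x) g)"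

definition ereal_convex :: "('a::real_vector \<Rightarrow> ereal) \<Rightarrow> bool" where
  "ereal_convex g \<longleftrightarrow>
     (\<forall>x y. \<forall>u\<ge>0. \<forall>v\<ge>0. u + v = 1 \<longrightarrow>
        g (u *\<^sub>R x + v *\<^sub>R y) \<le> ereal u * g x + ereal v * g y)"

definition weakly_convex :: "real \<Rightarrow> ('a::real_normed_vector \<Rightarrow> ereal) \<Rightarrow> bool" where
  "weakly_convex \<kappa> g \<longleftrightarrow>
     \<kappa> \<ge> 0 \<and> ereal_convex (\<lambda>x. g x + ereal (\<kappa> / 2 * (norm x)\<^sup>2))"

text \<open>Meaningful only where \<open>f\<close> is differentiable.\<close>

definition gradient :: "('a::real_inner \<Rightarrow> real) \<Rightarrow> 'a \<Rightarrow> 'a" where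
  "gradient f x = (THE g. GDERIV f x :> g)"

definition objective ::
  "'s measure \<Rightarrow> (real \<Rightarrow> real) \<Rightarrow> ('a \<Rightarrow> 's \<Rightarrow> real) \<Rightarrow> ('a \<Rightarrow> ereal) \<Rightarrow> 'a \<Rightarrow> ereal" where
  "objective \<Xi> h c \<omega> x = ereal (\<integral>\<xi>. h (c x \<xi>) \<partial>\<Xi>) + \<omega> x"

definition partial_linearization ::
  "(real \<Rightarrow> real) \<Rightarrow> ('a::real_inner \<Rightarrow> 's \<Rightarrow> real) \<Rightarrow> 'a \<Rightarrow> 'a \<Rightarrow> 's \<Rightarrow> real" where
  "partial_linearization h c z x \<xi> = h (c z \<xi> + gradient (\<lambda>u. c u \<xi>) z \<bullet> (x - z))"

text \<open>\<open>moreau_envelope \<rho> g\<close> is the envelope usually written with index \<open>1/\<rho>\<close>.\<close>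

definition moreau_envelope ::
  "real \<Rightarrow> ('a::real_normed_vector \<Rightarrow> ereal) \<Rightarrow> 'a \<Rightarrow> ereal" where
  "moreau_envelope \<rho> g x = (INF y. g y + ereal (\<rho> / 2 * (norm (x - y))\<^sup>2))"

text \<open>\<open>w k\<close> is the worker whose information is used at iteration \<open>k\<close> (\<open>k \<ge> 1\<close>), and
  \<open>worker_counter w k i\<close> is the counter of worker \<open>i\<close> after iteration \<open>k\<close>. The delay at
  iteration \<open>k\<close> is therefore read off after iteration \<open>k - 1\<close>.\<close>

primrec worker_counter :: "(nat \<Rightarrow> nat) \<Rightarrow> nat \<Rightarrow> nat \<Rightarrow> nat" where
  "worker_counter w 0 i = 0"
| "worker_counter w (Suc k) i = (if i = w (Suc k) then 0 else Suc (worker_counter w k i))"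

definition delay :: "(nat \<Rightarrow> nat) \<Rightarrow> nat \<Rightarrow> nat" where
  "delay w k = worker_counter w (k - 1) (w k)"

text \<open>One realization of the safeguarded method. \<open>\<xi> k\<close> is the sample used at iteration \<open>k\<close>,
  i.e. the one drawn by the worker along with the point \<open>x\<close> of index \<open>k - \<tau> k\<close>.
  It is indexed by the iteration using it because workers that have not yet reported all
  hold the point of index \<open>1\<close>, but each with its own draw.
  The \<open>max 1\<close> is the convention that indices below \<open>1\<close> refer to the initial point.\<close>

definition safeguarded_dspl ::
  "(real \<Rightarrow> real) \<Rightarrow> ('a::real_inner \<Rightarrow> 's \<Rightarrow> real) \<Rightarrow> ('a \<Rightarrow> ereal) \<Rightarrow>
     real \<Rightarrow> real \<Rightarrow> (nat \<Rightarrow> nat) \<Rightarrow> nat \<Rightarrow> 'a \<Rightarrow> (nat \<Rightarrow> 's) \<Rightarrow> (nat \<Rightarrow> 'a) \<Rightarrow> bool" where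
  "safeguarded_dspl h c \<omega> \<gamma> T \<tau> K x1 \<xi> x \<longleftrightarrow>
     x 1 = x1 \<and>
     (\<forall>k\<in>{1..K}.
        if real (\<tau> k) \<le> T
        then is_arg_min
               (\<lambda>y. ereal (partial_linearization h c (x (max 1 (k - \<tau> k))) y (\<xi> k)) + \<omega> y
                    + ereal (\<gamma> / 2 * (norm (y - x k))\<^sup>2))
               (\<lambda>_. True) (x (Suc k))
        else x (Suc k) = x k)"

end

theory Submission
  imports Defs
begin

text \<open>
  Write \<open>\<lambda> = L\<^sub>h C\<close>, \<open>f\<close> for the expected loss, \<open>\<psi> = f + \<omega>\<close>, \<open>E\<close> for the Moreau envelope of \<open>\<psi>\<close> with parameter \<open>\<rho>\<close>, and
  \<open>x\<^sup>*\<close> for the proximal point at \<open>x\<close>, the minimizer of \<open>\<psi> + \<rho>/2 \<parallel>\<cdot> - x\<parallel>\<^sup>2\<close>. Then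
  \<open>\<nabla>E(x) = \<rho> (x - x\<^sup>*)\<close> (lemma \<open>GDERIV_env\<close>), so the task is to bound the mean squared distance of the
  iterates to their own proximal points. The envelope serves as Lyapunov function.

  In a single iteration, let the point \<open>u\<close> be computed from \<open>e\<close> with a model linearized at a stale point \<open>z\<close>. The
  regularized model is strongly convex with minimizer \<open>u\<close>, the regularized objective is strongly convex
  with minimizer \<open>e\<^sup>*\<close>. Testing each minimization with the minimizer of the other and adding, one finds
  that \<open>u\<close> is closer to \<open>e\<^sup>*\<close> than \<open>e\<close>, up to errors. The linearization error, of size
  \<open>L\<^sub>h C\<^sub>\<xi>/2\<close> times a squared distance to \<open>z\<close>, must not be evaluated at \<open>u\<close>: both \<open>C\<^sub>\<xi>\<close> and \<open>u\<close> depend on the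
  sample, and only moments of \<open>C\<^sub>\<xi>\<close> alone are bounded. It is therefore evaluated at \<open>e\<close> and \<open>e\<^sup>*\<close>, and the
  passage from \<open>e\<close> to \<open>u\<close> is paid by Lipschitz continuity; completing the square in \<open>\<parallel>u - e\<parallel>\<close> turns this
  payment into \<open>2 L\<^sub>f\<^sup>2/\<delta>\<close> with \<open>\<delta> = \<gamma> - \<rho> - \<kappa> - 6 \<lambda> = \<surd>K/(\<alpha> \<surd>\<eta>)\<close>. Because \<open>E(u) \<le> \<psi>(e\<^sup>*) + \<rho>/2 \<parallel>e\<^sup>* - u\<parallel>\<^sup>2\<close>,
  the outcome is an expected decrease of \<open>E\<close> by a multiple of \<open>\<parallel>e - e\<^sup>*\<parallel>\<^sup>2\<close>, up to the constant
  \<open>2 L\<^sub>f\<^sup>2/\<delta>\<close> and the staleness \<open>3/2 \<lambda> \<parallel>e - z\<parallel>\<^sup>2\<close> (lemma \<open>one_step_expected\<close>).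

  To sum up these estimates, note that the current and the stale point are measurable functions of the samples used before, hence
  independent of the sample in use (lemmas \<open>x_factors_through_history\<close> and \<open>expected_step_conditional\<close>), and
  the one-step inequality may be integrated. Skipped iterations leave the iterate in place, so \<open>E\<close>
  telescopes. The stale point is at most \<open>\<tau>\<^sub>k\<close> steps away, each step having second moment at most
  \<open>((L\<^sub>f + L\<^sub>\<omega>)/(\<gamma> - \<kappa>/2))\<^sup>2\<close>, so the mean squared staleness is of order \<open>\<tau>\<^sub>k\<^sup>2\<close>
  (lemma \<open>expected_staleness\<close>).

  It remains to count delays. The sum of the counters grows by \<open>m - 1\<close> and drops by \<open>\<tau>\<^sub>k\<close> in iteration \<open>k\<close>; hence the delays
  sum up to at most \<open>m K\<close>. Consequently at most \<open>m K/T\<close> iterations are skipped, at least \<open>K/\<eta>\<close> are not, and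
  over the latter \<open>\<Sum> \<tau>\<^sub>k\<^sup>2 \<le> T m K\<close>. Averaging over the timely iterations, which is what the random index
  does, gives the stated rate.
\<close>


section \<open>Weak convexity and proximal points\<close>

text \<open>
  On a convex set this says that \<open>F + \<mu>/2 \<parallel>\<cdot>\<parallel>\<^sup>2\<close> is convex. The defect of the chord inequality is
  spelled out because in this form the notion is visibly additive and survives integration over a
  parameter. A negative \<open>\<mu>\<close> expresses strong convexity.
\<close>

definition weakly_convex_on :: "real \<Rightarrow> 'a::real_inner set \<Rightarrow> ('a \<Rightarrow> real) \<Rightarrow> bool" where
  "weakly_convex_on \<mu> A F \<longleftrightarrow>
     (\<forall>a\<in>A. \<forall>b\<in>A. \<forall>t\<in>{0..1}.
        F ((1 - t) *\<^sub>R a + t *\<^sub>R b)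
          \<le> (1 - t) * F a + t * F b + \<mu> / 2 * (t * (1 - t)) * (norm (a - b))\<^sup>2)"

lemma norm_convex_combination:
  fixes a b x :: "'a::real_inner"
  shows "(norm ((1 - t) *\<^sub>R a + t *\<^sub>R b - x))\<^sup>2
    = (1 - t) * (norm (a - x))\<^sup>2 + t * (norm (b - x))\<^sup>2 - t * (1 - t) * (norm (a - b))\<^sup>2"
proof -
  have "(1 - t) *\<^sub>R a + t *\<^sub>R b - x = (1 - t) *\<^sub>R (a - x) + t *\<^sub>R (b - x)" "a - b = (a - x) - (b - x)"
    by (simp_all add: algebra_simps)
  then show ?thesis
    by (simp only: power2_norm_eq_inner)
       (simp add: inner_add inner_diff inner_commute algebra_simps power2_eq_square)
qed

text \<open>
  The defect of the squared norm is exactly \<open>t (1 - t) \<parallel>a - b\<parallel>\<^sup>2\<close>, so a quadratic with coefficient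
  \<open>q/2\<close> lowers the weak convexity constant of any summand by \<open>q\<close>.
\<close>

lemma weakly_convex_on_square: "weakly_convex_on (- q) A (\<lambda>y. q / 2 * (norm (y - x))\<^sup>2)"
proof -
  have "s * ((1 - t) * u + t * v - t * (1 - t) * w)
      \<le> (1 - t) * (s * u) + t * (s * v) + - s * (t * (1 - t)) * w" for s t u v w :: real
    by (simp add: algebra_simps)
  then show ?thesis
    unfolding weakly_convex_on_def norm_convex_combination minus_divide_left[symmetric] by blast
qed

lemma weakly_convex_on_add:
  assumes "weakly_convex_on \<mu> A F" "weakly_convex_on \<nu> A G"
  shows "weakly_convex_on (\<mu> + \<nu>) A (\<lambda>y. F y + G y)"
  unfolding weakly_convex_on_def
proof (intro ballI)
  fix a b t assume "a \<in> A" "b \<in> A" "t \<in> {0..1::real}"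
  with assms have
    "F ((1 - t) *\<^sub>R a + t *\<^sub>R b) \<le> (1 - t) * F a + t * F b + \<mu> / 2 * (t * (1 - t)) * (norm (a - b))\<^sup>2"
    "G ((1 - t) *\<^sub>R a + t *\<^sub>R b) \<le> (1 - t) * G a + t * G b + \<nu> / 2 * (t * (1 - t)) * (norm (a - b))\<^sup>2"
    unfolding weakly_convex_on_def by blast+
  then show "F ((1 - t) *\<^sub>R a + t *\<^sub>R b) + G ((1 - t) *\<^sub>R a + t *\<^sub>R b)
      \<le> (1 - t) * (F a + G a) + t * (F b + G b) + (\<mu> + \<nu>) / 2 * (t * (1 - t)) * (norm (a - b))\<^sup>2"
    by (simp add: algebra_simps add_divide_distrib)
qed

text \<open>
  The minimizer is compared with the points of the segment towards \<open>y\<close>; dividing by \<open>t\<close> and letting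
  the point return to the minimizer leaves the full quadratic gap.
\<close>

lemma strongly_convex_minimizer_gap:
  assumes G: "weakly_convex_on (- \<sigma>) A G" and A: "convex A"
    and p: "p \<in> A" "\<And>y. y \<in> A \<Longrightarrow> G p \<le> G y" and y: "y \<in> A"
  shows "G p + \<sigma> / 2 * (norm (y - p))\<^sup>2 \<le> G y"
proof (rule tendsto_upperbound)
  show "((\<lambda>t. G p + \<sigma> / 2 * (1 - t) * (norm (y - p))\<^sup>2) \<longlongrightarrow> G p + \<sigma> / 2 * (norm (y - p))\<^sup>2) (at_right 0)"
    by (auto intro!: tendsto_eq_intros)
  have "G p + \<sigma> / 2 * (1 - t) * (norm (y - p))\<^sup>2 \<le> G y" if t: "0 < t" "t < 1" for t
  proof -
    have "(1 - t) *\<^sub>R p + t *\<^sub>R y \<in> A"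
      using A p(1) y t by (simp add: convex_alt)
    then have "G p \<le> G ((1 - t) *\<^sub>R p + t *\<^sub>R y)"
      by (rule p(2))
    also have "\<dots> \<le> (1 - t) * G p + t * G y - \<sigma> / 2 * (t * (1 - t)) * (norm (p - y))\<^sup>2"
    proof -
      have "t \<in> {0..1}" using t by simp
      then show ?thesis
        using G p(1) y unfolding weakly_convex_on_def by fastforce
    qed
    finally have "t * (G p + \<sigma> / 2 * (1 - t) * (norm (y - p))\<^sup>2) \<le> t * G y"
      by (simp add: algebra_simps norm_minus_commute)
    with t show ?thesis by simp
  qed
  then show "\<forall>\<^sub>F t in at_right 0. G p + \<sigma> / 2 * (1 - t) * (norm (y - p))\<^sup>2 \<le> G y"
    unfolding eventually_at_right_field by (intro exI[of _ 1]) auto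
qed simp

text \<open>
  A Lipschitz function decreases at most linearly, so beyond some radius the quadratic wins and the
  search is confined to a compact set.
\<close>

lemma lipschitz_plus_square_attains_min:
  fixes A :: "'a::euclidean_space set"
  assumes A: "closed A" "A \<noteq> {}" and F: "L-lipschitz_on A F" and q: "0 < q"
  shows "\<exists>p\<in>A. \<forall>y\<in>A. F p + q / 2 * (norm (p - x))\<^sup>2 \<le> F y + q / 2 * (norm (y - x))\<^sup>2"
proof -
  define G where "G y = F y + q / 2 * (norm (y - x))\<^sup>2" for y
  obtain a where a: "a \<in> A" using A by auto
  define d where "d = norm (a - x)"
  \<comment> \<open>at a distance \<open>D > R\<close> from \<open>x\<close> one has \<open>2 * L \<le> q * (D - d)\<close>, so the value is at least the one at \<open>a\<close>\<close>
  define R where "R = (2 * L + 2 * q * d) / q + d"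
  have L: "0 \<le> L" using F by (rule lipschitz_on_nonneg)
  have d: "0 \<le> d" by (simp add: d_def)
  have cont: "continuous_on (A \<inter> cball x R) G"
  proof -
    have "continuous_on (A \<inter> cball x R) F"
      by (rule continuous_on_subset[OF lipschitz_on_continuous_on[OF F]]) simp
    then show ?thesis
      unfolding G_def by (intro continuous_intros)
  qed
  have "d \<le> R" unfolding R_def using L q d by simp
  then have "a \<in> A \<inter> cball x R"
    using a by (simp add: dist_norm d_def norm_minus_commute)
  then have ne: "A \<inter> cball x R \<noteq> {}"
    by blast
  have "compact (A \<inter> cball x R)"
    using A(1) by (simp add: closed_Int_compact)
  from continuous_attains_inf[OF this ne cont]
  obtain p where p: "p \<in> A \<inter> cball x R" "\<And>y. y \<in> A \<inter> cball x R \<Longrightarrow> G p \<le> G y"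
    by blast
  have "G p \<le> G y" if y: "y \<in> A" for y
  proof (cases "y \<in> cball x R")
    case True
    then show ?thesis using p(2) y by simp
  next
    case False
    define D where "D = norm (y - x)"
    have D: "R < D" using False by (simp add: D_def dist_norm norm_minus_commute)
    have "norm (a - y) \<le> d + D"
      unfolding d_def D_def using norm_triangle_ineq4[of "a - x" "y - x"] by simp
    from mult_left_mono[OF this L] have "F a - F y \<le> L * (d + D)"
      using lipschitz_onD[OF F a y] unfolding dist_norm real_norm_def by linarith
    moreover have "L * (d + D) \<le> q / 2 * D\<^sup>2 - q / 2 * d\<^sup>2"
    proof -
      have "2 * L \<le> q * (D - d)"
      proof -
        have "2 * L + 2 * q * d = q * (R - d)" using q by (simp add: R_def)
        also have "\<dots> \<le> q * (D - d)" using q D by simp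
        finally show ?thesis using mult_nonneg_nonneg[of q d] q d by linarith
      qed
      then have "2 * L * (d + D) \<le> q * (D - d) * (d + D)"
        using d D \<open>d \<le> R\<close> by (intro mult_right_mono) auto
      also have "\<dots> = q * D\<^sup>2 - q * d\<^sup>2" by algebra
      finally show ?thesis by simp
    qed
    ultimately have "G a \<le> G y"
      unfolding G_def D_def d_def by linarith
    with p(2)[OF \<open>a \<in> A \<inter> cball x R\<close>] show ?thesis by linarith
  qed
  then have "\<forall>y\<in>A. G p \<le> G y" by blast
  with p(1) show ?thesis unfolding G_def by (intro bexI[of _ p]) simp_all
qed

definition prox :: "real \<Rightarrow> 'a::real_inner set \<Rightarrow> ('a \<Rightarrow> real) \<Rightarrow> 'a \<Rightarrow> 'a" where
  "prox q A F x =
     (SOME p. p \<in> A \<and> (\<forall>y\<in>A. F p + q / 2 * (norm (p - x))\<^sup>2 \<le> F y + q / 2 * (norm (y - x))\<^sup>2))"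

definition env :: "real \<Rightarrow> 'a::real_inner set \<Rightarrow> ('a \<Rightarrow> real) \<Rightarrow> 'a \<Rightarrow> real" where
  "env q A F x = F (prox q A F x) + q / 2 * (norm (prox q A F x - x))\<^sup>2"

text \<open>
  A Lipschitz and \<open>\<mu>\<close>-weakly convex function on a closed convex set, regularized with a weight
  \<open>q > \<mu>\<close>. Both the proximal points of the objective and the iterates of the algorithm, which are
  proximal points of random models, arise from this situation.
\<close>

locale prox_problem =
  fixes A :: "'a::euclidean_space set" and F :: "'a \<Rightarrow> real" and L \<mu> q :: real
  assumes closed_A: "closed A" and convex_A: "convex A" and nonempty_A: "A \<noteq> {}"
    and lipschitz_F: "L-lipschitz_on A F"
    and wconvex_F: "weakly_convex_on \<mu> A F"
    and mu_nonneg: "0 \<le> \<mu>" and mu_less: "\<mu> < q"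
begin

lemma prox_mem: "prox q A F x \<in> A"
  and prox_le: "y \<in> A \<Longrightarrow> F (prox q A F x) + q / 2 * (norm (prox q A F x - x))\<^sup>2
                              \<le> F y + q / 2 * (norm (y - x))\<^sup>2"
proof -
  let ?P = "\<lambda>p. p \<in> A \<and> (\<forall>y\<in>A. F p + q / 2 * (norm (p - x))\<^sup>2 \<le> F y + q / 2 * (norm (y - x))\<^sup>2)"
  have "\<exists>p. ?P p"
    using lipschitz_plus_square_attains_min[OF closed_A nonempty_A lipschitz_F, of q x]
      order.strict_trans1[OF mu_nonneg mu_less] unfolding Bex_def by blast
  then have "?P (prox q A F x)"
    unfolding prox_def by (rule someI_ex)
  then show "prox q A F x \<in> A"
    and "y \<in> A \<Longrightarrow> F (prox q A F x) + q / 2 * (norm (prox q A F x - x))\<^sup>2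
                              \<le> F y + q / 2 * (norm (y - x))\<^sup>2"
    by blast+
qed

lemma minimizer_gap:
  assumes p: "p \<in> A" "\<And>y. y \<in> A \<Longrightarrow> F p + q / 2 * (norm (p - x))\<^sup>2 \<le> F y + q / 2 * (norm (y - x))\<^sup>2"
    and y: "y \<in> A"
  shows "F p + q / 2 * (norm (p - x))\<^sup>2 + (q - \<mu>) / 2 * (norm (y - p))\<^sup>2
            \<le> F y + q / 2 * (norm (y - x))\<^sup>2"
proof -
  have eq: "- (q - \<mu>) = \<mu> + - q"
    by simp
  have "weakly_convex_on (- (q - \<mu>)) A (\<lambda>y. F y + q / 2 * (norm (y - x))\<^sup>2)"
    unfolding eq by (rule weakly_convex_on_add[OF wconvex_F weakly_convex_on_square])
  from strongly_convex_minimizer_gap[OF this convex_A p y] show ?thesis .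
qed

lemma prox_gap:
  assumes y: "y \<in> A"
  shows "F (prox q A F x) + q / 2 * (norm (prox q A F x - x))\<^sup>2
            + (q - \<mu>) / 2 * (norm (y - prox q A F x))\<^sup>2
          \<le> F y + q / 2 * (norm (y - x))\<^sup>2"
  using minimizer_gap[of "prox q A F x" x y] prox_mem[of x] prox_le[of _ x] y by blast

lemma prox_unique:
  assumes p: "p \<in> A" "\<And>y. y \<in> A \<Longrightarrow> F p + q / 2 * (norm (p - x))\<^sup>2 \<le> F y + q / 2 * (norm (y - x))\<^sup>2"
  shows "p = prox q A F x"
proof -
  have "(q - \<mu>) / 2 * (norm (p - prox q A F x))\<^sup>2 \<le> 0"
    using prox_gap[OF p(1), of x] p(2)[OF prox_mem, of x] by linarith
  then show ?thesis
    using mu_less by (auto simp: mult_le_0_iff)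
qed

text \<open>
  Each of the two proximal points competes in the minimization that defines the other; adding the two
  gap inequalities makes the function values cancel.
\<close>

lemma prox_lipschitz: "(q - \<mu>) * norm (prox q A F y - prox q A F x) \<le> q * norm (y - x)"
proof -
  let ?p = "prox q A F x" and ?r = "prox q A F y"
  have "(q - \<mu>) * (norm (?r - ?p))\<^sup>2
      \<le> q / 2 * ((norm (?r - x))\<^sup>2 - (norm (?p - x))\<^sup>2 + (norm (?p - y))\<^sup>2 - (norm (?r - y))\<^sup>2)"
    using prox_gap[OF prox_mem[of y], of x] prox_gap[OF prox_mem[of x], of y]
    by (simp add: field_simps norm_minus_commute)
  also have "\<dots> = q * ((y - x) \<bullet> (?r - ?p))"
    by (simp add: power2_norm_eq_inner inner_diff inner_commute algebra_simps)
  also have "\<dots> \<le> q * (norm (y - x) * norm (?r - ?p))"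
    using mu_nonneg mu_less by (intro mult_left_mono norm_cauchy_schwarz) auto
  finally have "norm (?r - ?p) * ((q - \<mu>) * norm (?r - ?p)) \<le> norm (?r - ?p) * (q * norm (y - x))"
    by (simp add: power2_eq_square algebra_simps)
  then show ?thesis
    using mu_nonneg mu_less by (cases "?r = ?p") auto
qed

lemma env_le: "y \<in> A \<Longrightarrow> env q A F x \<le> F y + q / 2 * (norm (y - x))\<^sup>2"
  unfolding env_def by (rule prox_le)

lemma env_upper: "env q A F y \<le> env q A F x + (q *\<^sub>R (x - prox q A F x)) \<bullet> (y - x) + q / 2 * (norm (y - x))\<^sup>2"
proof -
  let ?p = "prox q A F x"
  have "env q A F y \<le> F ?p + q / 2 * (norm (?p - y))\<^sup>2"
    by (rule env_le[OF prox_mem])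
  also have "(norm (?p - y))\<^sup>2 = (norm (?p - x))\<^sup>2 + 2 * ((x - ?p) \<bullet> (y - x)) + (norm (y - x))\<^sup>2"
    by (simp add: power2_norm_eq_inner inner_diff inner_commute algebra_simps)
  finally show ?thesis
    by (simp add: env_def algebra_simps)
qed

text \<open>
  Applying the one-sided quadratic estimate \<open>env_upper\<close> from \<open>x\<close> to \<open>y\<close> and from \<open>y\<close> to \<open>x\<close> sandwiches
  the increment of the envelope; the two linear terms differ by a multiple of \<open>\<parallel>y - x\<parallel>\<^sup>2\<close> because the
  proximal map is Lipschitz continuous.
\<close>

lemma GDERIV_env: "GDERIV (env q A F) x :> q *\<^sub>R (x - prox q A F x)"
proof -
  let ?g = "\<lambda>x. q *\<^sub>R (x - prox q A F x)"
  define B where "B = q * (q / (q - \<mu>)) + 2 * q"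
  have q: "0 < q" using mu_nonneg mu_less by simp
  have B: "\<bar>env q A F y - env q A F x - (y - x) \<bullet> ?g x\<bar> \<le> B * (norm (y - x))\<^sup>2" for y
  proof -
    have pr: "norm (prox q A F x - prox q A F y) \<le> q / (q - \<mu>) * norm (y - x)"
      using prox_lipschitz[of y x] mu_less
      by (simp add: field_simps norm_minus_commute)
    have "\<bar>(?g y - ?g x) \<bullet> (y - x)\<bar> \<le> norm (?g y - ?g x) * norm (y - x)"
      by (rule Cauchy_Schwarz_ineq2)
    also have "\<dots> \<le> (q * (norm (y - x) + q / (q - \<mu>) * norm (y - x))) * norm (y - x)"
    proof (rule mult_right_mono)
      have "?g y - ?g x = q *\<^sub>R ((y - x) + (prox q A F x - prox q A F y))"
        by (simp add: algebra_simps)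
      then have "norm (?g y - ?g x) \<le> q * (norm (y - x) + norm (prox q A F x - prox q A F y))"
        using q norm_triangle_ineq[of "y - x" "prox q A F x - prox q A F y"] by simp
      then show "norm (?g y - ?g x) \<le> q * (norm (y - x) + q / (q - \<mu>) * norm (y - x))"
        using mult_left_mono[OF pr, of q] q by (simp add: distrib_left)
    qed simp
    finally have *: "\<bar>(?g y - ?g x) \<bullet> (y - x)\<bar> \<le> (q + q * (q / (q - \<mu>))) * (norm (y - x))\<^sup>2"
      by (simp add: algebra_simps power2_eq_square)
    have up: "env q A F y \<le> env q A F x + ?g x \<bullet> (y - x) + q / 2 * (norm (y - x))\<^sup>2"
      by (rule env_upper)
    have lo: "env q A F x \<le> env q A F y + ?g y \<bullet> (x - y) + q / 2 * (norm (y - x))\<^sup>2"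
      using env_upper[of x y] by (simp add: norm_minus_commute)
    define I where "I = ?g x \<bullet> (y - x)"
    define J where "J = (?g y - ?g x) \<bullet> (y - x)"
    define c\<^sub>1 where "c\<^sub>1 = q * (norm (y - x))\<^sup>2"
    define c\<^sub>2 where "c\<^sub>2 = q * (q / (q - \<mu>)) * (norm (y - x))\<^sup>2"
    have "?g y \<bullet> (x - y) = - I - J"
      unfolding I_def J_def by (simp add: inner_diff algebra_simps)
    with lo have lo': "env q A F x \<le> env q A F y - I - J + c\<^sub>1 / 2"
      by (simp add: c\<^sub>1_def)
    have up': "env q A F y \<le> env q A F x + I + c\<^sub>1 / 2"
      using up by (simp add: c\<^sub>1_def I_def)
    have J: "\<bar>J\<bar> \<le> c\<^sub>1 + c\<^sub>2"
      using * unfolding J_def c\<^sub>1_def c\<^sub>2_def by (simp add: distrib_right)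
    have "0 \<le> c\<^sub>1" "0 \<le> c\<^sub>2"
      unfolding c\<^sub>1_def c\<^sub>2_def using q mu_less by simp_all
    then have "\<bar>env q A F y - env q A F x - I\<bar> \<le> c\<^sub>2 + 2 * c\<^sub>1"
      using up' lo' J by linarith
    then show ?thesis
      unfolding B_def I_def c\<^sub>1_def c\<^sub>2_def
      by (simp add: inner_commute distrib_right)
  qed
  have "((\<lambda>y. (1 / norm (y - x)) *\<^sub>R (env q A F y - (env q A F x + (y - x) \<bullet> ?g x))) \<longlongrightarrow> 0) (at x)"
  proof (rule Lim_null_comparison)
    show "\<forall>\<^sub>F y in at x. norm ((1 / norm (y - x)) *\<^sub>R (env q A F y - (env q A F x + (y - x) \<bullet> ?g x)))
        \<le> B * norm (y - x)"
      using B by (intro always_eventually allI)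
        (auto simp: divide_simps power2_eq_square mult.assoc diff_diff_eq)
    show "((\<lambda>y. B * norm (y - x)) \<longlongrightarrow> 0) (at x)"
      by (auto intro!: tendsto_eq_intros)
  qed
  then show ?thesis
    unfolding gderiv_def has_derivative_within
    by (intro conjI bounded_linear_inner_left)
qed

lemma isCont_env: "isCont (env q A F) x"
  using GDERIV_env unfolding gderiv_def by (rule has_derivative_continuous)

text \<open>
  The function value cannot drop by more than \<open>L\<close> times the step length, whereas the drop has to pay
  for the quadratic term and for the strong convexity gap.
\<close>

lemma prox_step_bound:
  assumes x: "x \<in> A"
  shows "(q - \<mu> / 2) * norm (prox q A F x - x) \<le> L"
proof -
  let ?d = "norm (prox q A F x - x)"
  have "?d * ((q - \<mu> / 2) * ?d) \<le> F x - F (prox q A F x)"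
    using prox_gap[OF x, of x] by (simp add: norm_minus_commute power2_eq_square field_simps)
  also have "\<dots> \<le> ?d * L"
    using lipschitz_onD[OF lipschitz_F x prox_mem[of x]]
    by (simp add: dist_norm norm_minus_commute mult.commute)
  finally show ?thesis
    using lipschitz_on_nonneg[OF lipschitz_F] by (cases "?d = 0") auto
qed

end

lemma gradient_eqI: "GDERIV f x :> g \<Longrightarrow> gradient f x = g"
  unfolding gradient_def
proof (rule the_equality)
  fix g' assume "GDERIV f x :> g" "GDERIV f x :> g'"
  then have "(\<lambda>h. h \<bullet> g) = (\<lambda>h. h \<bullet> g')"
    unfolding gderiv_def by (rule has_derivative_unique)
  from fun_cong[OF this] have "\<forall>h. h \<bullet> g' = h \<bullet> g"
    by simp
  then show "g' = g"
    by (simp only: vector_eq_ldot)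
qed


section \<open>Convex functions composed with smooth maps\<close>

lemma GDERIV_gradient:
  fixes c :: "'a::euclidean_space \<Rightarrow> real"
  assumes "c differentiable (at y)"
  shows "GDERIV c y :> gradient c y"
proof -
  obtain D where D: "(c has_derivative D) (at y)"
    using assms unfolding differentiable_def by blast
  interpret D: bounded_linear D
    using D by (rule has_derivative_bounded_linear)
  have "D v = v \<bullet> (\<Sum>b\<in>Basis. D b *\<^sub>R b)" for v
  proof -
    have "D v = D (\<Sum>b\<in>Basis. (v \<bullet> b) *\<^sub>R b)"
      by (simp only: euclidean_representation)
    also have "\<dots> = (\<Sum>b\<in>Basis. (v \<bullet> b) * D b)"
      by (simp only: D.sum D.scaleR real_scaleR_def)
    also have "\<dots> = v \<bullet> (\<Sum>b\<in>Basis. D b *\<^sub>R b)"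
      by (simp only: inner_sum_right inner_scaleR_right mult.commute)
    finally show ?thesis .
  qed
  then have eq: "(\<lambda>v. v \<bullet> (\<Sum>b\<in>Basis. D b *\<^sub>R b)) = D"
    by (intro ext) (rule sym)
  have "GDERIV c y :> (\<Sum>b\<in>Basis. D b *\<^sub>R b)"
    unfolding gderiv_def eq by (rule D)
  from gradient_eqI[OF this] this show ?thesis
    by simp
qed

lemma DERIV_along_line:
  fixes c :: "'a::euclidean_space \<Rightarrow> real"
  assumes "c differentiable (at (x + t *\<^sub>R v))"
  shows "((\<lambda>t. c (x + t *\<^sub>R v)) has_real_derivative gradient c (x + t *\<^sub>R v) \<bullet> v) (at t)"
proof -
  have "((\<lambda>t. x + t *\<^sub>R v) has_derivative (\<lambda>s. s *\<^sub>R v)) (at t)"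
    by (auto intro!: derivative_eq_intros)
  from has_derivative_compose[OF this GDERIV_gradient[OF assms, unfolded gderiv_def]]
  have "((\<lambda>t. c (x + t *\<^sub>R v)) has_derivative (\<lambda>s. (s *\<^sub>R v) \<bullet> gradient c (x + t *\<^sub>R v))) (at t)" .
  moreover have "(\<lambda>s. (s *\<^sub>R v) \<bullet> g) = (*) (g \<bullet> v)" for g
    by (rule ext) (simp add: inner_commute[of v g])
  ultimately show ?thesis
    unfolding has_field_derivative_def by simp
qed

text \<open>
  Along the segment the derivative deviates from its initial value by at most \<open>C t \<parallel>y - x\<parallel>\<^sup>2\<close>, so
  adding or subtracting \<open>C t\<^sup>2/2 \<parallel>y - x\<parallel>\<^sup>2\<close> makes the remainder monotone.
\<close>

lemma taylor_lipschitz_gradient: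
  fixes c :: "'a::euclidean_space \<Rightarrow> real"
  assumes diff: "\<And>y. c differentiable (at y)" and lip: "C-lipschitz_on UNIV (gradient c)"
  shows "\<bar>c y - (c x + gradient c x \<bullet> (y - x))\<bar> \<le> C / 2 * (norm (y - x))\<^sup>2"
proof -
  let ?v = "y - x"
  define \<phi> where "\<phi> t = c (x + t *\<^sub>R ?v) - t * (gradient c x \<bullet> ?v)" for t
  have D: "(\<phi> has_real_derivative (gradient c (x + t *\<^sub>R ?v) \<bullet> ?v - gradient c x \<bullet> ?v)) (at t)" for t
    unfolding \<phi>_def by (auto intro!: derivative_eq_intros DERIV_along_line diff)
  have D_le: "\<bar>gradient c (x + t *\<^sub>R ?v) \<bullet> ?v - gradient c x \<bullet> ?v\<bar> \<le> C * t * (norm ?v)\<^sup>2"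
    if "0 \<le> t" for t
  proof -
    have "\<bar>(gradient c (x + t *\<^sub>R ?v) - gradient c x) \<bullet> ?v\<bar>
        \<le> norm (gradient c (x + t *\<^sub>R ?v) - gradient c x) * norm ?v"
      by (rule Cauchy_Schwarz_ineq2)
    also have "norm (gradient c (x + t *\<^sub>R ?v) - gradient c x) \<le> C * (t * norm ?v)"
      using lipschitz_onD[OF lip, of "x + t *\<^sub>R ?v" x] that by (simp add: dist_norm)
    finally show ?thesis
      by (simp add: inner_diff_left power2_eq_square mult_right_mono mult.assoc)
  qed
  have "\<phi> 1 - C * 1\<^sup>2 / 2 * (norm ?v)\<^sup>2 \<le> \<phi> 0 - C * 0\<^sup>2 / 2 * (norm ?v)\<^sup>2"
  proof (rule DERIV_nonpos_imp_nonincreasing[where f = "\<lambda>t. \<phi> t - C * t\<^sup>2 / 2 * (norm ?v)\<^sup>2"])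
    fix t :: real assume "0 \<le> t" "t \<le> 1"
    with D_le[of t] show "\<exists>d. ((\<lambda>t. \<phi> t - C * t\<^sup>2 / 2 * (norm ?v)\<^sup>2) has_real_derivative d) (at t) \<and> d \<le> 0"
      by (intro exI[of _ "gradient c (x + t *\<^sub>R ?v) \<bullet> ?v - gradient c x \<bullet> ?v - C * t * (norm ?v)\<^sup>2"])
         (auto intro!: derivative_eq_intros D)
  qed simp
  moreover have "\<phi> 0 + C * 0\<^sup>2 / 2 * (norm ?v)\<^sup>2 \<le> \<phi> 1 + C * 1\<^sup>2 / 2 * (norm ?v)\<^sup>2"
  proof (rule DERIV_nonneg_imp_nondecreasing[where f = "\<lambda>t. \<phi> t + C * t\<^sup>2 / 2 * (norm ?v)\<^sup>2"])
    fix t :: real assume "0 \<le> t" "t \<le> 1"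
    with D_le[of t] show "\<exists>d. ((\<lambda>t. \<phi> t + C * t\<^sup>2 / 2 * (norm ?v)\<^sup>2) has_real_derivative d) (at t) \<and> 0 \<le> d"
      by (intro exI[of _ "gradient c (x + t *\<^sub>R ?v) \<bullet> ?v - gradient c x \<bullet> ?v + C * t * (norm ?v)\<^sup>2"])
         (auto intro!: derivative_eq_intros D)
  qed simp
  ultimately have "\<phi> 1 - \<phi> 0 \<le> C / 2 * (norm ?v)\<^sup>2" "- (\<phi> 1 - \<phi> 0) \<le> C / 2 * (norm ?v)\<^sup>2"
    by simp_all
  then have "\<bar>\<phi> 1 - \<phi> 0\<bar> \<le> C / 2 * (norm ?v)\<^sup>2"
    by (rule abs_leI)
  then show ?thesis
    unfolding \<phi>_def by (simp add: diff_diff_eq2 algebra_simps)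
qed

text \<open>
  Lipschitz continuity is available on \<open>A\<close> only, and \<open>A\<close> may have empty interior, so the norm of the
  gradient is not controlled. Directions \<open>u - e\<close> between points of \<open>A\<close> are: after shrinking both
  points towards \<open>z\<close> they stay in \<open>A\<close>, and their difference quotient tends to the required inner
  product, also when \<open>z\<close> lies on the boundary.
\<close>

lemma gradient_bound_feasible_direction:
  fixes c :: "'a::euclidean_space \<Rightarrow> real"
  assumes A: "convex A" and lip: "L-lipschitz_on A c" and diff: "c differentiable (at z)"
    and z: "z \<in> A" and u: "u \<in> A" and e: "e \<in> A"
  shows "\<bar>gradient c z \<bullet> (u - e)\<bar> \<le> L * norm (u - e)"
proof -
  define \<phi> where "\<phi> t = c (z + t *\<^sub>R (u - z)) - c (z + t *\<^sub>R (e - z))" for t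
  have "(\<phi> has_real_derivative gradient c z \<bullet> (u - z) - gradient c z \<bullet> (e - z)) (at 0)"
    unfolding \<phi>_def
    using DERIV_along_line[of c z 0 "u - z"] DERIV_along_line[of c z 0 "e - z"] diff
    by (auto intro!: derivative_eq_intros)
  moreover have "gradient c z \<bullet> (u - z) - gradient c z \<bullet> (e - z) = gradient c z \<bullet> (u - e)"
    by (simp add: inner_diff_right)
  ultimately have "((\<lambda>t. \<phi> t / t) \<longlongrightarrow> gradient c z \<bullet> (u - e)) (at 0)"
    unfolding DERIV_def by (simp add: \<phi>_def)
  then have "((\<lambda>t. \<bar>\<phi> t / t\<bar>) \<longlongrightarrow> \<bar>gradient c z \<bullet> (u - e)\<bar>) (at_right 0)"
    by (intro tendsto_rabs) (rule tendsto_within_subset[OF _ subset_UNIV])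
  moreover have "\<bar>\<phi> t / t\<bar> \<le> L * norm (u - e)" if t: "0 < t" "t < 1" for t
  proof -
    have in_A: "z + t *\<^sub>R (v - z) \<in> A" if "v \<in> A" for v
      using convexD_alt[OF A z that, of t] t by (simp add: algebra_simps)
    have "\<bar>\<phi> t\<bar> \<le> L * norm (z + t *\<^sub>R (u - z) - (z + t *\<^sub>R (e - z)))"
      using lipschitz_onD[OF lip in_A[OF u] in_A[OF e]] unfolding \<phi>_def dist_norm real_norm_def .
    also have "z + t *\<^sub>R (u - z) - (z + t *\<^sub>R (e - z)) = t *\<^sub>R (u - e)"
      by (simp add: algebra_simps)
    also have "L * norm (t *\<^sub>R (u - e)) = t * (L * norm (u - e))"
      using t by simp
    finally have "\<bar>\<phi> t\<bar> \<le> t * (L * norm (u - e))" .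
    then show ?thesis
      using t by (simp add: pos_divide_le_eq mult.commute)
  qed
  then have "\<forall>\<^sub>F t in at_right 0. \<bar>\<phi> t / t\<bar> \<le> L * norm (u - e)"
    unfolding eventually_at_right_field by (intro exI[of _ 1]) auto
  ultimately show ?thesis
    by (rule tendsto_upperbound) simp
qed

lemma lipschitz_real_le:
  fixes h :: "real \<Rightarrow> real"
  assumes "L-lipschitz_on UNIV h" "\<bar>a - b\<bar> \<le> d"
  shows "\<bar>h a - h b\<bar> \<le> L * d"
proof -
  have "\<bar>h a - h b\<bar> \<le> L * \<bar>a - b\<bar>"
    using lipschitz_onD[OF assms(1), of a b] by (simp add: dist_real_def)
  also have "\<dots> \<le> L * d"
    by (rule mult_left_mono[OF assms(2) lipschitz_on_nonneg[OF assms(1)]])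
  finally show ?thesis .
qed

lemma partial_linearization_error:
  fixes c :: "'a::euclidean_space \<Rightarrow> 's \<Rightarrow> real"
  assumes "L\<^sub>h-lipschitz_on UNIV h"
    and "\<And>y. (\<lambda>u. c u s) differentiable (at y)" "C-lipschitz_on UNIV (gradient (\<lambda>u. c u s))"
  shows "\<bar>h (c y s) - partial_linearization h c z y s\<bar> \<le> L\<^sub>h * C / 2 * (norm (y - z))\<^sup>2"
  using lipschitz_real_le[OF assms(1) taylor_lipschitz_gradient[OF assms(2,3)], of y z]
  unfolding partial_linearization_def by (simp add: mult.assoc)

lemma lipschitz_on_partial_linearization:
  fixes c :: "'a::euclidean_space \<Rightarrow> 's \<Rightarrow> real"
  assumes h: "L\<^sub>h-lipschitz_on UNIV h" and A: "convex A" and z: "z \<in> A"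
    and lip: "L-lipschitz_on A (\<lambda>u. c u s)" and diff: "(\<lambda>u. c u s) differentiable (at z)"
  shows "(L\<^sub>h * L)-lipschitz_on A (\<lambda>y. partial_linearization h c z y s)"
proof (rule lipschitz_onI)
  fix u e assume "u \<in> A" "e \<in> A"
  let ?g = "gradient (\<lambda>u. c u s) z"
  have "\<bar>c z s + ?g \<bullet> (u - z) - (c z s + ?g \<bullet> (e - z))\<bar> \<le> L * norm (u - e)"
    using gradient_bound_feasible_direction[OF A lip diff z \<open>u \<in> A\<close> \<open>e \<in> A\<close>]
    by (simp add: inner_diff_right)
  from lipschitz_real_le[OF h this]
  show "dist (partial_linearization h c z u s) (partial_linearization h c z e s) \<le> L\<^sub>h * L * dist u e"
    unfolding partial_linearization_def dist_norm by (simp add: mult.assoc)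
qed (use lipschitz_on_nonneg[OF h] lipschitz_on_nonneg[OF lip] in simp)

lemma convex_on_UNIV_D:
  fixes h :: "real \<Rightarrow> real"
  assumes "convex_on UNIV h" "t \<in> {0..1}"
  shows "h ((1 - t) * a + t * b) \<le> (1 - t) * h a + t * h b"
  using convex_onD[OF assms(1), of t a b] assms(2) by simp

lemma weakly_convex_on_partial_linearization:
  assumes "convex_on UNIV h"
  shows "weakly_convex_on 0 A (\<lambda>y. partial_linearization h c z y s)"
  unfolding weakly_convex_on_def
proof (intro ballI)
  fix a b t assume t: "t \<in> {0..1::real}"
  let ?g = "gradient (\<lambda>u. c u s) z"
  have "c z s + ?g \<bullet> ((1 - t) *\<^sub>R a + t *\<^sub>R b - z)
      = (1 - t) * (c z s + ?g \<bullet> (a - z)) + t * (c z s + ?g \<bullet> (b - z))"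
    by (simp add: inner_diff_right inner_add_right algebra_simps)
  with convex_on_UNIV_D[OF assms t]
  show "partial_linearization h c z ((1 - t) *\<^sub>R a + t *\<^sub>R b) s
    \<le> (1 - t) * partial_linearization h c z a s + t * partial_linearization h c z b s
      + 0 / 2 * (t * (1 - t)) * (norm (a - b))\<^sup>2"
    unfolding partial_linearization_def by simp
qed

text \<open>
  The smooth map differs from its chord by at most the weighted Taylor errors at the two end points,
  taken at the intermediate point; their weighted sum is \<open>C/2 t (1 - t) \<parallel>a - b\<parallel>\<^sup>2\<close>. The Lipschitz
  constant of the outer function transports this error, its convexity does the rest.
\<close>

lemma weakly_convex_on_composition:
  fixes c :: "'a::euclidean_space \<Rightarrow> real"
  assumes h: "convex_on UNIV h" "L\<^sub>h-lipschitz_on UNIV h"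
    and c: "\<And>y. c differentiable (at y)" "C-lipschitz_on UNIV (gradient c)"
  shows "weakly_convex_on (L\<^sub>h * C) A (\<lambda>y. h (c y))"
  unfolding weakly_convex_on_def
proof (intro ballI)
  fix a b :: 'a and t assume t: "t \<in> {0..1::real}"
  let ?y = "(1 - t) *\<^sub>R a + t *\<^sub>R b"
  let ?e = "\<lambda>x. c x - (c ?y + gradient c ?y \<bullet> (x - ?y))"
  have "\<bar>c ?y - ((1 - t) * c a + t * c b)\<bar> = \<bar>(1 - t) * ?e a + t * ?e b\<bar>"
  proof -
    have "(1 - t) * (gradient c ?y \<bullet> (a - ?y)) + t * (gradient c ?y \<bullet> (b - ?y)) = 0"
      by (simp add: inner_diff_right inner_add_right algebra_simps)
    then have "c ?y - ((1 - t) * c a + t * c b) = - ((1 - t) * ?e a + t * ?e b)"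
      by (simp add: algebra_simps)
    then show ?thesis by simp
  qed
  also have "\<dots> \<le> (1 - t) * \<bar>?e a\<bar> + t * \<bar>?e b\<bar>"
    using t by (intro order.trans[OF abs_triangle_ineq]) (simp add: abs_mult)
  also have "\<dots> \<le> (1 - t) * (C / 2 * (norm (a - ?y))\<^sup>2) + t * (C / 2 * (norm (b - ?y))\<^sup>2)"
    using t by (intro add_mono mult_left_mono taylor_lipschitz_gradient[OF c]) auto
  also have "\<dots> = C / 2 * ((1 - t) * (norm (a - ?y))\<^sup>2 + t * (norm (b - ?y))\<^sup>2)"
    by (simp only: distrib_left mult.left_commute)
  also have "(1 - t) * (norm (a - ?y))\<^sup>2 + t * (norm (b - ?y))\<^sup>2 = t * (1 - t) * (norm (a - b))\<^sup>2"
    using norm_convex_combination[of t a b ?y] by simp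
  finally have "\<bar>h (c ?y) - h ((1 - t) * c a + t * c b)\<bar>
      \<le> L\<^sub>h * (C / 2 * (t * (1 - t) * (norm (a - b))\<^sup>2))"
    by (rule lipschitz_real_le[OF h(2)])
  then have "h (c ?y) - h ((1 - t) * c a + t * c b)
      \<le> L\<^sub>h * (C / 2 * (t * (1 - t) * (norm (a - b))\<^sup>2))"
    by (rule abs_le_D1)
  with convex_on_UNIV_D[OF h(1) t, of "c a" "c b"]
  show "h (c ?y) \<le> (1 - t) * h (c a) + t * h (c b)
      + L\<^sub>h * C / 2 * (t * (1 - t)) * (norm (a - b))\<^sup>2"
    by (simp add: mult.assoc)
qed

lemma weakly_convex_edom:
  fixes \<omega> :: "'a::real_inner \<Rightarrow> ereal"
  assumes wc: "weakly_convex \<kappa> \<omega>" and proper: "\<And>y. \<omega> y \<noteq> -\<infinity>"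
  shows "convex (edom \<omega>)"
    and "weakly_convex_on \<kappa> (edom \<omega>) (\<lambda>y. real_of_ereal (\<omega> y))"
proof -
  have fin: "\<exists>r. \<omega> y = ereal r" if "y \<in> edom \<omega>" for y
    using that proper[of y] unfolding edom_def by (cases "\<omega> y") auto
  have main: "\<omega> ((1 - t) *\<^sub>R a + t *\<^sub>R b) \<le> ereal ((1 - t) * real_of_ereal (\<omega> a)
      + t * real_of_ereal (\<omega> b) + \<kappa> / 2 * (t * (1 - t)) * (norm (a - b))\<^sup>2)"
    if ab: "a \<in> edom \<omega>" "b \<in> edom \<omega>" and t: "t \<in> {0..1}" for a b t
  proof -
    let ?y = "(1 - t) *\<^sub>R a + t *\<^sub>R b"
    obtain r s where r: "\<omega> a = ereal r" and s: "\<omega> b = ereal s"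
      using fin ab by blast
    have "\<omega> ?y + ereal (\<kappa> / 2 * (norm ?y)\<^sup>2)
        \<le> ereal (1 - t) * (\<omega> a + ereal (\<kappa> / 2 * (norm a)\<^sup>2))
          + ereal t * (\<omega> b + ereal (\<kappa> / 2 * (norm b)\<^sup>2))"
      using wc t unfolding weakly_convex_def ereal_convex_def by auto
    also have "\<dots> = ereal ((1 - t) * (r + \<kappa> / 2 * (norm a)\<^sup>2) + t * (s + \<kappa> / 2 * (norm b)\<^sup>2))"
      by (simp add: r s)
    finally have "\<omega> ?y \<le> ereal ((1 - t) * (r + \<kappa> / 2 * (norm a)\<^sup>2)
        + t * (s + \<kappa> / 2 * (norm b)\<^sup>2) - \<kappa> / 2 * (norm ?y)\<^sup>2)"
      by (cases "\<omega> ?y") auto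
    also have "(1 - t) * (r + k * (norm a)\<^sup>2) + t * (s + k * (norm b)\<^sup>2) - k * (norm ?y)\<^sup>2
        = (1 - t) * r + t * s + k * (t * (1 - t)) * (norm (a - b))\<^sup>2" for k
      unfolding norm_convex_combination[of t a b 0, unfolded diff_zero] by (simp add: algebra_simps)
    finally show ?thesis by (simp add: r s)
  qed
  show "convex (edom \<omega>)"
    unfolding convex_alt
  proof (intro ballI allI impI)
    fix a b and t :: real assume "a \<in> edom \<omega>" "b \<in> edom \<omega>" "0 \<le> t \<and> t \<le> 1"
    then have "\<omega> ((1 - t) *\<^sub>R a + t *\<^sub>R b) < \<infinity>"
      by (intro le_less_trans[OF main[of a b t]]) auto
    then show "(1 - t) *\<^sub>R a + t *\<^sub>R b \<in> edom \<omega>"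
      by (simp add: edom_def)
  qed
  then have mem: "(1 - t) *\<^sub>R a + t *\<^sub>R b \<in> edom \<omega>"
    if "a \<in> edom \<omega>" "b \<in> edom \<omega>" "t \<in> {0..1}" for a b t
    using that by (simp add: convex_alt)
  show "weakly_convex_on \<kappa> (edom \<omega>) (\<lambda>y. real_of_ereal (\<omega> y))"
    unfolding weakly_convex_on_def
  proof (intro ballI)
    fix a b and t :: real assume *: "a \<in> edom \<omega>" "b \<in> edom \<omega>" "t \<in> {0..1}"
    then show "real_of_ereal (\<omega> ((1 - t) *\<^sub>R a + t *\<^sub>R b))
      \<le> (1 - t) * real_of_ereal (\<omega> a) + t * real_of_ereal (\<omega> b)
        + \<kappa> / 2 * (t * (1 - t)) * (norm (a - b))\<^sup>2"
      using main[OF *] fin[OF mem[OF *]] by auto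
  qed
qed

text \<open>
  Near a limit point of the domain the function is bounded along the domain by Lipschitz continuity,
  so lower semicontinuity forbids the value \<open>\<infinity>\<close> there.
\<close>

lemma closed_edom_lipschitz:
  fixes \<omega> :: "'a::real_normed_vector \<Rightarrow> ereal"
  assumes lsc: "lower_semicontinuous \<omega>" and proper: "\<And>y. \<omega> y \<noteq> -\<infinity>"
    and lip: "L-lipschitz_on (edom \<omega>) (\<lambda>y. real_of_ereal (\<omega> y))"
  shows "closed (edom \<omega>)"
  unfolding closed_limpt
proof (intro allI impI)
  fix y assume y: "y islimpt edom \<omega>"
  show "y \<in> edom \<omega>"
  proof (rule ccontr)
    assume "y \<notin> edom \<omega>"
    then have "\<omega> y = \<infinity>" by (simp add: edom_def)
    have "edom \<omega> \<noteq> {}"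
      using y by auto
    then obtain a where a: "a \<in> edom \<omega>"
      by blast
    define B where "B = real_of_ereal (\<omega> a) + L * (norm (y - a) + 1)"
    have "\<infinity> \<le> Liminf (at y) \<omega>"
      using lsc \<open>\<omega> y = \<infinity>\<close> unfolding lower_semicontinuous_def by metis
    then have "\<forall>\<^sub>F v in at y. ereal B < \<omega> v"
      unfolding le_Liminf_iff by simp
    moreover have "\<forall>\<^sub>F v in at y. norm (v - y) < 1"
      unfolding eventually_at dist_norm by (intro exI[of _ 1]) auto
    ultimately have "\<forall>\<^sub>F v in at y. v \<notin> edom \<omega>"
    proof eventually_elim
      case (elim v)
      show ?case
      proof
        assume v: "v \<in> edom \<omega>"
        have "norm (v - a) \<le> norm (y - a) + 1"
          using elim(2) norm_triangle_ineq[of "v - y" "y - a"] by simp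
        from mult_left_mono[OF this lipschitz_on_nonneg[OF lip]]
        have "real_of_ereal (\<omega> v) \<le> B"
          using lipschitz_onD[OF lip v a] unfolding B_def dist_norm real_norm_def by linarith
        moreover obtain r where "\<omega> v = ereal r"
          using v proper[of v] unfolding edom_def by (cases "\<omega> v") auto
        ultimately show False using elim(1) by simp
      qed
    qed
    with y show False
      unfolding islimpt_conv_frequently_at frequently_def by simp
  qed
qed


section \<open>Measurable dependence on a parameter\<close>

text \<open>
  Substituting a simple function for the continuous argument leaves countably many measurable
  functions to be glued; simple functions converging to \<open>Z\<close> then give the claim as a limit.
\<close>

lemma borel_measurable_Caratheodory:
  fixes g :: "'a::{second_countable_topology, metric_space} \<Rightarrow> 's \<Rightarrow> real"
  assumes meas: "\<And>y. g y \<in> borel_measurable S"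
    and cont: "\<And>s. s \<in> space S \<Longrightarrow> continuous_on UNIV (\<lambda>y. g y s)"
    and Z: "Z \<in> borel_measurable N" and X: "X \<in> measurable N S"
  shows "(\<lambda>p. g (Z p) (X p)) \<in> borel_measurable N"
proof -
  obtain F where F: "\<And>i. simple_function N (F i)"
    and lim: "\<And>p. p \<in> space N \<Longrightarrow> (\<lambda>i. F i p) \<longlonglongrightarrow> Z p"
    using borel_measurable_implies_sequence_metric[OF Z, of undefined] by blast
  show ?thesis
  proof (rule borel_measurable_LIMSEQ_real)
    fix p assume p: "p \<in> space N"
    then have "isCont (\<lambda>y. g y (X p)) (Z p)"
      using cont[OF measurable_space[OF X p]] by (simp add: continuous_on_eq_continuous_at)
    then show "(\<lambda>i. g (F i p) (X p)) \<longlonglongrightarrow> g (Z p) (X p)"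
      by (rule isCont_tendsto_compose) (rule lim[OF p])
  next
    fix i
    show "(\<lambda>p. g (F i p) (X p)) \<in> borel_measurable N"
    proof (rule measurable_compose_countable'[where f = "\<lambda>y p. g y (X p)" and g = "F i" and I = "F i ` space N"])
      show "F i \<in> measurable N (count_space (F i ` space N))"
        using F[of i] unfolding simple_function_def by (simp add: measurable_count_space_eq2)
      show "countable (F i ` space N)"
        using F[of i] by (simp add: simple_function_def countable_finite)
    qed (rule measurable_compose[OF X meas])
  qed
qed

text \<open>
  Directional derivatives are limits of difference quotients.
\<close>

lemma borel_measurable_gradient:
  fixes c :: "'a::euclidean_space \<Rightarrow> 's \<Rightarrow> real"
  assumes meas: "\<And>y. c y \<in> borel_measurable S"
    and diff: "\<And>s y. s \<in> space S \<Longrightarrow> (\<lambda>u. c u s) differentiable (at y)"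
  shows "(\<lambda>s. gradient (\<lambda>u. c u s) y \<bullet> v) \<in> borel_measurable S"
proof (rule borel_measurable_LIMSEQ_real)
  let ?t = "\<lambda>i. inverse (real (Suc i))"
  fix s assume s: "s \<in> space S"
  have "((\<lambda>t. c (y + t *\<^sub>R v) s) has_real_derivative gradient (\<lambda>u. c u s) (y + 0 *\<^sub>R v) \<bullet> v) (at 0)"
    by (rule DERIV_along_line) (rule diff[OF s])
  then have *: "((\<lambda>t. (c (y + t *\<^sub>R v) s - c y s) / t) \<longlongrightarrow> gradient (\<lambda>u. c u s) y \<bullet> v) (at 0)"
    by (simp add: DERIV_def)
  have "filterlim ?t (at 0) sequentially"
    unfolding filterlim_at using LIMSEQ_inverse_real_of_nat by simp
  from filterlim_compose[OF * this]
  show "(\<lambda>i. (c (y + ?t i *\<^sub>R v) s - c y s) / ?t i) \<longlonglongrightarrow> gradient (\<lambda>u. c u s) y \<bullet> v" .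
qed (intro borel_measurable_divide borel_measurable_diff meas borel_measurable_const)

text \<open>
  This is what makes the iterates random variables. On a countable dense subset of \<open>A\<close> a point that is
  optimal up to \<open>1/(n+1)\<close> can be picked measurably, namely the one with the least index. The quadratic
  growth around the minimizer forces these points to converge to it.
\<close>

lemma borel_measurable_strong_minimizer:
  fixes u :: "'n \<Rightarrow> 'a::{second_countable_topology, real_normed_vector}"
  assumes A: "A \<noteq> {}" and \<sigma>: "0 < \<sigma>"
    and meas: "\<And>y. y \<in> A \<Longrightarrow> (\<lambda>p. G y p) \<in> borel_measurable N"
    and cont: "\<And>p. p \<in> space N \<Longrightarrow> continuous_on A (\<lambda>y. G y p)"
    and u: "\<And>p. p \<in> space N \<Longrightarrow> u p \<in> A"
    and gap: "\<And>p y. p \<in> space N \<Longrightarrow> y \<in> A \<Longrightarrow> G (u p) p + \<sigma> * (norm (y - u p))\<^sup>2 \<le> (G y p :: real)"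
  shows "u \<in> borel_measurable N"
proof -
  obtain Q where Q: "countable Q" "Q \<subseteq> A" "A \<subseteq> closure Q"
    using separable by metis
  then have "Q \<noteq> {}"
    using A by auto
  define q where "q = from_nat_into Q"
  have q: "q i \<in> A" for i
    using from_nat_into[OF \<open>Q \<noteq> {}\<close>] Q(2) unfolding q_def by blast
  have approx: "\<exists>i. G (q i) p < G y p + \<epsilon>" if p: "p \<in> space N" and y: "y \<in> A" and \<epsilon>: "0 < \<epsilon>" for p y \<epsilon>
  proof -
    obtain \<delta> where \<delta>: "0 < \<delta>" "\<And>z. z \<in> A \<Longrightarrow> dist z y < \<delta> \<Longrightarrow> dist (G z p) (G y p) < \<epsilon>"
      using cont[OF p] y \<epsilon> unfolding continuous_on_iff by metis
    obtain z where z: "z \<in> Q" "dist z y < \<delta>"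
      using Q(3) y \<delta>(1) closure_approachable by (metis subsetD)
    obtain i where "z = q i"
      using from_nat_into_surj[OF Q(1) z(1)] unfolding q_def by metis
    moreover have "G z p < G y p + \<epsilon>"
      using \<delta>(2)[of z] z Q(2) by (auto simp: dist_real_def)
    ultimately show ?thesis by blast
  qed
  define P where "P n p i \<longleftrightarrow> (\<forall>j. G (q i) p \<le> G (q j) p + inverse (real (Suc n)))" for n p i
  define J where "J n p = (LEAST i. P n p i)" for n p
  have ex: "\<exists>i. P n p i" if p: "p \<in> space N" for n p
  proof -
    obtain i where i: "G (q i) p < G (u p) p + inverse (real (Suc n))"
      using approx[OF p u[OF p], of "inverse (real (Suc n))"] by auto
    have "G (q i) p \<le> G (q j) p + inverse (real (Suc n))" for j
    proof -
      have "0 \<le> \<sigma> * (norm (q j - u p))\<^sup>2" using \<sigma> by simp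
      with i gap[OF p q, of j] show ?thesis by linarith
    qed
    then show ?thesis unfolding P_def by blast
  qed
  have near: "\<sigma> * (norm (q (J n p) - u p))\<^sup>2 \<le> inverse (real (Suc n))" if p: "p \<in> space N" for n p
  proof -
    have J: "P n p (J n p)"
      unfolding J_def by (rule LeastI_ex) (rule ex[OF p])
    have "G (q (J n p)) p \<le> G (u p) p + inverse (real (Suc n))"
    proof (rule field_le_epsilon)
      fix \<epsilon> :: real assume "0 < \<epsilon>"
      from approx[OF p u[OF p] this] obtain j where "G (q j) p < G (u p) p + \<epsilon>" by blast
      moreover have "G (q (J n p)) p \<le> G (q j) p + inverse (real (Suc n))"
        using J unfolding P_def by blast
      ultimately show "G (q (J n p)) p \<le> G (u p) p + inverse (real (Suc n)) + \<epsilon>"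
        by linarith
    qed
    with gap[OF p q, of "J n p"] show ?thesis by linarith
  qed
  have [measurable]: "(\<lambda>p. G (q i) p) \<in> borel_measurable N" for i
    by (rule meas[OF q])
  show ?thesis
  proof (rule borel_measurable_LIMSEQ_metric)
    fix n
    have "J n \<in> measurable N (count_space UNIV)"
      unfolding J_def P_def by measurable
    then show "(\<lambda>p. q (J n p)) \<in> borel_measurable N"
      by (rule measurable_compose) simp
  next
    fix p assume p: "p \<in> space N"
    have "(\<lambda>n. (norm (q (J n p) - u p))\<^sup>2) \<longlonglongrightarrow> 0"
    proof (rule Lim_null_comparison)
      have "(norm (q (J n p) - u p))\<^sup>2 \<le> inverse \<sigma> * inverse (real (Suc n))" for n
        using mult_left_mono[OF near[OF p, of n], of "inverse \<sigma>"] \<sigma> by (simp flip: mult.assoc)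
      then show "\<forall>\<^sub>F n in sequentially. norm ((norm (q (J n p) - u p))\<^sup>2) \<le> inverse \<sigma> * inverse (real (Suc n))"
        by simp
      show "(\<lambda>n. inverse \<sigma> * inverse (real (Suc n))) \<longlonglongrightarrow> 0"
        by (rule tendsto_mult_right_zero[OF LIMSEQ_inverse_real_of_nat])
    qed
    from tendsto_real_sqrt[OF this] have "(\<lambda>n. norm (q (J n p) - u p)) \<longlonglongrightarrow> 0"
      by simp
    then show "(\<lambda>n. q (J n p)) \<longlonglongrightarrow> u p"
      by (simp add: tendsto_norm_zero_iff LIM_zero_iff)
  qed
qed


section \<open>Counting the delays\<close>

text \<open>
  The sum of all counters is a potential: an iteration raises \<open>m - 1\<close> of them by one and removes
  exactly the delay from the remaining one.
\<close>

lemma sum_worker_counters: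
  assumes "\<And>k. k \<in> {1..K} \<Longrightarrow> w k < m"
  shows "(\<Sum>k=1..K. delay w k) + (\<Sum>i<m. worker_counter w K i) + K = m * K"
  using assms
proof (induction K)
  case 0
  then show ?case by simp
next
  case (Suc K)
  let ?v = "w (Suc K)"
  have v: "?v \<in> {..<m}"
    using Suc.prems[of "Suc K"] by simp
  have "(\<Sum>i<m. worker_counter w (Suc K) i) = (\<Sum>i\<in>{..<m} - {?v}. Suc (worker_counter w K i))"
    by (subst sum.remove[OF _ v]) (auto intro: sum.cong)
  moreover have "(\<Sum>i<m. Suc (worker_counter w K i))
      = Suc (worker_counter w K ?v) + (\<Sum>i\<in>{..<m} - {?v}. Suc (worker_counter w K i))"
    by (rule sum.remove[OF _ v]) simp
  moreover have "(\<Sum>i<m. Suc (worker_counter w K i)) = (\<Sum>i<m. worker_counter w K i) + m"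
    by (simp add: sum_Suc)
  moreover have "delay w (Suc K) = worker_counter w K ?v"
    by (simp add: delay_def)
  moreover have "(\<Sum>k=1..K. delay w k) + (\<Sum>i<m. worker_counter w K i) + K = m * K"
    by (rule Suc.IH) (rule Suc.prems, simp)
  ultimately show ?case
    by simp
qed

lemma sum_delay_le:
  assumes "\<And>k. k \<in> {1..K} \<Longrightarrow> w k < m"
  shows "(\<Sum>k=1..K. real (delay w k)) \<le> real m * real K"
proof -
  have "(\<Sum>k=1..K. delay w k) \<le> m * K"
    using sum_worker_counters[of K w m, OF assms] by simp
  then show ?thesis
    by (simp flip: of_nat_sum of_nat_mult)
qed

text \<open>
  Markov's inequality for the counting measure: every iteration above the threshold uses up more than
  \<open>T\<close> of the total delay, which is at most \<open>m K\<close>.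
\<close>

lemma card_delay_le_threshold:
  assumes w: "\<And>k. k \<in> {1..K} \<Longrightarrow> w k < m" and T: "0 < T"
  shows "real K - real m * real K / T \<le> real (card {k \<in> {1..K}. real (delay w k) \<le> T})"
proof -
  let ?S = "{k \<in> {1..K}. real (delay w k) \<le> T}"
  let ?B = "{k \<in> {1..K}. \<not> real (delay w k) \<le> T}"
  have "T * real (card ?B) = (\<Sum>k\<in>?B. T)"
    by simp
  also have "\<dots> \<le> (\<Sum>k\<in>?B. real (delay w k))"
    by (rule sum_mono) auto
  also have "\<dots> \<le> (\<Sum>k=1..K. real (delay w k))"
    by (rule sum_mono2) auto
  also have "\<dots> \<le> real m * real K"
    by (rule sum_delay_le[OF w])
  finally have "real (card ?B) \<le> real m * real K / T"
    using T by (simp add: field_simps)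
  moreover have "card ?S + card ?B = K"
  proof -
    have "card (?S \<union> ?B) = card ?S + card ?B"
      by (rule card_Un_disjoint) auto
    moreover have "?S \<union> ?B = {1..K}" by blast
    ultimately show ?thesis by simp
  qed
  ultimately show ?thesis
    by linarith
qed

text \<open>
  The safeguard pays off here: below the threshold a squared delay is at most \<open>T\<close> times the delay, so
  the bound on the total delay controls the second moment as well.
\<close>

lemma sum_delay_squares_le:
  assumes w: "\<And>k. k \<in> {1..K} \<Longrightarrow> w k < m" and T: "0 \<le> T"
  shows "(\<Sum>k | k \<in> {1..K} \<and> real (delay w k) \<le> T. (real (delay w k))\<^sup>2) \<le> T * (real m * real K)"
proof -
  let ?S = "{k. k \<in> {1..K} \<and> real (delay w k) \<le> T}"
  have "(\<Sum>k\<in>?S. (real (delay w k))\<^sup>2) \<le> (\<Sum>k\<in>?S. T * real (delay w k))"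
    by (rule sum_mono) (auto simp: power2_eq_square intro: mult_right_mono)
  also have "\<dots> \<le> (\<Sum>k=1..K. T * real (delay w k))"
    using T by (intro sum_mono2) auto
  also have "\<dots> = T * (\<Sum>k=1..K. real (delay w k))"
    by (rule sum_distrib_left[symmetric])
  also have "\<dots> \<le> T * (real m * real K)"
    by (rule mult_left_mono[OF sum_delay_le[OF w] T])
  finally show ?thesis .
qed


section \<open>Expected descent in one iteration\<close>

text \<open>
  Nonnegativity serves measurability, since then \<open>X\<close> is the square root of its measurable square. The
  last claim is Minkowski's inequality for \<open>a X + b\<close>.
\<close>

lemma (in prob_space) second_moment_bound:
  fixes X :: "'a \<Rightarrow> real"
  assumes nonneg: "\<And>p. p \<in> space M \<Longrightarrow> 0 \<le> X p"
    and int: "integrable M (\<lambda>p. (X p)\<^sup>2)" and le: "(\<integral>p. (X p)\<^sup>2 \<partial>M) \<le> B\<^sup>2" and B: "0 \<le> B"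
  shows "integrable M X" and "expectation X \<le> B"
    and "0 \<le> a \<Longrightarrow> 0 \<le> b \<Longrightarrow> integrable M (\<lambda>p. (a * X p + b)\<^sup>2)"
    and "0 \<le> a \<Longrightarrow> 0 \<le> b \<Longrightarrow> (\<integral>p. (a * X p + b)\<^sup>2 \<partial>M) \<le> (a * B + b)\<^sup>2"
proof -
  have "(\<lambda>p. sqrt ((X p)\<^sup>2)) \<in> borel_measurable M"
    using borel_measurable_integrable[OF int] by measurable
  moreover have "(\<lambda>p. sqrt ((X p)\<^sup>2)) \<in> borel_measurable M \<longleftrightarrow> X \<in> borel_measurable M"
    by (rule measurable_cong) (simp add: nonneg)
  ultimately have meas: "X \<in> borel_measurable M" by simp
  show iX: "integrable M X"
    by (rule square_integrable_imp_integrable[OF meas int])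
  have "0 \<le> variance X"
    by (rule variance_positive)
  then have "(expectation X)\<^sup>2 \<le> B\<^sup>2"
    using variance_eq[OF iX int] le by linarith
  then show EX: "expectation X \<le> B"
    using B by (rule power2_le_imp_le)
  assume a: "0 \<le> a" and b: "0 \<le> b"
  have expand: "(a * X p + b)\<^sup>2 = a\<^sup>2 * (X p)\<^sup>2 + (2 * a * b) * X p + b\<^sup>2" for p
    by (simp add: power2_eq_square algebra_simps)
  show "integrable M (\<lambda>p. (a * X p + b)\<^sup>2)"
    unfolding expand using int iX by simp
  have "(\<integral>p. (a * X p + b)\<^sup>2 \<partial>M) = a\<^sup>2 * (\<integral>p. (X p)\<^sup>2 \<partial>M) + (2 * a * b) * expectation X + b\<^sup>2"
    unfolding expand using int iX by (simp add: prob_space)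
  also have "\<dots> \<le> a\<^sup>2 * B\<^sup>2 + (2 * a * b) * B + b\<^sup>2"
    using a b le EX by (intro add_mono mult_left_mono) auto
  also have "\<dots> = (a * B + b)\<^sup>2"
    by (simp add: power2_eq_square algebra_simps)
  finally show "(\<integral>p. (a * X p + b)\<^sup>2 \<partial>M) \<le> (a * B + b)\<^sup>2" .
qed

text \<open>
  The distances are \<open>d = \<parallel>u - e\<parallel>\<close>, \<open>p = \<parallel>u - x\<^sup>*\<parallel>\<close> and \<open>q = \<parallel>e - x\<^sup>*\<parallel>\<close>, where \<open>e\<close> is the current
  point, \<open>u\<close> the next one and \<open>x\<^sup>*\<close> the proximal point of the objective at \<open>e\<close>; names
  beginning with \<open>g\<close>, \<open>h\<close>, \<open>f\<close>, \<open>w\<close> stand for values of the linearized loss, the sampled loss, the expected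
  loss and the regularizer, taken at \<open>u\<close>, \<open>e\<close> or (final letter \<open>h\<close>) at \<open>x\<^sup>*\<close>.

  Adding \<open>model\<close> and \<open>prx\<close> leaves \<open>(\<gamma> + \<rho> - 2 \<kappa> - lam)/2\<close> as coefficient of \<open>p\<^sup>2\<close>. The surplus over \<open>(\<gamma> - \<kappa> - 2 lam)/2\<close> is worth at least \<open>3/2 lam p\<^sup>2 \<ge> lam q\<^sup>2 - 3 lam d\<^sup>2\<close>; this
  is where the \<open>6 lam\<close> in \<open>\<delta>\<close> is spent. Of the \<open>d\<^sup>2\<close> terms at least \<open>\<delta>/2 d\<^sup>2\<close> is left, which absorbs the Lipschitz
  error \<open>(l + L) d\<close> by completing the square.
\<close>

lemma one_step_arithmetic:
  fixes d p q \<gamma> \<rho> \<kappa> lam \<delta> :: real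
  assumes model: "gu + wu + \<gamma> / 2 * d\<^sup>2 + (\<gamma> - \<kappa>) / 2 * p\<^sup>2 \<le> gh + wh + \<gamma> / 2 * q\<^sup>2"
    and prx: "fh + wh + \<rho> / 2 * q\<^sup>2 + (\<rho> - (lam + \<kappa>)) / 2 * p\<^sup>2 \<le> fu + wu + \<rho> / 2 * d\<^sup>2"
    and gu: "ge - l * d \<le> gu" and ge: "he - \<epsilon>\<^sub>e \<le> ge" and gh: "gh \<le> hh + \<epsilon>\<^sub>h" and fu: "fu \<le> fe + L * d"
    and triangle: "q \<le> p + d" and nonneg: "0 \<le> q" "0 \<le> lam" "0 \<le> \<kappa>"
    and \<rho>: "2 * lam + \<kappa> < \<rho>" and \<delta>: "\<delta> = \<gamma> - \<rho> - \<kappa> - 6 * lam" "0 < \<delta>"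
  shows "(\<gamma> - \<kappa> - 2 * lam) / 2 * (p\<^sup>2 - q\<^sup>2)
      \<le> - ((\<rho> - \<kappa>) / 2) * q\<^sup>2 + (hh - fh) - (he - fe) + (\<epsilon>\<^sub>e + \<epsilon>\<^sub>h) + (l + L)\<^sup>2 / (2 * \<delta>)"
proof -
  have "q\<^sup>2 \<le> (p + d)\<^sup>2"
    using triangle nonneg(1) by (rule power_mono)
  also have "\<dots> \<le> 3 / 2 * p\<^sup>2 + 3 * d\<^sup>2"
    \<comment> \<open>the weights \<open>3/2\<close> and \<open>3\<close> come from \<open>2 p d \<le> p\<^sup>2/2 + 2 d\<^sup>2\<close>\<close>
    using zero_le_power2[of "p - 2 * d"] by (simp add: power2_sum power2_diff power_mult_distrib)
  finally have "lam * q\<^sup>2 \<le> lam * (3 / 2 * p\<^sup>2 + 3 * d\<^sup>2)"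
    using nonneg(2) by (rule mult_left_mono)
  then have t1: "lam * q\<^sup>2 \<le> 3 / 2 * (lam * p\<^sup>2) + 3 * (lam * d\<^sup>2)"
    by (simp add: distrib_left)
  have "(2 * lam + \<kappa>) * p\<^sup>2 \<le> \<rho> * p\<^sup>2"
    using \<rho> by (intro mult_right_mono) auto
  then have t2: "2 * (lam * p\<^sup>2) + \<kappa> * p\<^sup>2 \<le> \<rho> * p\<^sup>2"
    by (simp add: distrib_right)
  have "0 \<le> (\<delta> * d - (l + L))\<^sup>2 / (2 * \<delta>)"
    using \<delta>(2) by simp
  also have "(\<delta> * d - (l + L))\<^sup>2 / (2 * \<delta>) = \<delta> / 2 * d\<^sup>2 - (l + L) * d + (l + L)\<^sup>2 / (2 * \<delta>)"
    using \<delta>(2) by (simp add: power2_diff power2_eq_square field_simps)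
  also have "\<delta> / 2 * d\<^sup>2 = (\<gamma> * d\<^sup>2 - \<rho> * d\<^sup>2 - \<kappa> * d\<^sup>2 - 6 * (lam * d\<^sup>2)) / 2"
    unfolding \<delta>(1) by (simp add: left_diff_distrib)
  finally have t3: "l * d + L * d \<le> (\<gamma> * d\<^sup>2 - \<rho> * d\<^sup>2 - \<kappa> * d\<^sup>2 - 6 * (lam * d\<^sup>2)) / 2 + (l + L)\<^sup>2 / (2 * \<delta>)"
    unfolding distrib_right[symmetric] by linarith
  have t4: "0 \<le> \<kappa> * d\<^sup>2"
    using nonneg by simp
  have model': "gu + wu + \<gamma> * d\<^sup>2 / 2 + (\<gamma> * p\<^sup>2 - \<kappa> * p\<^sup>2) / 2 \<le> gh + wh + \<gamma> * q\<^sup>2 / 2"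
    using model by (simp add: left_diff_distrib)
  have prx': "fh + wh + \<rho> * q\<^sup>2 / 2 + (\<rho> * p\<^sup>2 - lam * p\<^sup>2 - \<kappa> * p\<^sup>2) / 2 \<le> fu + wu + \<rho> * d\<^sup>2 / 2"
    using prx by (simp add: left_diff_distrib distrib_right diff_diff_eq)
  have "(\<gamma> * p\<^sup>2 - \<kappa> * p\<^sup>2 - 2 * (lam * p\<^sup>2)) / 2 - (\<gamma> * q\<^sup>2 - \<kappa> * q\<^sup>2 - 2 * (lam * q\<^sup>2)) / 2
      \<le> - ((\<rho> * q\<^sup>2 - \<kappa> * q\<^sup>2) / 2) + (hh - fh) - (he - fe) + (\<epsilon>\<^sub>e + \<epsilon>\<^sub>h) + (l + L)\<^sup>2 / (2 * \<delta>)"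
    using model' prx' gu ge gh fu t1 t2 t3 t4
    unfolding diff_divide_distrib add_divide_distrib by linarith
  moreover have "(\<gamma> - \<kappa> - 2 * lam) / 2 * (p\<^sup>2 - q\<^sup>2)
      = (\<gamma> * p\<^sup>2 - \<kappa> * p\<^sup>2 - 2 * (lam * p\<^sup>2)) / 2 - (\<gamma> * q\<^sup>2 - \<kappa> * q\<^sup>2 - 2 * (lam * q\<^sup>2)) / 2"
    by (simp add: left_diff_distrib right_diff_distrib diff_divide_distrib)
  moreover have "- ((\<rho> - \<kappa>) / 2) * q\<^sup>2 = - ((\<rho> * q\<^sup>2 - \<kappa> * q\<^sup>2) / 2)"
    by (simp add: left_diff_distrib diff_divide_distrib)
  ultimately show ?thesis
    by linarith
qed

text \<open>
  The stochastic problem without the algorithm: \<open>edom \<omega>\<close> is the feasible set, and the constants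
  \<open>L\<^sub>f = L\<^sub>h L\<^sub>c\<close> and \<open>lam = L\<^sub>h C\<close> turn out to be a Lipschitz and a weak convexity constant of the expected
  loss.
\<close>

locale composite_problem = prob_space \<Xi> for \<Xi> :: "'s measure" +
  fixes h :: "real \<Rightarrow> real"
    and c :: "'a::euclidean_space \<Rightarrow> 's \<Rightarrow> real"
    and \<omega> :: "'a \<Rightarrow> ereal"
    and C\<^sub>\<xi> L\<^sub>\<xi> :: "'s \<Rightarrow> real"
    and C L\<^sub>c L\<^sub>h L\<^sub>\<omega> L\<^sub>f \<kappa> lam :: real
  assumes proper: "\<And>y. \<omega> y \<noteq> -\<infinity>"
    and lsc: "lower_semicontinuous \<omega>"
    and lipschitz_omega: "L\<^sub>\<omega>-lipschitz_on (edom \<omega>) (\<lambda>y. real_of_ereal (\<omega> y))"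
    and wconvex_omega: "weakly_convex \<kappa> \<omega>"
    and nonempty: "edom \<omega> \<noteq> {}"
    and convex_h: "convex_on UNIV h" and lipschitz_h: "L\<^sub>h-lipschitz_on UNIV h"
    and meas_c: "\<And>y. c y \<in> borel_measurable \<Xi>"
    and integrable_hc: "\<And>y. y \<in> edom \<omega> \<Longrightarrow> integrable \<Xi> (\<lambda>s. h (c y s))"
    and diff_c: "\<And>s y. s \<in> space \<Xi> \<Longrightarrow> (\<lambda>u. c u s) differentiable (at y)"
    and lipschitz_gradient_c: "\<And>s. s \<in> space \<Xi> \<Longrightarrow> (C\<^sub>\<xi> s)-lipschitz_on UNIV (gradient (\<lambda>u. c u s))"
    and lipschitz_c: "\<And>s. s \<in> space \<Xi> \<Longrightarrow> (L\<^sub>\<xi> s)-lipschitz_on (edom \<omega>) (\<lambda>u. c u s)"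
    and C: "0 \<le> C" "integrable \<Xi> (\<lambda>s. (C\<^sub>\<xi> s)\<^sup>2)" "(\<integral>s. (C\<^sub>\<xi> s)\<^sup>2 \<partial>\<Xi>) \<le> C\<^sup>2"
    and L\<^sub>c: "0 \<le> L\<^sub>c" "integrable \<Xi> (\<lambda>s. (L\<^sub>\<xi> s)\<^sup>2)" "(\<integral>s. (L\<^sub>\<xi> s)\<^sup>2 \<partial>\<Xi>) \<le> L\<^sub>c\<^sup>2"
    and L\<^sub>f: "L\<^sub>f = L\<^sub>h * L\<^sub>c" and lam: "lam = L\<^sub>h * C"
begin

abbreviation A :: "'a set" where "A \<equiv> edom \<omega>"

abbreviation \<omega>\<^sub>r :: "'a \<Rightarrow> real" where "\<omega>\<^sub>r y \<equiv> real_of_ereal (\<omega> y)"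

definition loss :: "'a \<Rightarrow> real" where "loss y = (\<integral>s. h (c y s) \<partial>\<Xi>)"

definition obj :: "'a \<Rightarrow> real" where "obj y = loss y + \<omega>\<^sub>r y"

definition model :: "'a \<Rightarrow> 's \<Rightarrow> 'a \<Rightarrow> real" where
  "model z s y = partial_linearization h c z y s + \<omega>\<^sub>r y"

lemma closed_A: "closed A"
  by (rule closed_edom_lipschitz[OF lsc proper lipschitz_omega])

lemma convex_A: "convex A"
  by (rule weakly_convex_edom(1)[OF wconvex_omega proper])

lemma wconvex_omega_r: "weakly_convex_on \<kappa> A \<omega>\<^sub>r"
  by (rule weakly_convex_edom(2)[OF wconvex_omega proper])

lemma omega_eq: "y \<in> A \<Longrightarrow> \<omega> y = ereal (\<omega>\<^sub>r y)"
  using proper[of y] unfolding edom_def by (cases "\<omega> y") auto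

lemma kappa_nonneg: "0 \<le> \<kappa>"
  using wconvex_omega by (simp add: weakly_convex_def)

lemma L_h_nonneg: "0 \<le> L\<^sub>h"
  using lipschitz_h by (rule lipschitz_on_nonneg)

lemma L_f_nonneg: "0 \<le> L\<^sub>f"
  using L_h_nonneg L\<^sub>c(1) by (simp add: L\<^sub>f)

lemma lam_nonneg: "0 \<le> lam"
  using L_h_nonneg C(1) by (simp add: lam)

lemma L_omega_nonneg: "0 \<le> L\<^sub>\<omega>"
  using lipschitz_omega by (rule lipschitz_on_nonneg)

lemma C_moments: "integrable \<Xi> C\<^sub>\<xi>" "expectation C\<^sub>\<xi> \<le> C"
  using second_moment_bound(1,2)[OF _ C(2,3,1)] lipschitz_on_nonneg[OF lipschitz_gradient_c]
  by blast+

lemma L_moments: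
  shows "integrable \<Xi> L\<^sub>\<xi>" and "expectation L\<^sub>\<xi> \<le> L\<^sub>c"
    and "0 \<le> b \<Longrightarrow> integrable \<Xi> (\<lambda>s. (L\<^sub>h * L\<^sub>\<xi> s + b)\<^sup>2)"
    and "0 \<le> b \<Longrightarrow> (\<integral>s. (L\<^sub>h * L\<^sub>\<xi> s + b)\<^sup>2 \<partial>\<Xi>) \<le> (L\<^sub>f + b)\<^sup>2"
proof -
  note L = second_moment_bound[OF _ L\<^sub>c(2,3,1)]
  have "0 \<le> L\<^sub>\<xi> s" if "s \<in> space \<Xi>" for s
    using lipschitz_c[OF that] by (rule lipschitz_on_nonneg)
  note L = L[OF this]
  show "integrable \<Xi> L\<^sub>\<xi>" and "expectation L\<^sub>\<xi> \<le> L\<^sub>c"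
    by (rule L(1), assumption) (rule L(2), assumption)
  assume b: "0 \<le> b"
  show "integrable \<Xi> (\<lambda>s. (L\<^sub>h * L\<^sub>\<xi> s + b)\<^sup>2)"
    by (rule L(3)[OF _ L_h_nonneg b])
  show "(\<integral>s. (L\<^sub>h * L\<^sub>\<xi> s + b)\<^sup>2 \<partial>\<Xi>) \<le> (L\<^sub>f + b)\<^sup>2"
    unfolding L\<^sub>f by (rule L(4)[OF _ L_h_nonneg b])
qed

lemma lipschitz_loss: "L\<^sub>f-lipschitz_on A loss"
proof (rule lipschitz_onI[OF _ L_f_nonneg])
  fix u v assume u: "u \<in> A" and v: "v \<in> A"
  have "\<bar>loss u - loss v\<bar> = \<bar>\<integral>s. h (c u s) - h (c v s) \<partial>\<Xi>\<bar>"
    unfolding loss_def using integrable_hc[OF u] integrable_hc[OF v] by simp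
  also have "\<dots> \<le> (\<integral>s. L\<^sub>h * (L\<^sub>\<xi> s * norm (u - v)) \<partial>\<Xi>)"
  proof (rule integral_abs_bound[THEN order.trans], rule integral_mono)
    fix s assume s: "s \<in> space \<Xi>"
    have "\<bar>c u s - c v s\<bar> \<le> L\<^sub>\<xi> s * norm (u - v)"
      using lipschitz_onD[OF lipschitz_c[OF s] u v] by (simp add: dist_norm)
    then show "\<bar>h (c u s) - h (c v s)\<bar> \<le> L\<^sub>h * (L\<^sub>\<xi> s * norm (u - v))"
      by (rule lipschitz_real_le[OF lipschitz_h])
  qed (use integrable_hc[OF u] integrable_hc[OF v] L_moments(1) in auto)
  also have "\<dots> = L\<^sub>h * norm (u - v) * expectation L\<^sub>\<xi>"
    by simp
  also have "\<dots> \<le> L\<^sub>h * norm (u - v) * L\<^sub>c"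
    using L_h_nonneg by (intro mult_left_mono L_moments(2)) simp
  finally show "dist (loss u) (loss v) \<le> L\<^sub>f * dist u v"
    by (simp add: dist_norm L\<^sub>f mult.commute mult.left_commute)
qed

text \<open>
  Each sampled loss is weakly convex with the random constant \<open>L\<^sub>h C\<^sub>\<xi>\<close>; the chord defect is linear in
  this constant, so only its mean enters.
\<close>

lemma wconvex_loss: "weakly_convex_on lam A loss"
  unfolding weakly_convex_on_def
proof (intro ballI)
  fix a b :: 'a and t :: real assume a: "a \<in> A" and b: "b \<in> A" and t: "t \<in> {0..1}"
  let ?y = "(1 - t) *\<^sub>R a + t *\<^sub>R b"
  let ?k = "L\<^sub>h / 2 * (t * (1 - t)) * (norm (a - b))\<^sup>2"
  have y: "?y \<in> A"
    using convex_A a b t by (simp add: convex_alt)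
  have "loss ?y \<le> (\<integral>s. (1 - t) * h (c a s) + t * h (c b s) + ?k * C\<^sub>\<xi> s \<partial>\<Xi>)"
    unfolding loss_def
  proof (rule integral_mono)
    fix s assume s: "s \<in> space \<Xi>"
    have "h (c ?y s) \<le> (1 - t) * h (c a s) + t * h (c b s)
        + L\<^sub>h * C\<^sub>\<xi> s / 2 * (t * (1 - t)) * (norm (a - b))\<^sup>2"
      using weakly_convex_on_composition[OF convex_h lipschitz_h diff_c[OF s] lipschitz_gradient_c[OF s], of A] a b t
      unfolding weakly_convex_on_def by blast
    moreover have "L\<^sub>h * C\<^sub>\<xi> s / 2 * (t * (1 - t)) * (norm (a - b))\<^sup>2 = ?k * C\<^sub>\<xi> s"
      by simp
    ultimately show "h (c ?y s) \<le> (1 - t) * h (c a s) + t * h (c b s) + ?k * C\<^sub>\<xi> s"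
      by linarith
  qed (use integrable_hc a b y C_moments(1) in auto)
  also have "\<dots> = (1 - t) * loss a + t * loss b + ?k * expectation C\<^sub>\<xi>"
    unfolding loss_def using integrable_hc a b C_moments(1) by simp
  also have "\<dots> \<le> (1 - t) * loss a + t * loss b + ?k * C"
    using L_h_nonneg t by (intro add_left_mono mult_left_mono C_moments(2)) auto
  finally show "loss ?y \<le> (1 - t) * loss a + t * loss b + lam / 2 * (t * (1 - t)) * (norm (a - b))\<^sup>2"
    by (simp add: lam mult.commute mult.left_commute)
qed

lemma prox_problem_obj:
  assumes "2 * lam + \<kappa> < \<rho>"
  shows "prox_problem A obj (L\<^sub>f + L\<^sub>\<omega>) (lam + \<kappa>) \<rho>"
proof
  show "(L\<^sub>f + L\<^sub>\<omega>)-lipschitz_on A obj"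
    unfolding obj_def by (intro lipschitz_on_add lipschitz_loss lipschitz_omega)
  show "weakly_convex_on (lam + \<kappa>) A obj"
    unfolding obj_def by (intro weakly_convex_on_add wconvex_loss wconvex_omega_r)
qed (use closed_A convex_A nonempty kappa_nonneg lam_nonneg assms in auto)

lemma prox_problem_model:
  assumes "\<kappa> < \<gamma>" and z: "z \<in> A" and s: "s \<in> space \<Xi>"
  shows "prox_problem A (model z s) (L\<^sub>h * L\<^sub>\<xi> s + L\<^sub>\<omega>) \<kappa> \<gamma>"
proof
  show "(L\<^sub>h * L\<^sub>\<xi> s + L\<^sub>\<omega>)-lipschitz_on A (model z s)"
    unfolding model_def
    by (intro lipschitz_on_add lipschitz_omega lipschitz_on_partial_linearization
        lipschitz_h convex_A z lipschitz_c diff_c s)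
  show "weakly_convex_on \<kappa> A (model z s)"
    using weakly_convex_on_add[OF weakly_convex_on_partial_linearization[OF convex_h, of A c z s] wconvex_omega_r]
    unfolding model_def by simp
qed (use closed_A convex_A nonempty kappa_nonneg assms in auto)

lemma objective_eq: "objective \<Xi> h c \<omega> y = (if y \<in> A then ereal (obj y) else \<infinity>)"
proof (cases "y \<in> A")
  case True
  have "objective \<Xi> h c \<omega> y = ereal (loss y) + \<omega> y"
    unfolding objective_def loss_def ..
  also have "\<dots> = ereal (loss y) + ereal (\<omega>\<^sub>r y)"
    using omega_eq[OF True] by (rule arg_cong)
  finally show ?thesis
    using True by (simp add: obj_def del: ereal_real)
next
  case False
  then show ?thesis
    by (simp add: objective_def edom_def)
qed

lemma moreau_envelope_eq:
  assumes \<rho>: "2 * lam + \<kappa> < \<rho>"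
  shows "moreau_envelope \<rho> (objective \<Xi> h c \<omega>) x = ereal (env \<rho> A obj x)"
  unfolding moreau_envelope_def
proof (rule antisym)
  interpret prox_problem A obj "L\<^sub>f + L\<^sub>\<omega>" "lam + \<kappa>" \<rho>
    by (rule prox_problem_obj[OF \<rho>])
  let ?p = "prox \<rho> A obj x"
  have "(INF y. objective \<Xi> h c \<omega> y + ereal (\<rho> / 2 * (norm (x - y))\<^sup>2))
      \<le> objective \<Xi> h c \<omega> ?p + ereal (\<rho> / 2 * (norm (x - ?p))\<^sup>2)"
    by (rule INF_lower) simp
  also have "\<dots> = ereal (env \<rho> A obj x)"
    using prox_mem[of x] by (simp add: objective_eq env_def norm_minus_commute)
  finally show "(INF y. objective \<Xi> h c \<omega> y + ereal (\<rho> / 2 * (norm (x - y))\<^sup>2)) \<le> ereal (env \<rho> A obj x)" .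
  show "ereal (env \<rho> A obj x) \<le> (INF y. objective \<Xi> h c \<omega> y + ereal (\<rho> / 2 * (norm (x - y))\<^sup>2))"
    using env_le[of _ x] by (intro INF_greatest) (auto simp: objective_eq norm_minus_commute)
qed

text \<open>
  For a fixed sample the next point \<open>u\<close> and the proximal point \<open>xh\<close> are compared, each in the
  minimization problem solved by the other. The model is replaced by the sampled loss only at \<open>e\<close> and
  at \<open>xh\<close>: these do not depend on the sample, so that the differences between sampled and expected loss
  average out later. The transition from \<open>e\<close> to \<open>u\<close> costs the Lipschitz constants of model and loss.
\<close>

lemma one_step_pointwise:
  assumes \<rho>: "2 * lam + \<kappa> < \<rho>" and \<delta>: "\<delta> = \<gamma> - \<rho> - \<kappa> - 6 * lam" "0 < \<delta>"
    and e: "e \<in> A" and z: "z \<in> A" and s: "s \<in> space \<Xi>"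
    and xh: "xh = prox \<rho> A obj e" and u: "u = prox \<gamma> A (model z s) e"
  shows "(\<gamma> - \<kappa> - 2 * lam) / \<rho> * (env \<rho> A obj u - env \<rho> A obj e)
      \<le> - ((\<rho> - \<kappa>) / 2) * (norm (xh - e))\<^sup>2 + (h (c xh s) - loss xh) - (h (c e s) - loss e)
        + (L\<^sub>h * C\<^sub>\<xi> s / 2 * (norm (e - z))\<^sup>2 + L\<^sub>h * C\<^sub>\<xi> s / 2 * (norm (xh - z))\<^sup>2)
        + (L\<^sub>h * L\<^sub>\<xi> s + L\<^sub>f)\<^sup>2 / (2 * \<delta>)"
proof -
  interpret O: prox_problem A obj "L\<^sub>f + L\<^sub>\<omega>" "lam + \<kappa>" \<rho>
    by (rule prox_problem_obj[OF \<rho>])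
  have \<gamma>: "\<kappa> < \<gamma>" "\<kappa> + 2 * lam < \<gamma>"
    using \<delta> \<rho> kappa_nonneg lam_nonneg by simp_all
  interpret P: prox_problem A "model z s" "L\<^sub>h * L\<^sub>\<xi> s + L\<^sub>\<omega>" \<kappa> \<gamma>
    by (rule prox_problem_model[OF \<gamma>(1) z s])
  have u_A: "u \<in> A" and xh_A: "xh \<in> A"
    unfolding u xh by (rule P.prox_mem O.prox_mem)+
  have lin: "\<bar>h (c y s) - partial_linearization h c z y s\<bar> \<le> L\<^sub>h * C\<^sub>\<xi> s / 2 * (norm (y - z))\<^sup>2" for y
    using s by (intro partial_linearization_error[where c = c] lipschitz_h diff_c lipschitz_gradient_c)
  have lin_lipschitz: "(L\<^sub>h * L\<^sub>\<xi> s)-lipschitz_on A (\<lambda>y. partial_linearization h c z y s)"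
    using s z by (intro lipschitz_on_partial_linearization lipschitz_h convex_A lipschitz_c diff_c)
  have "(\<gamma> - \<kappa> - 2 * lam) / 2 * ((norm (xh - u))\<^sup>2 - (norm (xh - e))\<^sup>2)
      \<le> - ((\<rho> - \<kappa>) / 2) * (norm (xh - e))\<^sup>2 + (h (c xh s) - loss xh) - (h (c e s) - loss e)
        + (L\<^sub>h * C\<^sub>\<xi> s / 2 * (norm (e - z))\<^sup>2 + L\<^sub>h * C\<^sub>\<xi> s / 2 * (norm (xh - z))\<^sup>2)
        + (L\<^sub>h * L\<^sub>\<xi> s + L\<^sub>f)\<^sup>2 / (2 * \<delta>)"
  proof (rule one_step_arithmetic)
    show "partial_linearization h c z u s + \<omega>\<^sub>r u + \<gamma> / 2 * (norm (u - e))\<^sup>2 + (\<gamma> - \<kappa>) / 2 * (norm (xh - u))\<^sup>2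
        \<le> partial_linearization h c z xh s + \<omega>\<^sub>r xh + \<gamma> / 2 * (norm (xh - e))\<^sup>2"
      using P.prox_gap[OF xh_A, of e] unfolding u[symmetric] model_def .
    show "loss xh + \<omega>\<^sub>r xh + \<rho> / 2 * (norm (xh - e))\<^sup>2 + (\<rho> - (lam + \<kappa>)) / 2 * (norm (xh - u))\<^sup>2
        \<le> loss u + \<omega>\<^sub>r u + \<rho> / 2 * (norm (u - e))\<^sup>2"
      using O.prox_gap[OF u_A, of e] unfolding xh[symmetric] obj_def norm_minus_commute[of u xh] .
    show "partial_linearization h c z e s - L\<^sub>h * L\<^sub>\<xi> s * norm (u - e) \<le> partial_linearization h c z u s"
      using lipschitz_onD[OF lin_lipschitz u_A e] unfolding dist_norm real_norm_def by linarith
    show "loss u \<le> loss e + L\<^sub>f * norm (u - e)"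
      using lipschitz_onD[OF lipschitz_loss u_A e] unfolding dist_norm real_norm_def by linarith
    show "h (c e s) - L\<^sub>h * C\<^sub>\<xi> s / 2 * (norm (e - z))\<^sup>2 \<le> partial_linearization h c z e s"
      using lin[of e] by linarith
    show "partial_linearization h c z xh s \<le> h (c xh s) + L\<^sub>h * C\<^sub>\<xi> s / 2 * (norm (xh - z))\<^sup>2"
      using lin[of xh] by linarith
    show "norm (xh - e) \<le> norm (xh - u) + norm (u - e)"
      using norm_triangle_ineq[of "xh - u" "u - e"] by simp
  qed (use \<rho> \<delta> kappa_nonneg lam_nonneg in auto)
  moreover have "(\<gamma> - \<kappa> - 2 * lam) / \<rho> * (env \<rho> A obj u - env \<rho> A obj e)
      \<le> (\<gamma> - \<kappa> - 2 * lam) / 2 * ((norm (xh - u))\<^sup>2 - (norm (xh - e))\<^sup>2)"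
  proof -
    have "env \<rho> A obj u - env \<rho> A obj e \<le> \<rho> / 2 * ((norm (xh - u))\<^sup>2 - (norm (xh - e))\<^sup>2)"
      using O.env_le[OF xh_A, of u] unfolding env_def[of \<rho> A obj e] xh[symmetric]
      by (simp add: right_diff_distrib)
    then have "(\<gamma> - \<kappa> - 2 * lam) / \<rho> * (env \<rho> A obj u - env \<rho> A obj e)
        \<le> (\<gamma> - \<kappa> - 2 * lam) / \<rho> * (\<rho> / 2 * ((norm (xh - u))\<^sup>2 - (norm (xh - e))\<^sup>2))"
      using \<gamma> \<rho> kappa_nonneg lam_nonneg by (intro mult_left_mono) auto
    also have "\<dots> = (\<gamma> - \<kappa> - 2 * lam) / 2 * ((norm (xh - u))\<^sup>2 - (norm (xh - e))\<^sup>2)"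
      using \<rho> kappa_nonneg lam_nonneg by simp
    finally show ?thesis .
  qed
  ultimately show ?thesis
    by linarith
qed

text \<open>
  In the mean the fluctuations of the sampled loss vanish and the linearization constant becomes
  \<open>lam\<close>; of the error at \<open>xh\<close> a part \<open>lam \<parallel>xh - e\<parallel>\<^sup>2\<close> is charged to the descent, whence
  \<open>\<rho> - 2 lam - \<kappa>\<close>. The envelope is shifted by a lower bound \<open>i\<close> so that all terms are nonnegative and the
  inequality can be integrated over \<open>e\<close> and \<open>z\<close> without integrability conditions.
\<close>

lemma one_step_expected:
  assumes \<rho>: "2 * lam + \<kappa> < \<rho>" and \<delta>: "\<delta> = \<gamma> - \<rho> - \<kappa> - 6 * lam" "0 < \<delta>"
    and e: "e \<in> A" and z: "z \<in> A" and lower: "\<And>y. i \<le> env \<rho> A obj y"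
  shows "ennreal ((\<rho> - 2 * lam - \<kappa>) / 2 * (norm (prox \<rho> A obj e - e))\<^sup>2)
      + (\<integral>\<^sup>+s. ennreal ((\<gamma> - \<kappa> - 2 * lam) / \<rho> * (env \<rho> A obj (prox \<gamma> A (model z s) e) - i)) \<partial>\<Xi>)
      \<le> ennreal ((\<gamma> - \<kappa> - 2 * lam) / \<rho> * (env \<rho> A obj e - i))
        + ennreal (2 * L\<^sub>f\<^sup>2 / \<delta> + 3 / 2 * lam * (norm (e - z))\<^sup>2)"
proof -
  interpret O: prox_problem A obj "L\<^sub>f + L\<^sub>\<omega>" "lam + \<kappa>" \<rho>
    by (rule prox_problem_obj[OF \<rho>])
  define xh where "xh = prox \<rho> A obj e"
  have xh_A: "xh \<in> A"
    unfolding xh_def by (rule O.prox_mem)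
  define b where "b = (\<gamma> - \<kappa> - 2 * lam) / \<rho>"
  have b: "0 \<le> b"
    unfolding b_def using \<delta> \<rho> kappa_nonneg lam_nonneg by simp
  define N where "N = (norm (e - z))\<^sup>2 + (norm (xh - z))\<^sup>2"
  define k where "k = b * (env \<rho> A obj e - i) - (\<rho> - \<kappa>) / 2 * (norm (xh - e))\<^sup>2 - loss xh + loss e"
  \<comment> \<open>the pointwise bound, arranged as a constant plus integrable functions of the sample\<close>
  define R where "R s = k + (h (c xh s) - h (c e s)) + L\<^sub>h / 2 * N * C\<^sub>\<xi> s
      + inverse (2 * \<delta>) * (L\<^sub>h * L\<^sub>\<xi> s + L\<^sub>f)\<^sup>2" for s
  have le_R: "b * (env \<rho> A obj (prox \<gamma> A (model z s) e) - i) \<le> R s" if s: "s \<in> space \<Xi>" for s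
  proof -
    let ?u = "prox \<gamma> A (model z s) e"
    have "b * (env \<rho> A obj ?u - i) = b * (env \<rho> A obj ?u - env \<rho> A obj e) + b * (env \<rho> A obj e - i)"
      by (simp add: right_diff_distrib)
    moreover have "L\<^sub>h * C\<^sub>\<xi> s / 2 * (norm (e - z))\<^sup>2 + L\<^sub>h * C\<^sub>\<xi> s / 2 * (norm (xh - z))\<^sup>2
        = L\<^sub>h / 2 * N * C\<^sub>\<xi> s"
      unfolding N_def distrib_left[symmetric] by simp
    moreover have "(L\<^sub>h * L\<^sub>\<xi> s + L\<^sub>f)\<^sup>2 / (2 * \<delta>) = inverse (2 * \<delta>) * (L\<^sub>h * L\<^sub>\<xi> s + L\<^sub>f)\<^sup>2"
      by (simp only: divide_inverse mult.commute)
    moreover note one_step_pointwise[OF \<rho> \<delta> e z s refl refl, folded xh_def b_def]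
    ultimately show ?thesis
      unfolding R_def k_def mult_minus_left by linarith
  qed
  have R_nonneg: "0 \<le> R s" if s: "s \<in> space \<Xi>" for s
  proof -
    have "0 \<le> b * (env \<rho> A obj (prox \<gamma> A (model z s) e) - i)"
      using b lower[of "prox \<gamma> A (model z s) e"] by simp
    with le_R[OF s] show ?thesis by linarith
  qed
  have int_R: "integrable \<Xi> R"
    unfolding R_def
    using integrable_hc[OF xh_A] integrable_hc[OF e] C_moments(1) L_moments(3)[OF L_f_nonneg] by simp
  have "expectation R = k + (loss xh - loss e) + L\<^sub>h / 2 * N * expectation C\<^sub>\<xi>
      + inverse (2 * \<delta>) * expectation (\<lambda>s. (L\<^sub>h * L\<^sub>\<xi> s + L\<^sub>f)\<^sup>2)"
    unfolding R_def loss_def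
    using integrable_hc[OF xh_A] integrable_hc[OF e] C_moments(1) L_moments(3)[OF L_f_nonneg]
    by (simp add: prob_space)
  also have "\<dots> \<le> k + (loss xh - loss e) + L\<^sub>h / 2 * N * C + inverse (2 * \<delta>) * (L\<^sub>f + L\<^sub>f)\<^sup>2"
    using L_h_nonneg \<delta>(2) L_f_nonneg
    by (intro add_mono add_left_mono mult_left_mono C_moments(2) L_moments(4)) (auto simp: N_def)
  finally have "expectation R \<le> b * (env \<rho> A obj e - i) - (\<rho> - \<kappa>) / 2 * (norm (xh - e))\<^sup>2
      + lam / 2 * N + inverse (2 * \<delta>) * (L\<^sub>f + L\<^sub>f)\<^sup>2"
    by (simp add: k_def lam mult.commute mult.left_commute)
  moreover have "inverse (2 * \<delta>) * (L\<^sub>f + L\<^sub>f)\<^sup>2 = 2 * L\<^sub>f\<^sup>2 / \<delta>"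
    using \<delta>(2) by (simp add: field_simps power2_eq_square)
  moreover have "lam / 2 * N \<le> lam / 2 * (3 * (norm (e - z))\<^sup>2 + 2 * (norm (xh - e))\<^sup>2)"
  proof (rule mult_left_mono)
    have "norm (xh - z) \<le> norm (xh - e) + norm (e - z)"
      using norm_triangle_ineq[of "xh - e" "e - z"] by simp
    then have "(norm (xh - z))\<^sup>2 \<le> (norm (xh - e) + norm (e - z))\<^sup>2"
      by (rule power_mono) simp
    also have "\<dots> \<le> 2 * (norm (xh - e))\<^sup>2 + 2 * (norm (e - z))\<^sup>2"
      using zero_le_power2[of "norm (xh - e) - norm (e - z)"] unfolding power2_sum power2_diff by linarith
    finally show "N \<le> 3 * (norm (e - z))\<^sup>2 + 2 * (norm (xh - e))\<^sup>2"
      unfolding N_def by linarith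
  qed (use lam_nonneg in simp)
  moreover have "lam / 2 * (3 * (norm (e - z))\<^sup>2 + 2 * (norm (xh - e))\<^sup>2)
      = 3 / 2 * lam * (norm (e - z))\<^sup>2 + lam * (norm (xh - e))\<^sup>2"
    by (simp add: distrib_left)
  moreover have "(\<rho> - 2 * lam - \<kappa>) / 2 * (norm (xh - e))\<^sup>2
      = (\<rho> - \<kappa>) / 2 * (norm (xh - e))\<^sup>2 - lam * (norm (xh - e))\<^sup>2"
    by (simp add: left_diff_distrib diff_divide_distrib)
  ultimately have ER: "(\<rho> - 2 * lam - \<kappa>) / 2 * (norm (xh - e))\<^sup>2 + expectation R
      \<le> b * (env \<rho> A obj e - i) + (2 * L\<^sub>f\<^sup>2 / \<delta> + 3 / 2 * lam * (norm (e - z))\<^sup>2)"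
    by linarith
  have "(\<integral>\<^sup>+s. ennreal (b * (env \<rho> A obj (prox \<gamma> A (model z s) e) - i)) \<partial>\<Xi>) \<le> (\<integral>\<^sup>+s. ennreal (R s) \<partial>\<Xi>)"
    by (rule nn_integral_mono) (intro ennreal_leI le_R)
  also have "\<dots> = ennreal (expectation R)"
    by (rule nn_integral_eq_integral[OF int_R]) (simp add: R_nonneg)
  finally have "ennreal ((\<rho> - 2 * lam - \<kappa>) / 2 * (norm (xh - e))\<^sup>2)
      + (\<integral>\<^sup>+s. ennreal (b * (env \<rho> A obj (prox \<gamma> A (model z s) e) - i)) \<partial>\<Xi>)
      \<le> ennreal ((\<rho> - 2 * lam - \<kappa>) / 2 * (norm (xh - e))\<^sup>2) + ennreal (expectation R)"
    by (rule add_left_mono)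
  also have "\<dots> = ennreal ((\<rho> - 2 * lam - \<kappa>) / 2 * (norm (xh - e))\<^sup>2 + expectation R)"
    using \<rho> by (intro ennreal_plus[symmetric]) (auto intro: Bochner_Integration.integral_nonneg R_nonneg)
  also have "\<dots> \<le> ennreal (b * (env \<rho> A obj e - i) + (2 * L\<^sub>f\<^sup>2 / \<delta> + 3 / 2 * lam * (norm (e - z))\<^sup>2))"
    using ER by (rule ennreal_leI)
  also have "\<dots> = ennreal (b * (env \<rho> A obj e - i)) + ennreal (2 * L\<^sub>f\<^sup>2 / \<delta> + 3 / 2 * lam * (norm (e - z))\<^sup>2)"
    using b lower[of e] \<delta>(2) lam_nonneg by (intro ennreal_plus) auto
  finally show ?thesis
    unfolding b_def xh_def .
qed

lemma borel_measurable_prox_model: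
  assumes \<gamma>: "\<kappa> < \<gamma>" and Z: "Z \<in> borel_measurable N" "\<And>p. p \<in> space N \<Longrightarrow> Z p \<in> A"
    and E: "E \<in> borel_measurable N" and X: "X \<in> measurable N \<Xi>"
  shows "(\<lambda>p. prox \<gamma> A (model (Z p) (X p)) (E p)) \<in> borel_measurable N"
proof (rule borel_measurable_strong_minimizer[OF nonempty,
      where G = "\<lambda>y p. model (Z p) (X p) y + \<gamma> / 2 * (norm (y - E p))\<^sup>2" and \<sigma> = "(\<gamma> - \<kappa>) / 2"])
  fix p assume p: "p \<in> space N"
  interpret P: prox_problem A "model (Z p) (X p)" "L\<^sub>h * L\<^sub>\<xi> (X p) + L\<^sub>\<omega>" \<kappa> \<gamma>
    by (rule prox_problem_model[OF \<gamma> Z(2)[OF p] measurable_space[OF X p]])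
  show "continuous_on A (\<lambda>y. model (Z p) (X p) y + \<gamma> / 2 * (norm (y - E p))\<^sup>2)"
    by (intro continuous_intros lipschitz_on_continuous_on[OF P.lipschitz_F])
  show "prox \<gamma> A (model (Z p) (X p)) (E p) \<in> A"
    by (rule P.prox_mem)
  fix y assume "y \<in> A"
  then show "model (Z p) (X p) (prox \<gamma> A (model (Z p) (X p)) (E p))
      + \<gamma> / 2 * (norm (prox \<gamma> A (model (Z p) (X p)) (E p) - E p))\<^sup>2
      + (\<gamma> - \<kappa>) / 2 * (norm (y - prox \<gamma> A (model (Z p) (X p)) (E p)))\<^sup>2
    \<le> model (Z p) (X p) y + \<gamma> / 2 * (norm (y - E p))\<^sup>2"
    by (rule P.prox_gap)
next
  fix y assume "y \<in> A"
  have [measurable]: "h \<in> borel_measurable borel"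
    using lipschitz_on_continuous_on[OF lipschitz_h] by (rule borel_measurable_continuous_onI)
  note Z(1)[measurable] E[measurable]
  have [measurable]: "(\<lambda>p. c (Z p) (X p)) \<in> borel_measurable N"
  proof (rule borel_measurable_Caratheodory[OF meas_c _ Z(1) X])
    fix s assume "s \<in> space \<Xi>"
    then show "continuous_on UNIV (\<lambda>y. c y s)"
      using differentiable_imp_continuous_on[of "\<lambda>y. c y s" UNIV] diff_c
      by (simp add: differentiable_on_def)
  qed
  have [measurable]: "(\<lambda>p. gradient (\<lambda>u. c u (X p)) (Z p) \<bullet> v) \<in> borel_measurable N" for v
  proof (rule borel_measurable_Caratheodory[OF borel_measurable_gradient[OF meas_c diff_c] _ Z(1) X])
    fix s assume "s \<in> space \<Xi>"
    then show "continuous_on UNIV (\<lambda>y. gradient (\<lambda>u. c u s) y \<bullet> v)"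
      by (intro continuous_intros lipschitz_on_continuous_on[OF lipschitz_gradient_c])
  qed assumption
  have "gradient (\<lambda>u. c u (X p)) (Z p) \<bullet> (y - Z p)
      = (\<Sum>v\<in>Basis. (gradient (\<lambda>u. c u (X p)) (Z p) \<bullet> v) * ((y - Z p) \<bullet> v))" for p
    by (rule euclidean_inner)
  then show "(\<lambda>p. model (Z p) (X p) y + \<gamma> / 2 * (norm (y - E p))\<^sup>2) \<in> borel_measurable N"
    unfolding model_def partial_linearization_def by simp
qed (use \<gamma> in simp)

end


section \<open>Independence and summation of the descent inequalities\<close>

text \<open>
  Independence makes the joint law a product, so that the second variable can be integrated out first,
  as in a conditional expectation given the first one. It is phrased by the events of the two variables
  because these may take values in different types.
\<close>

lemma (in prob_space) nn_integral_indep: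
  assumes X: "X \<in> measurable M S" and Y: "Y \<in> measurable M T"
    and ind: "indep_set {X -` A \<inter> space M | A. A \<in> sets S} {Y -` B \<inter> space M | B. B \<in> sets T}"
    and g: "(\<lambda>(x, y). g x y) \<in> borel_measurable (S \<Otimes>\<^sub>M T)"
  shows "(\<integral>\<^sup>+p. g (X p) (Y p) \<partial>M) = (\<integral>\<^sup>+p. (\<integral>\<^sup>+y. g (X p) y \<partial>distr M T Y) \<partial>M)"
    and "(\<lambda>x. \<integral>\<^sup>+y. g x y \<partial>distr M T Y) \<in> borel_measurable S"
proof -
  interpret X: prob_space "distr M S X"
    by (rule prob_space_distr[OF X])
  interpret Y: prob_space "distr M T Y"
    by (rule prob_space_distr[OF Y])
  have XY: "(\<lambda>p. (X p, Y p)) \<in> measurable M (S \<Otimes>\<^sub>M T)"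
    using X Y by (rule measurable_Pair)
  have eq: "distr M S X \<Otimes>\<^sub>M distr M T Y = distr M (S \<Otimes>\<^sub>M T) (\<lambda>p. (X p, Y p))"
  proof (rule pair_measure_eqI)
    fix A B assume "A \<in> sets (distr M S X)" "B \<in> sets (distr M T Y)"
    then have A: "A \<in> sets S" and B: "B \<in> sets T"
      by simp_all
    have "(\<lambda>p. (X p, Y p)) -` (A \<times> B) \<inter> space M = (X -` A \<inter> space M) \<inter> (Y -` B \<inter> space M)"
      by auto
    moreover have "prob ((X -` A \<inter> space M) \<inter> (Y -` B \<inter> space M))
        = prob (X -` A \<inter> space M) * prob (Y -` B \<inter> space M)"
      using ind A B unfolding indep_sets2_eq by blast
    ultimately show "emeasure (distr M S X) A * emeasure (distr M T Y) B
        = emeasure (distr M (S \<Otimes>\<^sub>M T) (\<lambda>p. (X p, Y p))) (A \<times> B)"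
      using A B X Y XY by (simp add: emeasure_distr emeasure_eq_measure ennreal_mult)
  qed (simp_all add: X.sigma_finite_measure_axioms Y.sigma_finite_measure_axioms cong: sets_pair_measure_cong)
  have g': "(\<lambda>z. g (fst z) (snd z)) \<in> borel_measurable (S \<Otimes>\<^sub>M distr M T Y)"
    "(\<lambda>z. g (fst z) (snd z)) \<in> borel_measurable (distr M S X \<Otimes>\<^sub>M distr M T Y)"
    "(\<lambda>z. g (fst z) (snd z)) \<in> borel_measurable (S \<Otimes>\<^sub>M T)"
    using g by (simp_all add: case_prod_beta' cong: measurable_cong_sets sets_pair_measure_cong)
  show meas: "(\<lambda>x. \<integral>\<^sup>+y. g x y \<partial>distr M T Y) \<in> borel_measurable S"
    using Y.borel_measurable_nn_integral_fst[OF g'(1)] by simp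
  have "(\<integral>\<^sup>+p. g (X p) (Y p) \<partial>M)
      = (\<integral>\<^sup>+z. g (fst z) (snd z) \<partial>(distr M (S \<Otimes>\<^sub>M T) (\<lambda>p. (X p, Y p))))"
    using g'(3) X Y by (subst nn_integral_distr) simp_all
  also have "\<dots> = (\<integral>\<^sup>+x. (\<integral>\<^sup>+y. g x y \<partial>distr M T Y) \<partial>distr M S X)"
    unfolding eq[symmetric] using Y.nn_integral_fst[OF g'(2)] by simp
  also have "\<dots> = (\<integral>\<^sup>+p. (\<integral>\<^sup>+y. g (X p) y \<partial>distr M T Y) \<partial>M)"
    using X meas by (subst nn_integral_distr) simp_all
  finally show "(\<integral>\<^sup>+p. g (X p) (Y p) \<partial>M) = (\<integral>\<^sup>+p. (\<integral>\<^sup>+y. g (X p) y \<partial>distr M T Y) \<partial>M)" .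
qed

lemma (in prob_space) nn_integral_uniform_index:
  fixes g :: "nat \<Rightarrow> 'b \<Rightarrow> ennreal"
  assumes ind: "indep_set (sets (vimage_algebra (space M) k (count_space UNIV)))
      (sets (vimage_algebra (space M) W N))"
    and W: "W \<in> measurable M N"
    and k: "distr M (count_space UNIV) k = measure_pmf (pmf_of_set S)"
    and S: "finite S" "S \<noteq> {}" and g: "\<And>j. g j \<in> borel_measurable N"
  shows "(\<integral>\<^sup>+p. g (k p) (W p) \<partial>M) = (\<Sum>j\<in>S. \<integral>\<^sup>+p. g j (W p) \<partial>M) / of_nat (card S)"
    and "AE p in M. k p \<in> S"
proof -
  have "sets (vimage_algebra (space M) k (count_space UNIV)) \<subseteq> events"
    using ind unfolding indep_sets2_eq by auto
  then have kM: "k \<in> measurable M (count_space UNIV)"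
    using in_vimage_algebra[of _ "count_space UNIV" k "space M"] by (auto intro!: measurableI)
  have ind': "indep_set {k -` A \<inter> space M | A. A \<in> sets (count_space UNIV)} {W -` B \<inter> space M | B. B \<in> sets N}"
    using ind unfolding indep_set_def sets_vimage_algebra
    by (rule indep_sets_mono_sets) (auto split: bool.split)
  have "(\<integral>\<^sup>+p. g (k p) (W p) \<partial>M) = (\<integral>\<^sup>+p. (\<integral>\<^sup>+w. g (k p) w \<partial>distr M N W) \<partial>M)"
    by (rule nn_integral_indep(1)[OF kM W ind'])
       (rule measurable_pair_measure_countable1, simp_all add: g)
  also have "\<dots> = (\<integral>\<^sup>+j. (\<integral>\<^sup>+w. g j w \<partial>distr M N W) \<partial>distr M (count_space UNIV) k)"
    using kM by (subst nn_integral_distr) simp_all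
  also have "\<dots> = (\<Sum>j\<in>S. \<integral>\<^sup>+w. g j w \<partial>distr M N W) / of_nat (card S)"
    unfolding k by (rule nn_integral_pmf_of_set[OF S(2,1)])
  also have "(\<lambda>j. \<integral>\<^sup>+w. g j w \<partial>distr M N W) = (\<lambda>j. \<integral>\<^sup>+p. g j (W p) \<partial>M)"
    using W g by (simp add: nn_integral_distr)
  finally show "(\<integral>\<^sup>+p. g (k p) (W p) \<partial>M) = (\<Sum>j\<in>S. \<integral>\<^sup>+p. g j (W p) \<partial>M) / of_nat (card S)" .
  have "AE j in distr M (count_space UNIV) k. j \<in> S"
    unfolding k by (simp add: AE_measure_pmf_iff S)
  then show "AE p in M. k p \<in> S"
    using kM by (simp add: AE_distr_iff)
qed

text \<open>
  The telescoping sum is carried out additively in the extended nonnegative reals: nothing is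
  subtracted, so the expectations \<open>v k\<close> need not be known to be finite.
\<close>

lemma sum_descent:
  fixes v a c :: "nat \<Rightarrow> ennreal"
  assumes move: "\<And>k. k \<in> {1..n} \<Longrightarrow> k \<in> S \<Longrightarrow> a k + v (Suc k) \<le> v k + c k"
    and stay: "\<And>k. k \<in> {1..n} \<Longrightarrow> k \<notin> S \<Longrightarrow> v (Suc k) = v k"
  shows "(\<Sum>k\<in>{1..n} \<inter> S. a k) + v (Suc n) \<le> v 1 + (\<Sum>k\<in>{1..n} \<inter> S. c k)"
  using assms
proof (induction n)
  case 0
  then show ?case by simp
next
  case (Suc n)
  have IH: "(\<Sum>k\<in>{1..n} \<inter> S. a k) + v (Suc n) \<le> v 1 + (\<Sum>k\<in>{1..n} \<inter> S. c k)"
    by (rule Suc.IH) (use Suc.prems in auto)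
  show ?case
  proof (cases "Suc n \<in> S")
    case True
    then have split: "{1..Suc n} \<inter> S = insert (Suc n) ({1..n} \<inter> S)"
      by (auto simp: atLeastAtMostSuc_conv)
    have "(\<Sum>k\<in>{1..Suc n} \<inter> S. a k) + v (Suc (Suc n))
        = (\<Sum>k\<in>{1..n} \<inter> S. a k) + (a (Suc n) + v (Suc (Suc n)))"
      unfolding split by (simp add: ac_simps)
    also have "\<dots> \<le> (\<Sum>k\<in>{1..n} \<inter> S. a k) + (v (Suc n) + c (Suc n))"
      using True by (intro add_left_mono Suc.prems(1)) simp_all
    also have "\<dots> \<le> v 1 + (\<Sum>k\<in>{1..n} \<inter> S. c k) + c (Suc n)"
      using add_right_mono[OF IH, of "c (Suc n)"] by (simp add: add.assoc)
    also have "\<dots> = v 1 + (\<Sum>k\<in>{1..Suc n} \<inter> S. c k)"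
      unfolding split by (simp add: ac_simps)
    finally show ?thesis .
  next
    case False
    then have "{1..Suc n} \<inter> S = {1..n} \<inter> S"
      by (auto simp: atLeastAtMostSuc_conv)
    with IH Suc.prems(2)[OF _ False] show ?thesis by simp
  qed
qed

lemma norm_diff_le_sum_steps:
  fixes y :: "nat \<Rightarrow> 'a::real_normed_vector"
  assumes "j \<le> k"
  shows "(norm (y k - y j))\<^sup>2 \<le> real (k - j) * (\<Sum>i=j..<k. (norm (y (Suc i) - y i))\<^sup>2)"
proof -
  have "y k - y j = (\<Sum>i=j..<k. y (Suc i) - y i)"
    using assms by (rule sum_Suc_diff'[symmetric])
  then have "norm (y k - y j) \<le> (\<Sum>i=j..<k. norm (y (Suc i) - y i))"
    by (simp add: norm_sum)
  then have "(norm (y k - y j))\<^sup>2 \<le> (\<Sum>i=j..<k. norm (y (Suc i) - y i))\<^sup>2"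
    by (rule power_mono) simp
  also have "\<dots> \<le> (\<Sum>i=j..<k. (norm (y (Suc i) - y i))\<^sup>2) * real (card {j..<k})"
    by (rule sum_squared_le_sum_of_squares)
  finally show ?thesis
    by (simp add: mult.commute)
qed

text \<open>
  A run for an arbitrary delay sequence \<open>\<tau>\<close>; the workers enter later, through the bounds on the sum of
  the delays.
\<close>

locale dspl_run = composite_problem \<Xi> h c \<omega> C\<^sub>\<xi> L\<^sub>\<xi> C L\<^sub>c L\<^sub>h L\<^sub>\<omega> L\<^sub>f \<kappa> lam + M: prob_space M
  for \<Xi> :: "'s measure" and h :: "real \<Rightarrow> real" and c :: "'a::euclidean_space \<Rightarrow> 's \<Rightarrow> real"
    and \<omega> :: "'a \<Rightarrow> ereal" and C\<^sub>\<xi> L\<^sub>\<xi> :: "'s \<Rightarrow> real" and C L\<^sub>c L\<^sub>h L\<^sub>\<omega> L\<^sub>f \<kappa> lam :: real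
    and M :: "'o measure" +
  fixes \<gamma> T :: real and \<tau> :: "nat \<Rightarrow> nat" and K :: nat and x1 :: 'a
    and \<xi> :: "nat \<Rightarrow> 'o \<Rightarrow> 's" and x :: "nat \<Rightarrow> 'o \<Rightarrow> 'a"
  assumes kappa_less: "\<kappa> < \<gamma>"
    and indep_samples: "M.indep_vars (\<lambda>_. \<Xi>) \<xi> {1..K}"
    and distr_samples: "\<And>k. k \<in> {1..K} \<Longrightarrow> distr M \<Xi> (\<xi> k) = \<Xi>"
    and x1_A: "x1 \<in> edom \<omega>"
    and run: "\<And>p. p \<in> space M \<Longrightarrow>
      safeguarded_dspl h c \<omega> \<gamma> T \<tau> K x1 (\<lambda>k. \<xi> k p) (\<lambda>k. x k p)"
begin

abbreviation stale :: "nat \<Rightarrow> nat" where "stale k \<equiv> max 1 (k - \<tau> k)"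

abbreviation history :: "nat \<Rightarrow> 'o \<Rightarrow> nat \<Rightarrow> 's" where
  "history k p \<equiv> restrict (\<lambda>j. \<xi> j p) {1..<k}"

lemma sample_measurable: "k \<in> {1..K} \<Longrightarrow> \<xi> k \<in> measurable M \<Xi>"
  using indep_samples unfolding M.indep_vars_def by blast

lemma x_1: "p \<in> space M \<Longrightarrow> x 1 p = x1"
  using run[of p] by (simp add: safeguarded_dspl_def)

lemma x_stay: "p \<in> space M \<Longrightarrow> k \<in> {1..K} \<Longrightarrow> T < real (\<tau> k) \<Longrightarrow> x (Suc k) p = x k p"
  using run[of p] unfolding safeguarded_dspl_def by (metis not_le)

lemma x_arg_min:
  assumes "p \<in> space M" "k \<in> {1..K}" "real (\<tau> k) \<le> T"
  shows "ereal (partial_linearization h c (x (stale k) p) (x (Suc k) p) (\<xi> k p)) + \<omega> (x (Suc k) p)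
      + ereal (\<gamma> / 2 * (norm (x (Suc k) p - x k p))\<^sup>2)
    \<le> ereal (partial_linearization h c (x (stale k) p) y (\<xi> k p)) + \<omega> y
      + ereal (\<gamma> / 2 * (norm (y - x k p))\<^sup>2)"
  using bspec[OF conjunct2[OF run[OF assms(1), unfolded safeguarded_dspl_def]] assms(2)] assms(3)
  unfolding is_arg_min_linorder by (simp only: if_True simp_thms)

lemma x_A:
  assumes p: "p \<in> space M" and k: "k \<in> {1..Suc K}"
  shows "x k p \<in> A"
proof -
  have "1 \<le> k" "k \<le> Suc K" using k by auto
  then show ?thesis
  proof (induction k rule: dec_induct)
    case base
    then show ?case using x_1[OF p] x1_A by simp
  next
    case (step k)
    show ?case
    proof (cases "real (\<tau> k) \<le> T")
      case True
      have "ereal (partial_linearization h c (x (stale k) p) (x (Suc k) p) (\<xi> k p)) + \<omega> (x (Suc k) p)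
          + ereal (\<gamma> / 2 * (norm (x (Suc k) p - x k p))\<^sup>2)
        \<le> ereal (partial_linearization h c (x (stale k) p) x1 (\<xi> k p)) + \<omega> x1
          + ereal (\<gamma> / 2 * (norm (x1 - x k p))\<^sup>2)"
        using step by (intro x_arg_min[OF p _ True]) auto
      then have "\<omega> (x (Suc k) p) \<noteq> \<infinity>"
        using omega_eq[OF x1_A] by auto
      then show ?thesis
        by (simp add: edom_def)
    next
      case False
      then show ?thesis
        using step x_stay[OF p, of k] by simp
    qed
  qed
qed

lemma stale_range: "k \<in> {1..K} \<Longrightarrow> stale k \<in> {1..k}"
  by simp

lemma stale_range': "k \<in> {1..K} \<Longrightarrow> stale k \<in> {1..Suc K}"
  by (simp add: le_diff_conv)

lemma x_Suc:
  assumes p: "p \<in> space M" and k: "k \<in> {1..K}" and \<tau>: "real (\<tau> k) \<le> T"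
  shows "x (Suc k) p = prox \<gamma> A (model (x (stale k) p) (\<xi> k p)) (x k p)"
proof -
  have z: "x (stale k) p \<in> A"
    by (rule x_A[OF p stale_range'[OF k]])
  have x': "x (Suc k) p \<in> A"
    by (rule x_A[OF p]) (use k in simp)
  have s: "\<xi> k p \<in> space \<Xi>"
    by (rule measurable_space[OF sample_measurable[OF k] p])
  interpret P: prox_problem A "model (x (stale k) p) (\<xi> k p)" "L\<^sub>h * L\<^sub>\<xi> (\<xi> k p) + L\<^sub>\<omega>" \<kappa> \<gamma>
    by (rule prox_problem_model[OF kappa_less z s])
  show ?thesis
  proof (rule P.prox_unique[OF x'])
    fix y assume y: "y \<in> A"
    show "model (x (stale k) p) (\<xi> k p) (x (Suc k) p) + \<gamma> / 2 * (norm (x (Suc k) p - x k p))\<^sup>2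
        \<le> model (x (stale k) p) (\<xi> k p) y + \<gamma> / 2 * (norm (y - x k p))\<^sup>2"
    proof -
      obtain a b where "\<omega> (x (Suc k) p) = ereal a" "\<omega> y = ereal b"
        using omega_eq[OF x'] omega_eq[OF y] by blast
      with x_arg_min[OF p k \<tau>, of y] show ?thesis
        unfolding model_def by simp
    qed
  qed
qed

text \<open>
  This is the precise sense in which \<open>x k\<close> and the stale point are independent of the sample \<open>\<xi> k\<close>: both
  are measurable functions of the earlier samples alone.
\<close>

lemma x_factors_through_history:
  assumes "k \<in> {1..Suc K}"
  shows "\<exists>Y \<in> measurable (PiM {1..<k} (\<lambda>_. \<Xi>)) borel.
    (\<forall>w \<in> space (PiM {1..<k} (\<lambda>_. \<Xi>)). Y w \<in> A) \<and> (\<forall>p \<in> space M. x k p = Y (history k p))"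
  using assms
proof (induction k rule: less_induct)
  case (less k)
  let ?N = "\<lambda>k. PiM {1..<k} (\<lambda>_. \<Xi>)"
  show ?case
  proof (cases "k = 1")
    case True
    then show ?thesis
      using x_1 x1_A by (intro bexI[of _ "\<lambda>_. x1"]) auto
  next
    case False
    then obtain n where n: "k = Suc n" "n \<in> {1..K}"
      using less.prems by (cases k) auto
    have restr: "(\<lambda>w. restrict w {1..<j}) \<in> measurable (?N k) (?N j)" if "j \<le> n" for j
      using that n by (intro measurable_restrict_subset) auto
    have hist: "restrict (history k p) {1..<j} = history j p" if "j \<le> n" for j p
      using that n by (auto simp: fun_eq_iff restrict_def)
    obtain Y where Y: "Y \<in> measurable (?N n) borel" "\<And>w. w \<in> space (?N n) \<Longrightarrow> Y w \<in> A"
      "\<And>p. p \<in> space M \<Longrightarrow> x n p = Y (history n p)"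
    proof -
      have "n < k" "n \<in> {1..Suc K}" using n by auto
      from less.IH[OF this] show ?thesis using that by blast
    qed
    have Y': "(\<lambda>w. Y (restrict w {1..<n})) \<in> borel_measurable (?N k)"
      by (rule measurable_compose[OF restr Y(1)]) simp
    show ?thesis
    proof (cases "real (\<tau> n) \<le> T")
      case False
      have "x k p = Y (restrict (history k p) {1..<n})" if p: "p \<in> space M" for p
        using x_stay[OF p n(2)] False Y(3)[OF p] unfolding hist[OF order_refl] n(1) by simp
      moreover have "Y (restrict w {1..<n}) \<in> A" if "w \<in> space (?N k)" for w
        by (rule Y(2)[OF measurable_space[OF restr[OF order_refl] that]])
      ultimately show ?thesis
        using Y' by (intro bexI[of _ "\<lambda>w. Y (restrict w {1..<n})"] conjI ballI) blast+
    next
      case True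
      have st: "stale n \<le> n" "stale n \<in> {1..Suc K}" "stale n < k"
        using stale_range[OF n(2)] stale_range'[OF n(2)] n(1) by simp_all
      obtain Z where Z: "Z \<in> measurable (?N (stale n)) borel" "\<And>w. w \<in> space (?N (stale n)) \<Longrightarrow> Z w \<in> A"
        "\<And>p. p \<in> space M \<Longrightarrow> x (stale n) p = Z (history (stale n) p)"
        using less.IH[OF st(3,2)] by blast
      have Z': "(\<lambda>w. Z (restrict w {1..<stale n})) \<in> borel_measurable (?N k)"
        by (rule measurable_compose[OF restr[OF st(1)] Z(1)])
      have Z_A: "Z (restrict w {1..<stale n}) \<in> A" if "w \<in> space (?N k)" for w
        by (rule Z(2)[OF measurable_space[OF restr[OF st(1)] that]])
      have X: "(\<lambda>w. w n) \<in> measurable (?N k) \<Xi>"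
        using n by (intro measurable_component_singleton) auto
      let ?Y = "\<lambda>w. prox \<gamma> A (model (Z (restrict w {1..<stale n})) (w n)) (Y (restrict w {1..<n}))"
      have "?Y \<in> borel_measurable (?N k)"
        by (rule borel_measurable_prox_model[OF kappa_less Z' Z_A Y' X])
      moreover have "?Y w \<in> A" if w: "w \<in> space (?N k)" for w
        by (rule prox_problem.prox_mem[OF prox_problem_model[OF kappa_less Z_A[OF w] measurable_space[OF X w]]])
      moreover have "x k p = ?Y (history k p)" if p: "p \<in> space M" for p
      proof -
        have "history k p n = \<xi> n p" using n by simp
        then show ?thesis
          unfolding n(1)[symmetric] hist[OF order_refl] hist[OF st(1)]
          using x_Suc[OF p n(2) True] Y(3)[OF p] Z(3)[OF p] n(1) by simp
      qed
      ultimately show ?thesis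
        by (intro bexI[of _ ?Y] conjI ballI) blast+
    qed
  qed
qed

lemma history_measurable: "k \<in> {1..Suc K} \<Longrightarrow> history k \<in> measurable M (PiM {1..<k} (\<lambda>_. \<Xi>))"
  by (intro measurable_restrict sample_measurable) auto

lemma x_measurable:
  assumes "k \<in> {1..Suc K}"
  shows "x k \<in> borel_measurable M"
proof -
  obtain Y where Y: "Y \<in> measurable (PiM {1..<k} (\<lambda>_. \<Xi>)) borel" "\<forall>p \<in> space M. x k p = Y (history k p)"
    using x_factors_through_history[OF assms] by blast
  have "(\<lambda>p. Y (history k p)) \<in> borel_measurable M"
    by (rule measurable_compose[OF history_measurable[OF assms] Y(1)])
  then show ?thesis
    using Y(2) by (subst measurable_cong[where g = "\<lambda>p. Y (history k p)"]) auto
qed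

lemma indep_history_sample:
  assumes k: "k \<in> {1..K}"
  shows "M.indep_set {history k -` A \<inter> space M | A. A \<in> sets (PiM {1..<k} (\<lambda>_. \<Xi>))}
    {\<xi> k -` B \<inter> space M | B. B \<in> sets \<Xi>}"
proof -
  let ?Y = "\<lambda>p. restrict (\<lambda>j. \<xi> j p) {k}"
  have "M.indep_var (PiM {1..<k} (\<lambda>_. \<Xi>)) (history k) (PiM {k} (\<lambda>_. \<Xi>)) ?Y"
    using k by (intro M.indep_var_restrict[OF indep_samples]) auto
  then have "M.indep_set (sigma_sets (space M) {history k -` A \<inter> space M | A. A \<in> sets (PiM {1..<k} (\<lambda>_. \<Xi>))})
      (sigma_sets (space M) {?Y -` B \<inter> space M | B. B \<in> sets (PiM {k} (\<lambda>_. \<Xi>))})"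
    unfolding M.indep_var_eq by blast
  then show ?thesis
    unfolding M.indep_set_def
  proof (rule M.indep_sets_mono_sets)
    have "\<exists>B'. \<xi> k -` B \<inter> space M = ?Y -` B' \<inter> space M \<and> B' \<in> sets (PiM {k} (\<lambda>_. \<Xi>))" if B: "B \<in> sets \<Xi>" for B
    proof (intro exI conjI)
      let ?B' = "(\<lambda>w. w k) -` B \<inter> space (PiM {k} (\<lambda>_. \<Xi>))"
      show "?B' \<in> sets (PiM {k} (\<lambda>_. \<Xi>))"
        using B by (intro measurable_sets[OF measurable_component_singleton]) auto
      show "\<xi> k -` B \<inter> space M = ?Y -` ?B' \<inter> space M"
        using measurable_space[OF sample_measurable[OF k]] by (auto simp: space_PiM)
    qed
    then show "\<And>i. i \<in> UNIV \<Longrightarrow>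
        case_bool {history k -` A \<inter> space M | A. A \<in> sets (PiM {1..<k} (\<lambda>_. \<Xi>))} {\<xi> k -` B \<inter> space M | B. B \<in> sets \<Xi>} i
        \<subseteq> case_bool (sigma_sets (space M) {history k -` A \<inter> space M | A. A \<in> sets (PiM {1..<k} (\<lambda>_. \<Xi>))})
          (sigma_sets (space M) {?Y -` B \<inter> space M | B. B \<in> sets (PiM {k} (\<lambda>_. \<Xi>))}) i"
      by (auto split: bool.split)
  qed
qed

text \<open>
  Given the history, the next iterate is a function of the fresh sample only, which therefore may be
  averaged with the current and the stale point kept fixed.
\<close>

lemma expected_step_conditional:
  fixes \<Phi> :: "'a \<Rightarrow> ennreal"
  assumes k: "k \<in> {1..K}" and \<tau>: "real (\<tau> k) \<le> T" and \<Phi>: "\<Phi> \<in> borel_measurable borel"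
  shows "(\<integral>\<^sup>+p. \<Phi> (x (Suc k) p) \<partial>M)
      = (\<integral>\<^sup>+p. (\<integral>\<^sup>+s. \<Phi> (prox \<gamma> A (model (x (stale k) p) s) (x k p)) \<partial>\<Xi>) \<partial>M)"
    and "(\<lambda>p. \<integral>\<^sup>+s. \<Phi> (prox \<gamma> A (model (x (stale k) p) s) (x k p)) \<partial>\<Xi>) \<in> borel_measurable M"
proof -
  let ?N = "\<lambda>k. PiM {1..<k} (\<lambda>_. \<Xi>)"
  have k': "k \<in> {1..Suc K}" using k by auto
  obtain Y where Y: "Y \<in> measurable (?N k) borel" "\<And>p. p \<in> space M \<Longrightarrow> x k p = Y (history k p)"
    using x_factors_through_history[OF k'] by blast
  have st: "stale k \<le> k" "stale k \<in> {1..Suc K}"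
    using stale_range[OF k] stale_range'[OF k] by simp_all
  obtain Z where Z: "Z \<in> measurable (?N (stale k)) borel" "\<And>w. w \<in> space (?N (stale k)) \<Longrightarrow> Z w \<in> A"
    "\<And>p. p \<in> space M \<Longrightarrow> x (stale k) p = Z (history (stale k) p)"
    using x_factors_through_history[OF st(2)] by blast
  let ?r = "\<lambda>w :: nat \<Rightarrow> 's. restrict w {1..<stale k}"
  have restr: "?r \<in> measurable (?N k) (?N (stale k))"
    using st(1) by (intro measurable_restrict_subset) auto
  have hist: "?r (history k p) = history (stale k) p" for p
    using st(1) by (auto simp: fun_eq_iff restrict_def)
  define g where "g = (\<lambda>w s. \<Phi> (prox \<gamma> A (model (Z (?r w)) s) (Y w)))"
  have g: "(\<lambda>(w, s). g w s) \<in> borel_measurable (?N k \<Otimes>\<^sub>M \<Xi>)"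
    unfolding g_def case_prod_beta'
  proof (rule measurable_compose[OF borel_measurable_prox_model[OF kappa_less] \<Phi>])
    show "(\<lambda>z. Z (?r (fst z))) \<in> borel_measurable (?N k \<Otimes>\<^sub>M \<Xi>)"
      by (rule measurable_compose[OF measurable_compose[OF measurable_fst restr] Z(1)])
    show "(\<lambda>z. Y (fst z)) \<in> borel_measurable (?N k \<Otimes>\<^sub>M \<Xi>)"
      by (rule measurable_compose[OF measurable_fst Y(1)])
    show "Z (?r (fst z)) \<in> A" if "z \<in> space (?N k \<Otimes>\<^sub>M \<Xi>)" for z
      by (rule Z(2)[OF measurable_space[OF measurable_compose[OF measurable_fst restr] that]])
  qed (rule measurable_snd)
  note ind = M.nn_integral_indep[OF history_measurable[OF k'] sample_measurable[OF k]
      indep_history_sample[OF k] g, unfolded distr_samples[OF k]]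
  have eq: "prox \<gamma> A (model (x (stale k) p) s) (x k p) = prox \<gamma> A (model (Z (?r (history k p))) s) (Y (history k p))"
    if "p \<in> space M" for p s
    using Y(2)[OF that] Z(3)[OF that] hist by simp
  have "(\<integral>\<^sup>+p. \<Phi> (x (Suc k) p) \<partial>M) = (\<integral>\<^sup>+p. g (history k p) (\<xi> k p) \<partial>M)"
    by (rule nn_integral_cong) (simp only: g_def x_Suc[OF _ k \<tau>] eq)
  also note ind(1)
  also have "(\<integral>\<^sup>+p. (\<integral>\<^sup>+s. g (history k p) s \<partial>\<Xi>) \<partial>M)
      = (\<integral>\<^sup>+p. (\<integral>\<^sup>+s. \<Phi> (prox \<gamma> A (model (x (stale k) p) s) (x k p)) \<partial>\<Xi>) \<partial>M)"
    by (rule nn_integral_cong) (simp only: g_def eq)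
  finally show "(\<integral>\<^sup>+p. \<Phi> (x (Suc k) p) \<partial>M)
      = (\<integral>\<^sup>+p. (\<integral>\<^sup>+s. \<Phi> (prox \<gamma> A (model (x (stale k) p) s) (x k p)) \<partial>\<Xi>) \<partial>M)" .
  have "(\<lambda>p. \<integral>\<^sup>+s. g (history k p) s \<partial>\<Xi>) \<in> borel_measurable M"
    by (rule measurable_compose[OF history_measurable[OF k'] ind(2)])
  then show "(\<lambda>p. \<integral>\<^sup>+s. \<Phi> (prox \<gamma> A (model (x (stale k) p) s) (x k p)) \<partial>\<Xi>) \<in> borel_measurable M"
    by (rule measurable_cong[THEN iffD1, rotated]) (simp only: g_def eq)
qed

text \<open>
  Skipped iterations do not move, so the bound holds for them as well; this allows the stale point to be
  reached through all intermediate iterations.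
\<close>

lemma step_bound:
  assumes p: "p \<in> space M" and k: "k \<in> {1..K}"
  shows "(norm (x (Suc k) p - x k p))\<^sup>2 \<le> inverse ((\<gamma> - \<kappa> / 2)\<^sup>2) * (L\<^sub>h * L\<^sub>\<xi> (\<xi> k p) + L\<^sub>\<omega>)\<^sup>2"
proof (cases "real (\<tau> k) \<le> T")
  case False
  then show ?thesis
    using x_stay[OF p k] by simp
next
  case True
  have z: "x (stale k) p \<in> A"
    by (rule x_A[OF p stale_range'[OF k]])
  have e: "x k p \<in> A"
    by (rule x_A[OF p]) (use k in simp)
  have \<gamma>: "0 < \<gamma> - \<kappa> / 2"
    using kappa_less kappa_nonneg by simp
  have s: "\<xi> k p \<in> space \<Xi>"
    by (rule measurable_space[OF sample_measurable[OF k] p])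
  interpret P: prox_problem A "model (x (stale k) p) (\<xi> k p)" "L\<^sub>h * L\<^sub>\<xi> (\<xi> k p) + L\<^sub>\<omega>" \<kappa> \<gamma>
    by (rule prox_problem_model[OF kappa_less z s])
  have "((\<gamma> - \<kappa> / 2) * norm (x (Suc k) p - x k p))\<^sup>2 \<le> (L\<^sub>h * L\<^sub>\<xi> (\<xi> k p) + L\<^sub>\<omega>)\<^sup>2"
    using P.prox_step_bound[OF e] \<gamma> unfolding x_Suc[OF p k True] by (intro power_mono) auto
  then have "(\<gamma> - \<kappa> / 2)\<^sup>2 * (norm (x (Suc k) p - x k p))\<^sup>2 \<le> (L\<^sub>h * L\<^sub>\<xi> (\<xi> k p) + L\<^sub>\<omega>)\<^sup>2"
    by (simp only: power_mult_distrib)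
  from mult_left_mono[OF this, of "inverse ((\<gamma> - \<kappa> / 2)\<^sup>2)"] show ?thesis
    using \<gamma> by (simp flip: mult.assoc)
qed

text \<open>
  At most \<open>\<tau> k\<close> steps lead from the stale point to the current one. By the Cauchy-Schwarz inequality
  the squared distance is at most \<open>\<tau> k\<close> times the sum of the squared steps, which gives the square of
  the delay.
\<close>

lemma expected_staleness:
  assumes k: "k \<in> {1..K}"
  shows "(\<integral>\<^sup>+p. ennreal ((norm (x k p - x (stale k) p))\<^sup>2) \<partial>M)
      \<le> ennreal ((real (\<tau> k))\<^sup>2 * ((L\<^sub>f + L\<^sub>\<omega>) / (\<gamma> - \<kappa> / 2))\<^sup>2)"
proof -
  let ?G = "\<lambda>s. (L\<^sub>h * L\<^sub>\<xi> s + L\<^sub>\<omega>)\<^sup>2"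
  let ?q = "inverse ((\<gamma> - \<kappa> / 2)\<^sup>2)"
  define z where "z = stale k"
  have z: "1 \<le> z" "z \<le> k" "k - z \<le> \<tau> k"
    using stale_range[OF k] unfolding z_def by simp_all
  let ?n = "k - z"
  have range: "{z..<k} \<subseteq> {1..K}"
    using k z(1) by auto
  have G: "integrable \<Xi> ?G" "(\<integral>s. ?G s \<partial>\<Xi>) \<le> (L\<^sub>f + L\<^sub>\<omega>)\<^sup>2"
    using L_moments(3,4)[OF L_omega_nonneg] by auto
  have int: "integrable M (\<lambda>p. ?G (\<xi> i p))" "(\<integral>p. ?G (\<xi> i p) \<partial>M) \<le> (L\<^sub>f + L\<^sub>\<omega>)\<^sup>2" if i: "i \<in> {z..<k}" for i
  proof -
    have i': "i \<in> {1..K}" using i range by blast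
    note m = sample_measurable[OF i'] and d = distr_samples[OF i']
    show "integrable M (\<lambda>p. ?G (\<xi> i p))"
      using G(1) integrable_distr_eq[OF m borel_measurable_integrable[OF G(1)]] d by simp
    show "(\<integral>p. ?G (\<xi> i p) \<partial>M) \<le> (L\<^sub>f + L\<^sub>\<omega>)\<^sup>2"
      using G(2) integral_distr[OF m borel_measurable_integrable[OF G(1)]] d by simp
  qed
  have "(\<integral>\<^sup>+p. ennreal ((norm (x k p - x (z) p))\<^sup>2) \<partial>M)
      \<le> (\<integral>\<^sup>+p. ennreal (real ?n * (\<Sum>i=z..<k. ?q * ?G (\<xi> i p))) \<partial>M)"
  proof (intro nn_integral_mono ennreal_leI)
    fix p assume p: "p \<in> space M"
    have "(norm (x k p - x (z) p))\<^sup>2 \<le> real ?n * (\<Sum>i=z..<k. (norm (x (Suc i) p - x i p))\<^sup>2)"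
      using z(2) by (rule norm_diff_le_sum_steps)
    also have "\<dots> \<le> real ?n * (\<Sum>i=z..<k. ?q * ?G (\<xi> i p))"
      using range by (intro mult_left_mono sum_mono step_bound[OF p]) auto
    finally show "(norm (x k p - x (z) p))\<^sup>2 \<le> real ?n * (\<Sum>i=z..<k. ?q * ?G (\<xi> i p))" .
  qed
  also have "\<dots> = ennreal (\<integral>p. real ?n * (\<Sum>i=z..<k. ?q * ?G (\<xi> i p)) \<partial>M)"
    using int(1) by (intro nn_integral_eq_integral integrable_mult_right Bochner_Integration.integrable_sum)
      (auto intro!: AE_I2 mult_nonneg_nonneg sum_nonneg)
  also have "(\<integral>p. real ?n * (\<Sum>i=z..<k. ?q * ?G (\<xi> i p)) \<partial>M)
      = real ?n * (\<Sum>i=z..<k. ?q * (\<integral>p. ?G (\<xi> i p) \<partial>M))"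
    using int(1) by (simp add: Bochner_Integration.integral_sum)
  also have "ennreal (real ?n * (\<Sum>i=z..<k. ?q * (\<integral>p. ?G (\<xi> i p) \<partial>M)))
      \<le> ennreal (real ?n * (\<Sum>i=z..<k. ?q * (L\<^sub>f + L\<^sub>\<omega>)\<^sup>2))"
    by (intro ennreal_leI mult_left_mono sum_mono int(2)) auto
  also have "?q * (L\<^sub>f + L\<^sub>\<omega>)\<^sup>2 = ((L\<^sub>f + L\<^sub>\<omega>) / (\<gamma> - \<kappa> / 2))\<^sup>2"
    unfolding power_divide by (simp only: divide_inverse mult.commute)
  also have "real ?n * (\<Sum>i=z..<k. ((L\<^sub>f + L\<^sub>\<omega>) / (\<gamma> - \<kappa> / 2))\<^sup>2) = (real ?n)\<^sup>2 * ((L\<^sub>f + L\<^sub>\<omega>) / (\<gamma> - \<kappa> / 2))\<^sup>2"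
    by (simp only: sum_constant card_atLeastLessThan power2_eq_square[of "real ?n"] mult.assoc)
  also have "ennreal \<dots> \<le> ennreal ((real (\<tau> k))\<^sup>2 * ((L\<^sub>f + L\<^sub>\<omega>) / (\<gamma> - \<kappa> / 2))\<^sup>2)"
    using z(3) by (intro ennreal_leI mult_right_mono power_mono) auto
  finally show ?thesis
    unfolding z_def .
qed

lemma borel_measurable_prox_obj:
  assumes \<rho>: "2 * lam + \<kappa> < \<rho>"
  shows "prox \<rho> A obj \<in> borel_measurable borel"
proof -
  interpret O: prox_problem A obj "L\<^sub>f + L\<^sub>\<omega>" "lam + \<kappa>" \<rho>
    by (rule prox_problem_obj[OF \<rho>])
  have "(\<rho> / (\<rho> - (lam + \<kappa>)))-lipschitz_on UNIV (prox \<rho> A obj)"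
  proof (rule lipschitz_onI)
    fix y z
    show "dist (prox \<rho> A obj y) (prox \<rho> A obj z) \<le> \<rho> / (\<rho> - (lam + \<kappa>)) * dist y z"
      using O.prox_lipschitz[of y z] O.mu_less by (simp add: dist_norm field_simps)
  qed (use O.mu_less O.mu_nonneg in simp)
  then show ?thesis
    by (intro borel_measurable_continuous_onI lipschitz_on_continuous_on)
qed

text \<open>
  The expected descent inequalities are summed over the timely iterations. The skipped ones leave the
  iterate unchanged, so the envelope telescopes across them.
\<close>

lemma sum_expected_prox_distance:
  assumes \<rho>: "2 * lam + \<kappa> < \<rho>" and \<delta>: "\<delta> = \<gamma> - \<rho> - \<kappa> - 6 * lam" "0 < \<delta>"
    and lower: "\<And>y. i \<le> env \<rho> A obj y"
  shows "(\<Sum>k | k \<in> {1..K} \<and> real (\<tau> k) \<le> T.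
        \<integral>\<^sup>+p. ennreal ((\<rho> - 2 * lam - \<kappa>) / 2 * (norm (prox \<rho> A obj (x k p) - x k p))\<^sup>2) \<partial>M)
      \<le> ennreal ((\<gamma> - \<kappa> - 2 * lam) / \<rho> * (env \<rho> A obj x1 - i)
          + (\<Sum>k | k \<in> {1..K} \<and> real (\<tau> k) \<le> T.
              2 * L\<^sub>f\<^sup>2 / \<delta> + 3 / 2 * lam * ((real (\<tau> k))\<^sup>2 * ((L\<^sub>f + L\<^sub>\<omega>) / (\<gamma> - \<kappa> / 2))\<^sup>2)))"
proof -
  let ?S = "{k. k \<in> {1..K} \<and> real (\<tau> k) \<le> T}"
  let ?B = "((L\<^sub>f + L\<^sub>\<omega>) / (\<gamma> - \<kappa> / 2))\<^sup>2"
  define b where "b = (\<gamma> - \<kappa> - 2 * lam) / \<rho>"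
  define a where "a k = (\<integral>\<^sup>+p. ennreal ((\<rho> - 2 * lam - \<kappa>) / 2 * (norm (prox \<rho> A obj (x k p) - x k p))\<^sup>2) \<partial>M)" for k
  define v where "v k = (\<integral>\<^sup>+p. ennreal (b * (env \<rho> A obj (x k p) - i)) \<partial>M)" for k
  define e where "e k = 2 * L\<^sub>f\<^sup>2 / \<delta> + 3 / 2 * lam * ((real (\<tau> k))\<^sup>2 * ?B)" for k
  have b: "0 \<le> b"
    unfolding b_def using \<delta> \<rho> kappa_nonneg lam_nonneg by simp
  have e: "0 \<le> e k" for k
    unfolding e_def using \<delta>(2) lam_nonneg by simp
  interpret O: prox_problem A obj "L\<^sub>f + L\<^sub>\<omega>" "lam + \<kappa>" \<rho>
    by (rule prox_problem_obj[OF \<rho>])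
  have env_meas: "env \<rho> A obj \<in> borel_measurable borel"
    by (intro borel_measurable_continuous_onI continuous_at_imp_continuous_on ballI O.isCont_env)
  note prox_meas = borel_measurable_prox_obj[OF \<rho>]
  have move: "a k + v (Suc k) \<le> v k + ennreal (e k)" if k: "k \<in> {1..K}" and \<tau>: "real (\<tau> k) \<le> T" for k
  proof -
    let ?\<Phi> = "\<lambda>y. ennreal (b * (env \<rho> A obj y - i))"
    have split: "ennreal (u + c * n) = ennreal u + ennreal c * ennreal n"
      if "0 \<le> u" "0 \<le> c" "0 \<le> n" for u c n :: real
      using that by (simp add: ennreal_mult)
    have k': "k \<in> {1..Suc K}" "stale k \<in> {1..Suc K}"
      using k stale_range'[OF k] by simp_all
    note [measurable] = env_meas x_measurable[OF k'(1)] x_measurable[OF k'(2)]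
      measurable_compose[OF x_measurable[OF k'(1)] prox_meas]
    have \<Phi>: "?\<Phi> \<in> borel_measurable borel"
      by measurable
    note cond = expected_step_conditional[OF k \<tau> \<Phi>]
    have dist_meas: "(\<lambda>p. ennreal ((\<rho> - 2 * lam - \<kappa>) / 2 * (norm (prox \<rho> A obj (x k p) - x k p))\<^sup>2)) \<in> borel_measurable M"
      by measurable
    have gap_meas: "(\<lambda>p. ennreal ((norm (x k p - x (stale k) p))\<^sup>2)) \<in> borel_measurable M"
      by measurable
    have scaled_gap_meas: "(\<lambda>p. ennreal (3 / 2 * lam) * ennreal ((norm (x k p - x (stale k) p))\<^sup>2)) \<in> borel_measurable M"
      by measurable
    have "a k + v (Suc k) = (\<integral>\<^sup>+p. ennreal ((\<rho> - 2 * lam - \<kappa>) / 2 * (norm (prox \<rho> A obj (x k p) - x k p))\<^sup>2)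
        + (\<integral>\<^sup>+s. ?\<Phi> (prox \<gamma> A (model (x (stale k) p) s) (x k p)) \<partial>\<Xi>) \<partial>M)"
      unfolding a_def v_def cond(1) by (rule nn_integral_add[OF dist_meas cond(2), symmetric])
    also have "\<dots> \<le> (\<integral>\<^sup>+p. ?\<Phi> (x k p)
        + ennreal (2 * L\<^sub>f\<^sup>2 / \<delta> + 3 / 2 * lam * (norm (x k p - x (stale k) p))\<^sup>2) \<partial>M)"
      unfolding b_def
      by (intro nn_integral_mono one_step_expected[OF \<rho> \<delta> _ _ lower] x_A k')
    also have "\<dots> = v k + (\<integral>\<^sup>+p. ennreal (2 * L\<^sub>f\<^sup>2 / \<delta> + 3 / 2 * lam * (norm (x k p - x (stale k) p))\<^sup>2) \<partial>M)"
      unfolding v_def by (rule nn_integral_add) measurable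
    also have "(\<integral>\<^sup>+p. ennreal (2 * L\<^sub>f\<^sup>2 / \<delta> + 3 / 2 * lam * (norm (x k p - x (stale k) p))\<^sup>2) \<partial>M)
        = (\<integral>\<^sup>+p. ennreal (2 * L\<^sub>f\<^sup>2 / \<delta>) + ennreal (3 / 2 * lam) * ennreal ((norm (x k p - x (stale k) p))\<^sup>2) \<partial>M)"
      using \<delta>(2) lam_nonneg by (intro nn_integral_cong split) simp_all
    also have "\<dots> = ennreal (2 * L\<^sub>f\<^sup>2 / \<delta>)
        + ennreal (3 / 2 * lam) * (\<integral>\<^sup>+p. ennreal ((norm (x k p - x (stale k) p))\<^sup>2) \<partial>M)"
      unfolding nn_integral_add[OF borel_measurable_const scaled_gap_meas]
      by (simp only: nn_integral_cmult[OF gap_meas] nn_integral_const M.emeasure_space_1 mult_1_right)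
    also have "\<dots> \<le> ennreal (2 * L\<^sub>f\<^sup>2 / \<delta>) + ennreal (3 / 2 * lam) * ennreal ((real (\<tau> k))\<^sup>2 * ?B)"
      by (intro add_left_mono mult_left_mono expected_staleness[OF k]) simp
    also have "\<dots> = ennreal (e k)"
      unfolding e_def using \<delta>(2) lam_nonneg by (intro split[symmetric]) simp_all
    finally show ?thesis
      by (simp add: add_left_mono)
  qed
  have stay: "v (Suc k) = v k" if k: "k \<in> {1..K}" and \<tau>: "\<not> real (\<tau> k) \<le> T" for k
    unfolding v_def using x_stay[OF _ k] \<tau> by (intro nn_integral_cong) simp
  have S: "{1..K} \<inter> ?S = ?S" by blast
  have "(\<Sum>k\<in>?S. a k) \<le> (\<Sum>k\<in>?S. a k) + v (Suc K)"
    by (rule add_increasing2) simp_all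
  also have "\<dots> \<le> v 1 + (\<Sum>k\<in>?S. ennreal (e k))"
    by (rule sum_descent[where n = K and S = ?S, unfolded S]) (use move stay in auto)
  also have "v 1 = ennreal (b * (env \<rho> A obj x1 - i))"
  proof -
    have "v 1 = (\<integral>\<^sup>+p. ennreal (b * (env \<rho> A obj x1 - i)) \<partial>M)"
      unfolding v_def by (intro nn_integral_cong) (simp only: x_1)
    then show ?thesis
      by (simp add: M.emeasure_space_1)
  qed
  also have "\<dots> + (\<Sum>k\<in>?S. ennreal (e k)) = ennreal (b * (env \<rho> A obj x1 - i) + (\<Sum>k\<in>?S. e k))"
    using b e lower[of x1] by (simp add: sum_nonneg ennreal_plus)
  finally show ?thesis
    unfolding a_def b_def e_def .
qed



lemma norm_gradient_moreau_envelope: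
  assumes \<rho>: "2 * lam + \<kappa> < \<rho>"
  shows "(norm (gradient (\<lambda>y. real_of_ereal (moreau_envelope \<rho> (objective \<Xi> h c \<omega>) y)) y))\<^sup>2
    = \<rho>\<^sup>2 * (norm (prox \<rho> A obj y - y))\<^sup>2"
proof -
  interpret O: prox_problem A obj "L\<^sub>f + L\<^sub>\<omega>" "lam + \<kappa>" \<rho>
    by (rule prox_problem_obj[OF \<rho>])
  have "(\<lambda>y. real_of_ereal (moreau_envelope \<rho> (objective \<Xi> h c \<omega>) y)) = env \<rho> A obj"
    by (rule ext) (simp add: moreau_envelope_eq[OF \<rho>])
  then show ?thesis
    by (simp add: gradient_eqI[OF O.GDERIV_env] power_mult_distrib norm_minus_commute)
qed

text \<open>
  The random index is independent of the whole sample sequence, of which all iterates are functions;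
  hence evaluating at the random index averages the expectations uniformly over \<open>S\<close>.
\<close>

lemma expectation_at_random_iterate:
  fixes \<Phi> :: "'a \<Rightarrow> ennreal"
  assumes \<Phi>: "\<Phi> \<in> borel_measurable borel"
    and S: "S \<subseteq> {1..K}" "S \<noteq> {}"
    and ind: "M.indep_set (sets (vimage_algebra (space M) k (count_space UNIV)))
        (sets (vimage_algebra (space M) (\<lambda>p. \<lambda>j\<in>{1..K}. \<xi> j p) (\<Pi>\<^sub>M j\<in>{1..K}. \<Xi>)))"
    and k: "distr M (count_space UNIV) k = measure_pmf (pmf_of_set S)"
  shows "(\<integral>\<^sup>+p. \<Phi> (x (k p) p) \<partial>M) = (\<Sum>j\<in>S. \<integral>\<^sup>+p. \<Phi> (x j p) \<partial>M) / of_nat (card S)"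
proof -
  let ?N = "\<lambda>j. PiM {1..<j} (\<lambda>_. \<Xi>)"
  let ?W = "\<lambda>p. \<lambda>j\<in>{1..K}. \<xi> j p"
  have fin: "finite S"
    using S(1) by (rule finite_subset) simp
  have W: "?W \<in> measurable M (\<Pi>\<^sub>M j\<in>{1..K}. \<Xi>)"
    by (intro measurable_restrict sample_measurable)
  have "\<forall>j\<in>{1..K}. \<exists>Y. Y \<in> measurable (?N j) borel \<and> (\<forall>p\<in>space M. x j p = Y (history j p))"
  proof
    fix j assume "j \<in> {1..K}"
    then have "j \<in> {1..Suc K}" by simp
    from x_factors_through_history[OF this]
    show "\<exists>Y. Y \<in> measurable (?N j) borel \<and> (\<forall>p\<in>space M. x j p = Y (history j p))" by blast
  qed
  from bchoice[OF this] obtain Y where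
    Y: "\<And>j. j \<in> {1..K} \<Longrightarrow> Y j \<in> measurable (?N j) borel"
       "\<And>j p. j \<in> {1..K} \<Longrightarrow> p \<in> space M \<Longrightarrow> x j p = Y j (history j p)"
    by blast
  define H where "H = (\<lambda>j w. if j \<in> {1..K} then \<Phi> (Y j (restrict w {1..<j})) else 0)"
  have H: "H j \<in> borel_measurable (\<Pi>\<^sub>M j\<in>{1..K}. \<Xi>)" for j
  proof (cases "j \<in> {1..K}")
    case True
    have "(\<lambda>w. restrict w {1..<j}) \<in> measurable (\<Pi>\<^sub>M j\<in>{1..K}. \<Xi>) (?N j)"
      using True by (intro measurable_restrict_subset) auto
    from measurable_compose[OF measurable_compose[OF this Y(1)[OF True]] \<Phi>]
    show ?thesis
      using True by (simp add: H_def)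
  next
    case False
    then show ?thesis
      by (simp add: H_def del: atLeastAtMost_iff)
  qed
  have H_eq: "H j (?W p) = \<Phi> (x j p)" if j: "j \<in> S" and p: "p \<in> space M" for j p
  proof -
    have j': "j \<in> {1..K}" using S(1) j by blast
    have "restrict (?W p) {1..<j} = history j p"
      using j' by (auto simp: fun_eq_iff restrict_def)
    then show ?thesis
      using j' Y(2)[OF j' p] by (simp add: H_def)
  qed
  note avg = M.nn_integral_uniform_index[OF ind W k fin S(2), of H]
  have "(\<integral>\<^sup>+p. \<Phi> (x (k p) p) \<partial>M) = (\<integral>\<^sup>+p. H (k p) (?W p) \<partial>M)"
    by (rule nn_integral_cong_AE, rule AE_mp[OF avg(2)[OF H]], rule AE_I2, rule impI) (simp only: H_eq)
  also have "\<dots> = (\<Sum>j\<in>S. \<integral>\<^sup>+p. H j (?W p) \<partial>M) / of_nat (card S)"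
    by (rule avg(1)[OF H])
  also have "(\<Sum>j\<in>S. \<integral>\<^sup>+p. H j (?W p) \<partial>M) = (\<Sum>j\<in>S. \<integral>\<^sup>+p. \<Phi> (x j p) \<partial>M)"
    by (intro sum.cong nn_integral_cong refl) (simp only: H_eq)
  finally show ?thesis .
qed

end

section \<open>The convergence rate\<close>

text \<open>
  The first two terms of the result come from the initial gap, weighted with
  \<open>1/n \<le> \<eta>/K\<close>; the third is the variance term \<open>2 L\<^sub>f\<^sup>2/\<delta>\<close>, which is the same in every iteration; the
  last one collects the staleness, with \<open>1/\<delta>\<^sup>2 = \<alpha>\<^sup>2 \<eta>/K\<close> and the factor \<open>3/2\<close> raised to \<open>6\<close>.
  Here \<open>n\<close> is the number of timely iterations, \<open>P = K\<^sup>\<beta>\<close>, and \<open>Q\<close> the sum of the squared delays.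
\<close>

lemma rate_arithmetic:
  fixes K n \<eta> \<alpha> \<delta> \<rho> lam D Q L\<^sub>f L G P m r :: real
  assumes pos: "0 < K" "0 < n" "0 < \<eta>" "0 < \<alpha>" "0 < \<rho>" "0 < r" "0 < P" "0 \<le> lam" "0 \<le> D"
    and n: "K \<le> \<eta> * n" and \<delta>: "\<delta> = sqrt K / (\<alpha> * sqrt \<eta>)" and G: "\<delta> \<le> G"
    and Q: "0 \<le> Q" "Q \<le> m\<^sup>2 * K * P / r"
  shows "\<rho> * ((\<delta> + \<rho> + 4 * lam) / \<rho> * D + (n * (2 * L\<^sub>f\<^sup>2 / \<delta>) + 3 / 2 * lam * (Q * (L / G)\<^sup>2))) / n
    \<le> \<eta> * (\<rho> + 4 * lam) / K * D + sqrt \<eta> / (sqrt K * \<alpha>) * D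
      + 2 * sqrt \<eta> * \<rho> * L\<^sub>f\<^sup>2 * \<alpha> / sqrt K
      + 6 * \<eta>\<^sup>2 * \<rho> * lam * L\<^sup>2 * m\<^sup>2 * \<alpha>\<^sup>2 / (r * (K / P))"
proof -
  define k e where "k = sqrt K" and "e = sqrt \<eta>"
  have k: "0 < k" "K = k * k" and e: "0 < e" "\<eta> = e * e"
    using pos by (simp_all add: k_def e_def)
  have \<delta>_eq: "\<delta> = k / (\<alpha> * e)"
    by (simp add: \<delta> k_def e_def)
  have \<delta>_pos: "0 < \<delta>"
    using k(1) e(1) pos by (simp add: \<delta>_eq)
  have inv_n: "1 / n \<le> \<eta> / K"
    using n pos by (simp add: field_simps)
  have "(\<delta> + \<rho> + 4 * lam) * D * (1 / n) \<le> (\<delta> + \<rho> + 4 * lam) * D * (\<eta> / K)"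
    using inv_n \<delta>_pos pos by (intro mult_left_mono) auto
  also have "\<dots> = \<eta> * (\<rho> + 4 * lam) / K * D + \<delta> * (\<eta> / K) * D"
    by (simp add: algebra_simps add_divide_distrib)
  also have "\<delta> * (\<eta> / K) = e / (k * \<alpha>)"
    unfolding \<delta>_eq k(2) e(2) using k(1) e(1) pos by simp
  finally have t1: "(\<delta> + \<rho> + 4 * lam) * D * (1 / n)
      \<le> \<eta> * (\<rho> + 4 * lam) / K * D + e / (k * \<alpha>) * D" .
  have t2: "\<rho> * (2 * L\<^sub>f\<^sup>2 / \<delta>) = 2 * e * \<rho> * L\<^sub>f\<^sup>2 * \<alpha> / k"
    unfolding \<delta>_eq by simp
  have "Q * (L / G)\<^sup>2 \<le> m\<^sup>2 * K * P / r * (L\<^sup>2 / \<delta>\<^sup>2)"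
  proof (rule mult_mono[OF Q(2)])
    have "\<delta>\<^sup>2 \<le> G\<^sup>2"
      using G \<delta>_pos by (intro power_mono) auto
    moreover have "0 < G"
      using G \<delta>_pos by linarith
    ultimately show "(L / G)\<^sup>2 \<le> L\<^sup>2 / \<delta>\<^sup>2"
      unfolding power_divide using \<delta>_pos by (intro divide_left_mono) auto
  qed (use Q in auto)
  then have "\<rho> * (3 / 2 * lam * (Q * (L / G)\<^sup>2)) \<le> \<rho> * (3 / 2 * lam * (m\<^sup>2 * K * P / r * (L\<^sup>2 / \<delta>\<^sup>2)))"
    by (rule mult_left_mono[OF mult_left_mono]) (use pos in simp_all)
  then have "\<rho> * (3 / 2 * lam * (Q * (L / G)\<^sup>2)) * (1 / n)
      \<le> \<rho> * (3 / 2 * lam * (m\<^sup>2 * K * P / r * (L\<^sup>2 / \<delta>\<^sup>2))) * (\<eta> / K)"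
    using inv_n by (rule mult_mono) (use pos in simp_all)
  also have "\<dots> = 3 / 2 * (\<eta>\<^sup>2 * \<rho> * lam * L\<^sup>2 * m\<^sup>2 * \<alpha>\<^sup>2 / (r * (K / P)))"
    unfolding \<delta>_eq k(2) e(2) using k(1) e(1) pos by (simp add: field_simps power2_eq_square)
  also have "\<dots> \<le> 6 * (\<eta>\<^sup>2 * \<rho> * lam * L\<^sup>2 * m\<^sup>2 * \<alpha>\<^sup>2 / (r * (K / P)))"
    using pos by (intro mult_right_mono) auto
  finally have t3: "\<rho> * (3 / 2 * lam * (Q * (L / G)\<^sup>2)) * (1 / n)
      \<le> 6 * \<eta>\<^sup>2 * \<rho> * lam * L\<^sup>2 * m\<^sup>2 * \<alpha>\<^sup>2 / (r * (K / P))"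
    by (simp only: mult.assoc times_divide_eq_right)
  have "\<rho> * ((\<delta> + \<rho> + 4 * lam) / \<rho> * D + (n * (2 * L\<^sub>f\<^sup>2 / \<delta>) + 3 / 2 * lam * (Q * (L / G)\<^sup>2))) / n
      = (\<delta> + \<rho> + 4 * lam) * D * (1 / n) + \<rho> * (2 * L\<^sub>f\<^sup>2 / \<delta>)
        + \<rho> * (3 / 2 * lam * (Q * (L / G)\<^sup>2)) * (1 / n)"
  proof -
    have "\<rho> * (u / \<rho> * D + (n * v + w)) / n = u * D * (1 / n) + \<rho> * v + \<rho> * w * (1 / n)" for u v w
      using pos by (simp add: distrib_left add_divide_distrib)
    then show ?thesis .
  qed
  with t1 t2 t3 show ?thesis
    unfolding k_def[symmetric] e_def[symmetric] by linarith
qed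

text \<open>
  For this threshold at most \<open>m K/T = r K/K\<^sup>\<beta>\<close> iterations are skipped, and \<open>\<eta> = K\<^sup>\<beta>/(K\<^sup>\<beta> - r)\<close> is
  the reciprocal of the fraction that remains.
\<close>

lemma card_timely_iterations:
  fixes \<beta> r \<eta> :: real
  assumes w: "\<And>k. k \<in> {1..K} \<Longrightarrow> w k < m" and K: "1 \<le> K" and r: "0 < r" "r < real K powr \<beta>"
    and T: "T = real m * real K powr \<beta> / r" and \<eta>: "\<eta> = 1 + r / (real K powr \<beta> - r)"
  shows "real K \<le> \<eta> * real (card {k \<in> {1..K}. real (delay w k) \<le> T})" and "0 < \<eta>" and "0 < T"
proof -
  let ?P = "real K powr \<beta>"
  have m: "0 < m"
    using w[of 1] K by simp
  have P: "0 < ?P"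
    using r by linarith
  show T_pos: "0 < T"
    unfolding T using m r(1) P by (intro divide_pos_pos mult_pos_pos) simp_all
  show \<eta>_pos: "0 < \<eta>"
    using r by (simp add: \<eta> add_pos_pos)
  have "real m * real K / T = real K * r / ?P"
    unfolding T using m r by simp
  moreover have "real K - real m * real K / T \<le> real (card {k \<in> {1..K}. real (delay w k) \<le> T})"
    by (rule card_delay_le_threshold[OF w T_pos])
  ultimately have "real K - real K * r / ?P \<le> real (card {k \<in> {1..K}. real (delay w k) \<le> T})"
    by (simp only:)
  then have "\<eta> * (real K - real K * r / ?P) \<le> \<eta> * real (card {k \<in> {1..K}. real (delay w k) \<le> T})"
    using \<eta>_pos by (intro mult_left_mono) auto
  moreover have "\<eta> * (real K - real K * r / ?P) = real K"
  proof -
    have "\<eta> = ?P / (?P - r)"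
      using r by (simp add: \<eta> field_simps)
    moreover have "real K - real K * r / ?P = real K * ((?P - r) / ?P)"
      using P by (simp add: diff_divide_distrib right_diff_distrib)
    ultimately show ?thesis
      using r P by simp
  qed
  ultimately show "real K \<le> \<eta> * real (card {k \<in> {1..K}. real (delay w k) \<le> T})"
    by simp
qed

theorem theorem5:
  fixes M :: "'o measure"
    and \<Xi> :: "'s measure"
    and h :: "real \<Rightarrow> real"
    and c :: "'a::euclidean_space \<Rightarrow> 's \<Rightarrow> real"
    and \<omega> :: "'a \<Rightarrow> ereal"
    and C\<^sub>\<xi> L\<^sub>\<xi> :: "'s \<Rightarrow> real"
    and C L\<^sub>c L\<^sub>h L\<^sub>\<omega> L\<^sub>f \<kappa> lam \<rho> r \<beta> \<alpha> \<eta> \<gamma> T :: real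
    and K m :: nat
    and w :: "nat \<Rightarrow> nat"
    and S :: "nat set"
    and \<xi> :: "nat \<Rightarrow> 'o \<Rightarrow> 's"
    and x1 :: 'a
    and x :: "nat \<Rightarrow> 'o \<Rightarrow> 'a"
    and kstar :: "'o \<Rightarrow> nat"
    and \<psi> :: "'a \<Rightarrow> ereal"
    and D :: ereal
  assumes "prob_space M" and "prob_space \<Xi>"
    \<comment> \<open>the regularizer\<close>
    and "\<And>y. \<omega> y \<noteq> -\<infinity>"
    and "lower_semicontinuous \<omega>"
    and "L\<^sub>\<omega>-lipschitz_on (edom \<omega>) (\<lambda>y. real_of_ereal (\<omega> y))"
    and "weakly_convex \<kappa> \<omega>"
    \<comment> \<open>the composite loss\<close>
    and "convex_on UNIV h" and "L\<^sub>h-lipschitz_on UNIV h"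
    and "\<And>y. c y \<in> borel_measurable \<Xi>"
    and "\<And>y. y \<in> edom \<omega> \<Longrightarrow> integrable \<Xi> (\<lambda>s. h (c y s))"
    and "\<And>s y. s \<in> space \<Xi> \<Longrightarrow> (\<lambda>u. c u s) differentiable (at y)"
    and "\<And>s. s \<in> space \<Xi> \<Longrightarrow> (C\<^sub>\<xi> s)-lipschitz_on UNIV (gradient (\<lambda>u. c u s))"
    and "\<And>s. s \<in> space \<Xi> \<Longrightarrow> (L\<^sub>\<xi> s)-lipschitz_on (edom \<omega>) (\<lambda>u. c u s)"
    and "C \<ge> 0" and "integrable \<Xi> (\<lambda>s. (C\<^sub>\<xi> s)\<^sup>2)" and "(\<integral>s. (C\<^sub>\<xi> s)\<^sup>2 \<partial>\<Xi>) \<le> C\<^sup>2"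
    and "L\<^sub>c \<ge> 0" and "integrable \<Xi> (\<lambda>s. (L\<^sub>\<xi> s)\<^sup>2)" and "(\<integral>s. (L\<^sub>\<xi> s)\<^sup>2 \<partial>\<Xi>) \<le> L\<^sub>c\<^sup>2"
    \<comment> \<open>the parameters\<close>
    and "L\<^sub>f = L\<^sub>h * L\<^sub>c" and "lam = L\<^sub>h * C"
    and "\<rho> > 2 * lam + \<kappa>" and "r > 0" and "\<alpha> > 0" and "K \<ge> 1"
    and "(\<beta> > 0 \<and> real K > r powr (1 / \<beta>)) \<or> (\<beta> = 0 \<and> r < 1)"
    and "T = real m * real K powr \<beta> / r"
    and "\<eta> = 1 + r / (real K powr \<beta> - r)"
    and "\<gamma> = sqrt (real K) / (\<alpha> * sqrt \<eta>) + \<rho> + \<kappa> + 6 * lam"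
    \<comment> \<open>the workers\<close>
    and "\<And>k. k \<in> {1..K} \<Longrightarrow> w k < m"
    \<comment> \<open>the samples and the iterates\<close>
    and "prob_space.indep_vars M (\<lambda>_. \<Xi>) \<xi> {1..K}"
    and "\<And>k. k \<in> {1..K} \<Longrightarrow> distr M \<Xi> (\<xi> k) = \<Xi>"
    and "x1 \<in> edom \<omega>"
    and "\<And>p. p \<in> space M \<Longrightarrow>
           safeguarded_dspl h c \<omega> \<gamma> T (delay w) K x1 (\<lambda>k. \<xi> k p) (\<lambda>k. x k p)"
    \<comment> \<open>the random index, drawn independently of the samples\<close>
    and "S = {k \<in> {1..K}. real (delay w k) \<le> T}"
    and "prob_space.indep_set M
           (sets (vimage_algebra (space M) kstar (count_space UNIV)))
           (sets (vimage_algebra (space M) (\<lambda>p. \<lambda>k\<in>{1..K}. \<xi> k p) (\<Pi>\<^sub>M k\<in>{1..K}. \<Xi>)))"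
    and "distr M (count_space UNIV) kstar = measure_pmf (pmf_of_set S)"
    \<comment> \<open>the objective and the initial gap\<close>
    and "\<psi> = objective \<Xi> h c \<omega>"
    and "D = moreau_envelope \<rho> \<psi> x1 - (INF y. \<psi> y)"
  shows "enn2ereal (\<integral>\<^sup>+p. ennreal
             ((norm (gradient (\<lambda>y. real_of_ereal (moreau_envelope \<rho> \<psi> y)) (x (kstar p) p)))\<^sup>2) \<partial>M)
         \<le> ereal (2 * \<rho> / (\<rho> - 2 * lam - \<kappa>)) *
             (ereal (\<eta> * (\<rho> + 4 * lam) / real K) * D
              + ereal (sqrt \<eta> / (sqrt (real K) * \<alpha>)) * D
              + ereal (2 * sqrt \<eta> * \<rho> * L\<^sub>f\<^sup>2 * \<alpha> / sqrt (real K))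
              + ereal (6 * \<eta>\<^sup>2 * \<rho> * lam * (L\<^sub>f + L\<^sub>\<omega>)\<^sup>2 * (real m)\<^sup>2 * \<alpha>\<^sup>2
                       / (r * real K powr (1 - \<beta>))))"
proof -
  have problem: "composite_problem \<Xi> h c \<omega> C\<^sub>\<xi> L\<^sub>\<xi> C L\<^sub>c L\<^sub>h L\<^sub>\<omega> L\<^sub>f \<kappa> lam"
  proof (intro composite_problem.intro composite_problem_axioms.intro)
    show "edom \<omega> \<noteq> {}"
      using \<open>x1 \<in> edom \<omega>\<close> by blast
  qed fact+
  interpret composite_problem \<Xi> h c \<omega> C\<^sub>\<xi> L\<^sub>\<xi> C L\<^sub>c L\<^sub>h L\<^sub>\<omega> L\<^sub>f \<kappa> lam
    by (rule problem)
  let ?P = "real K powr \<beta>"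
  note \<rho> = \<open>\<rho> > 2 * lam + \<kappa>\<close>
    and workers = \<open>\<And>k. k \<in> {1..K} \<Longrightarrow> w k < m\<close>
    and T_eq = \<open>T = real m * real K powr \<beta> / r\<close>
    and \<eta>_eq = \<open>\<eta> = 1 + r / (real K powr \<beta> - r)\<close>
  have \<rho>_pos: "0 < \<rho>"
    using \<rho> lam_nonneg kappa_nonneg by simp
  have P: "r < ?P"
    using \<open>(\<beta> > 0 \<and> real K > r powr (1 / \<beta>)) \<or> (\<beta> = 0 \<and> r < 1)\<close>
  proof
    assume \<beta>: "\<beta> > 0 \<and> real K > r powr (1 / \<beta>)"
    then have "(r powr (1 / \<beta>)) powr \<beta> < ?P"
      using \<open>r > 0\<close> by (intro powr_less_mono2) auto
    then show ?thesis
      using \<beta> \<open>r > 0\<close> by (simp add: powr_powr)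
  next
    assume "\<beta> = 0 \<and> r < 1"
    then show ?thesis
      using \<open>K \<ge> 1\<close> by simp
  qed
  have S: "S \<subseteq> {1..K}" and S': "{k. k \<in> {1..K} \<and> real (delay w k) \<le> T} = S"
    using \<open>S = _\<close> by auto
  have timely: "real K \<le> \<eta> * real (card S)" "0 < \<eta>" "0 < T"
    unfolding S'[symmetric]
    by (rule card_timely_iterations[OF _ \<open>K \<ge> 1\<close> \<open>r > 0\<close> P T_eq \<eta>_eq], rule workers, assumption)+
  have fin: "finite S"
    using S by (rule finite_subset) simp
  have card_pos: "0 < real (card S)"
  proof (rule ccontr)
    assume "\<not> 0 < real (card S)"
    then have "real K \<le> 0"
      using timely(1) by simp
    then show False
      using \<open>K \<ge> 1\<close> by simp
  qed
  then have S_ne: "S \<noteq> {}"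
    by auto
  define \<delta> where "\<delta> = sqrt (real K) / (\<alpha> * sqrt \<eta>)"
  have \<delta>_pos: "0 < \<delta>"
    unfolding \<delta>_def using \<open>K \<ge> 1\<close> \<open>\<alpha> > 0\<close> timely(2) by simp
  have \<gamma>: "\<gamma> = \<delta> + \<rho> + \<kappa> + 6 * lam"
    using \<open>\<gamma> = _\<close> by (simp add: \<delta>_def)
  have \<delta>_eq: "\<delta> = \<gamma> - \<rho> - \<kappa> - 6 * lam"
    by (simp add: \<gamma>)
  have \<kappa>_less: "\<kappa> < \<gamma>"
    unfolding \<gamma> using \<delta>_pos \<rho>_pos lam_nonneg by simp
  \<comment> \<open>the last four facts describe the sampling, the starting point and the recursion\<close>
  have "dspl_run_axioms \<Xi> h c \<omega> \<kappa> M \<gamma> T (delay w) K x1 \<xi> x"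
    by (intro dspl_run_axioms.intro \<kappa>_less assms(31-34)) assumption+
  then interpret dspl_run \<Xi> h c \<omega> C\<^sub>\<xi> L\<^sub>\<xi> C L\<^sub>c L\<^sub>h L\<^sub>\<omega> L\<^sub>f \<kappa> lam M \<gamma> T "delay w" K x1 \<xi> x
    by (intro dspl_run.intro problem \<open>prob_space M\<close>)
  interpret O: prox_problem "edom \<omega>" obj "L\<^sub>f + L\<^sub>\<omega>" "lam + \<kappa>" \<rho>
    by (rule prox_problem_obj[OF \<rho>])
  let ?grad = "\<lambda>y. gradient (\<lambda>y. real_of_ereal (moreau_envelope \<rho> \<psi> y)) y"
  let ?d = "\<lambda>y. (norm (prox \<rho> (edom \<omega>) obj y - y))\<^sup>2"
  define a where "a = (\<rho> - 2 * lam - \<kappa>) / 2"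
  have a: "0 < a"
    using \<rho> by (simp add: a_def)
  have grad: "(norm (?grad y))\<^sup>2 = \<rho>\<^sup>2 * ?d y" for y
    unfolding \<open>\<psi> = objective \<Xi> h c \<omega>\<close> by (rule norm_gradient_moreau_envelope[OF \<rho>])
  have prox_meas: "prox \<rho> (edom \<omega>) obj \<in> borel_measurable borel"
    by (rule borel_measurable_prox_obj[OF \<rho>])
  have psi: "\<psi> y = (if y \<in> edom \<omega> then ereal (obj y) else \<infinity>)" for y
    unfolding \<open>\<psi> = objective \<Xi> h c \<omega>\<close> by (rule objective_eq)
  have envelope: "moreau_envelope \<rho> \<psi> y = ereal (env \<rho> (edom \<omega>) obj y)" for y
    unfolding \<open>\<psi> = objective \<Xi> h c \<omega>\<close> by (rule moreau_envelope_eq[OF \<rho>])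
  have "(INF y. \<psi> y) \<le> \<psi> x1"
    by (rule INF_lower) simp
  then have "(INF y. \<psi> y) \<noteq> \<infinity>"
    using psi[of x1] \<open>x1 \<in> edom \<omega>\<close> by auto
  then consider (unbounded) "(INF y. \<psi> y) = -\<infinity>" | (bounded) i where "(INF y. \<psi> y) = ereal i"
    by (cases "INF y. \<psi> y") auto
  then show ?thesis
  proof cases
    \<comment> \<open>the initial gap is infinite, and so is the right-hand side\<close>
    case unbounded
    then have "D = \<infinity>"
      using \<open>D = _\<close> by (simp add: envelope)
    have pos: "0 < \<eta> * (\<rho> + 4 * lam) / real K" "0 < sqrt \<eta> / (sqrt (real K) * \<alpha>)"
      using timely(2) \<rho>_pos lam_nonneg \<open>K \<ge> 1\<close> \<open>\<alpha> > 0\<close> by simp_all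
    have pos': "0 < 2 * \<rho> / (\<rho> - 2 * lam - \<kappa>)"
      using \<rho> \<rho>_pos by simp
    have infinite: "ereal u * \<infinity> = \<infinity>" if "0 < u" for u
      using that by simp
    show ?thesis
      unfolding \<open>D = \<infinity>\<close> infinite[OF pos(1)] infinite[OF pos(2)] plus_ereal.simps infinite[OF pos']
      by simp
  next
    case bounded
    have lower: "i \<le> env \<rho> (edom \<omega>) obj y" for y
    proof -
      have "ereal i \<le> \<psi> (prox \<rho> (edom \<omega>) obj y)"
        unfolding bounded[symmetric] by (rule INF_lower) simp
      then have "i \<le> obj (prox \<rho> (edom \<omega>) obj y)"
        using O.prox_mem[of y] by (simp add: psi)
      also have "\<dots> \<le> env \<rho> (edom \<omega>) obj y"
        unfolding env_def using \<rho>_pos by simp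
      finally show ?thesis .
    qed
    define D\<^sub>r where "D\<^sub>r = env \<rho> (edom \<omega>) obj x1 - i"
    have D: "D = ereal D\<^sub>r" and D_nonneg: "0 \<le> D\<^sub>r"
      using \<open>D = _\<close> bounded lower[of x1] by (simp_all add: envelope D\<^sub>r_def)
    let ?Q = "\<Sum>k\<in>S. (real (delay w k))\<^sup>2"
    let ?B = "((L\<^sub>f + L\<^sub>\<omega>) / (\<gamma> - \<kappa> / 2))\<^sup>2"
    let ?R = "(\<gamma> - \<kappa> - 2 * lam) / \<rho> * D\<^sub>r + (real (card S) * (2 * L\<^sub>f\<^sup>2 / \<delta>) + 3 / 2 * lam * (?Q * ?B))"
    have R_nonneg: "0 \<le> ?R"
    proof -
      have "0 \<le> (\<gamma> - \<kappa> - 2 * lam) / \<rho>"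
        unfolding \<gamma> using \<delta>_pos \<rho>_pos lam_nonneg by simp
      then show ?thesis
        using D_nonneg \<delta>_pos lam_nonneg by (intro add_nonneg_nonneg mult_nonneg_nonneg sum_nonneg) auto
    qed
    have "(\<Sum>k\<in>S. 2 * L\<^sub>f\<^sup>2 / \<delta> + 3 / 2 * lam * ((real (delay w k))\<^sup>2 * ?B))
        = real (card S) * (2 * L\<^sub>f\<^sup>2 / \<delta>) + 3 / 2 * lam * (?Q * ?B)"
      by (simp only: sum.distrib sum_constant sum_distrib_left sum_distrib_right)
    with sum_expected_prox_distance[OF \<rho> \<delta>_eq \<delta>_pos lower]
    have sum_le: "(\<Sum>k\<in>S. \<integral>\<^sup>+p. ennreal (a * ?d (x k p)) \<partial>M) \<le> ennreal ?R"
      unfolding S' a_def D\<^sub>r_def by simp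
    have d_meas: "(\<lambda>y. ennreal (\<rho>\<^sup>2 * ?d y)) \<in> borel_measurable borel"
      using prox_meas by measurable
    have "(\<integral>\<^sup>+p. ennreal ((norm (?grad (x (kstar p) p)))\<^sup>2) \<partial>M) = (\<integral>\<^sup>+p. ennreal (\<rho>\<^sup>2 * ?d (x (kstar p) p)) \<partial>M)"
      by (simp only: grad)
    also have "\<dots> = (\<Sum>k\<in>S. \<integral>\<^sup>+p. ennreal (\<rho>\<^sup>2 * ?d (x k p)) \<partial>M) / of_nat (card S)"
      by (rule expectation_at_random_iterate[OF d_meas S S_ne]) fact+
    also have "(\<Sum>k\<in>S. \<integral>\<^sup>+p. ennreal (\<rho>\<^sup>2 * ?d (x k p)) \<partial>M)
        = ennreal (\<rho>\<^sup>2 / a) * (\<Sum>k\<in>S. \<integral>\<^sup>+p. ennreal (a * ?d (x k p)) \<partial>M)"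
      unfolding sum_distrib_left
    proof (rule sum.cong[OF refl])
      fix k assume "k \<in> S"
      then have k: "k \<in> {1..Suc K}" using S by auto
      have meas: "(\<lambda>p. ennreal (a * ?d (x k p))) \<in> borel_measurable M"
        using x_measurable[OF k] measurable_compose[OF x_measurable[OF k] prox_meas] by measurable
      have "ennreal (\<rho>\<^sup>2 * ?d (x k p)) = ennreal (\<rho>\<^sup>2 / a) * ennreal (a * ?d (x k p))" for p
        using a by (simp flip: ennreal_mult)
      then show "(\<integral>\<^sup>+p. ennreal (\<rho>\<^sup>2 * ?d (x k p)) \<partial>M) = ennreal (\<rho>\<^sup>2 / a) * (\<integral>\<^sup>+p. ennreal (a * ?d (x k p)) \<partial>M)"
        by (simp only: nn_integral_cmult[OF meas])
    qed
    also have "ennreal (\<rho>\<^sup>2 / a) * (\<Sum>k\<in>S. \<integral>\<^sup>+p. ennreal (a * ?d (x k p)) \<partial>M) / of_nat (card S)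
        \<le> ennreal (\<rho>\<^sup>2 / a) * ennreal ?R / of_nat (card S)"
      by (intro divide_right_mono_ennreal mult_left_mono sum_le) simp
    also have "\<dots> = ennreal (\<rho>\<^sup>2 / a * ?R / real (card S))"
      using a card_pos R_nonneg
      by (simp only: ennreal_of_nat_eq_real_of_nat divide_ennreal ennreal_mult[symmetric]
          mult_nonneg_nonneg divide_nonneg_pos zero_le_power2)
    finally have bound: "(\<integral>\<^sup>+p. ennreal ((norm (?grad (x (kstar p) p)))\<^sup>2) \<partial>M)
        \<le> ennreal (\<rho>\<^sup>2 / a * ?R / real (card S))" .
    have coeff: "\<gamma> - \<kappa> - 2 * lam = \<delta> + \<rho> + 4 * lam"
      by (simp add: \<gamma>)
    let ?E = "\<eta> * (\<rho> + 4 * lam) / real K * D\<^sub>r + sqrt \<eta> / (sqrt (real K) * \<alpha>) * D\<^sub>r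
        + 2 * sqrt \<eta> * \<rho> * L\<^sub>f\<^sup>2 * \<alpha> / sqrt (real K)
        + 6 * \<eta>\<^sup>2 * \<rho> * lam * (L\<^sub>f + L\<^sub>\<omega>)\<^sup>2 * (real m)\<^sup>2 * \<alpha>\<^sup>2 / (r * real K powr (1 - \<beta>))"
    have "\<rho> * ((\<delta> + \<rho> + 4 * lam) / \<rho> * D\<^sub>r
          + (real (card S) * (2 * L\<^sub>f\<^sup>2 / \<delta>) + 3 / 2 * lam * (?Q * ?B))) / real (card S)
        \<le> \<eta> * (\<rho> + 4 * lam) / real K * D\<^sub>r + sqrt \<eta> / (sqrt (real K) * \<alpha>) * D\<^sub>r
        + 2 * sqrt \<eta> * \<rho> * L\<^sub>f\<^sup>2 * \<alpha> / sqrt (real K)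
        + 6 * \<eta>\<^sup>2 * \<rho> * lam * (L\<^sub>f + L\<^sub>\<omega>)\<^sup>2 * (real m)\<^sup>2 * \<alpha>\<^sup>2 / (r * (real K / ?P))"
    proof (rule rate_arithmetic)
      show "\<delta> \<le> \<gamma> - \<kappa> / 2"
        unfolding \<gamma> using \<rho>_pos lam_nonneg kappa_nonneg by simp
      have "?Q \<le> T * (real m * real K)"
        by (rule sum_delay_squares_le[of K w m T, unfolded S']) (use workers timely(3) in simp_all)
      also have "\<dots> = (real m)\<^sup>2 * real K * ?P / r"
        unfolding T_eq by (simp add: power2_eq_square)
      finally show "?Q \<le> (real m)\<^sup>2 * real K * ?P / r" .
      show "0 \<le> ?Q" by (rule sum_nonneg) simp
      show "0 < ?P" using P \<open>r > 0\<close> by linarith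
    qed (use \<open>K \<ge> 1\<close> \<open>\<alpha> > 0\<close> \<open>r > 0\<close> timely card_pos \<rho>_pos lam_nonneg D_nonneg \<delta>_def in simp_all)
    also have "real K / ?P = real K powr (1 - \<beta>)"
      using \<open>K \<ge> 1\<close> by (simp add: powr_diff)
    finally have E_bound: "\<rho> * ?R / real (card S) \<le> ?E"
      unfolding coeff .
    from mult_left_mono[OF E_bound, of "2 * \<rho> / (\<rho> - 2 * lam - \<kappa>)"]
    have "2 * \<rho> / (\<rho> - 2 * lam - \<kappa>) * (\<rho> * ?R / real (card S)) \<le> 2 * \<rho> / (\<rho> - 2 * lam - \<kappa>) * ?E"
      using \<rho> \<rho>_pos by simp
    moreover have "2 * \<rho> / (\<rho> - 2 * lam - \<kappa>) * (\<rho> * ?R / real (card S)) = \<rho>\<^sup>2 / a * ?R / real (card S)"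
      unfolding a_def by (simp add: power2_eq_square)
    ultimately have "\<rho>\<^sup>2 / a * ?R / real (card S) \<le> 2 * \<rho> / (\<rho> - 2 * lam - \<kappa>) * ?E"
      by (simp only:)
    with bound have "(\<integral>\<^sup>+p. ennreal ((norm (?grad (x (kstar p) p)))\<^sup>2) \<partial>M)
        \<le> ennreal (2 * \<rho> / (\<rho> - 2 * lam - \<kappa>) * ?E)"
      by (meson ennreal_leI order.trans)
    moreover have "0 \<le> 2 * \<rho> / (\<rho> - 2 * lam - \<kappa>) * ?E"
    proof (rule mult_nonneg_nonneg)
      have "0 \<le> \<rho> * ?R / real (card S)"
        using R_nonneg \<rho>_pos by (intro divide_nonneg_nonneg mult_nonneg_nonneg) simp_all
      then show "0 \<le> ?E"
        using E_bound by (rule order.trans)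
    qed (use \<rho> \<rho>_pos in simp)
    ultimately have "enn2ereal (\<integral>\<^sup>+p. ennreal ((norm (?grad (x (kstar p) p)))\<^sup>2) \<partial>M)
        \<le> ereal (2 * \<rho> / (\<rho> - 2 * lam - \<kappa>) * ?E)"
      unfolding less_eq_ennreal.rep_eq by (simp only: enn2ereal_ennreal)
    then show ?thesis
      unfolding D times_ereal.simps plus_ereal.simps .
  qed
qed

end
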